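(* There exists an absolute constant $c_2>0$ such that the following holds for every $n\geq 2$. Let $K$ be a convex body in $\mathbb{R}^n$. If $K$ is in the minimal surface area, isotropic or John's position, or it is symmetric and in Löwner's position, then $$|K|^{\frac{1}{n}}\,\int_{S^{n-1}}S(P_{\xi^{\perp}}(K))\,d\sigma(\xi)\leq c_2\sqrt{n}\,S(K).$$
   Context: A convex body in $\mathbb{R}^n$ is a compact convex set with non-empty interior; $K$ is symmetric if $K=-K$, and centered if its barycenter is at the origin. $|\cdot|$ denotes volume, $\sigma$ is the rotationally invariant probability measure on the Euclidean unit sphere $S^{n-1}$, and $P_{\xi^{\perp}}$ is the orthogonal projection onto the hyperplane $\xi^{\perp}$. $S(A)$ is the surface area of a convex body $A$; $P_{\xi^\perp}(K)$ is regarded as a convex body in the $(n-1)$-dimensional Euclidean space $\xi^\perp$, and its surface area is taken there. In dimension $m$ one has $S(A)=mV((A,m-1),(B_2^m,1))$ (a mixed volume, $B_2^m$ the Euclidean unit ball); in particular the surface area of a segment in a one-dimensional space is $2$. Positions: $K$ is in the minimal surface area position if $S(K)\leq S(T(K))$ for every $T\in SL(n)$. $K$ is in the isotropic position if it is centered, has volume $1$, and there is a constant $L_K>0$ with $\int_K\langle x,\xi\rangle^2dx=L_K^2$ for every $\xi\in S^{n-1}$ (equivalently, $\int_K\|x\|_2^2dx\leq\int_{T(K)}\|x\|_2^2dx$ for every $T\in SL(n)$). $K$ is in John's position if the ellipsoid of maximal volume inscribed in $K$ is a multiple of the Euclidean unit ball $B_2^n$. $K$ is in Löwner's position if the ellipsoid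 of minimal volume containing $K$ is a multiple of $B_2^n$. "Absolute constant" means a constant independent of $n$ and of $K$. *)

theory Defs
  imports
    "Jordan_Normal_Form.Determinant"
    "HOL-Library.Poly_Mapping"
    "HOL-Analysis.Analysis"
begin

text \<open>
  The constant in the theorem must not depend on the dimension, so the dimension has to be
  quantified below the constant, which rules out spaces whose dimension is a type.
  We work in the inner product space \<open>nat \<Rightarrow>\<^sub>0 real\<close> of finitely
  supported real sequences and let \<open>\<real>\<^sup>n\<close> be its coordinate subspace \<open>Rn n\<close>.
  All geometric notions are defined relative to a finite-dimensional subspace \<open>E\<close> of a real
  inner product space, so that they apply both to \<open>Rn n\<close> and to its hyperplanes.
\<close>

section \<open>Finitely supported functions as an inner product space\<close>

instantiation poly_mapping :: (type, real_vector) real_vector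
begin

definition scaleR_poly_mapping :: "real \<Rightarrow> ('a \<Rightarrow>\<^sub>0 'b) \<Rightarrow> ('a \<Rightarrow>\<^sub>0 'b)"
  where "scaleR_poly_mapping r f = Poly_Mapping.map (scaleR r) f"

lemma lookup_scaleR [simp]:
  "Poly_Mapping.lookup (r *\<^sub>R f) k = r *\<^sub>R Poly_Mapping.lookup f k"
  by (simp add: scaleR_poly_mapping_def Poly_Mapping.map.rep_eq when_def)

instance
  by standard
    (auto intro!: poly_mapping_eqI simp: lookup_add scaleR_add_right scaleR_add_left)

end

instantiation poly_mapping :: (type, real_inner) real_inner
begin

definition inner_poly_mapping :: "('a \<Rightarrow>\<^sub>0 'b) \<Rightarrow> ('a \<Rightarrow>\<^sub>0 'b) \<Rightarrow> real"
  where "inner_poly_mapping f g =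
    (\<Sum>k\<in>Poly_Mapping.keys f. inner (Poly_Mapping.lookup f k) (Poly_Mapping.lookup g k))"

definition norm_poly_mapping :: "('a \<Rightarrow>\<^sub>0 'b) \<Rightarrow> real"
  where "norm_poly_mapping f = sqrt (inner f f)"

definition sgn_poly_mapping :: "('a \<Rightarrow>\<^sub>0 'b) \<Rightarrow> ('a \<Rightarrow>\<^sub>0 'b)"
  where "sgn_poly_mapping f = f /\<^sub>R norm f"

definition dist_poly_mapping :: "('a \<Rightarrow>\<^sub>0 'b) \<Rightarrow> ('a \<Rightarrow>\<^sub>0 'b) \<Rightarrow> real"
  where "dist_poly_mapping f g = norm (f - g)"

definition uniformity_poly_mapping :: "(('a \<Rightarrow>\<^sub>0 'b) \<times> ('a \<Rightarrow>\<^sub>0 'b)) filter"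
  where "uniformity_poly_mapping = (INF e\<in>{0<..}. principal {(f, g). dist f g < e})"

definition open_poly_mapping :: "('a \<Rightarrow>\<^sub>0 'b) set \<Rightarrow> bool"
  where "open_poly_mapping U \<longleftrightarrow> (\<forall>x\<in>U. \<forall>\<^sub>F (x', y) in uniformity. x' = x \<longrightarrow> y \<in> U)"

lemma inner_poly_mapping_superset:
  assumes "finite I" "Poly_Mapping.keys f \<subseteq> I"
  shows "inner f g =
    (\<Sum>k\<in>I. inner (Poly_Mapping.lookup f k) (Poly_Mapping.lookup g k))"
  unfolding inner_poly_mapping_def using assms
  by (intro sum.mono_neutral_left) (auto simp: in_keys_iff)

instance
proof
  fix f g h :: "'a \<Rightarrow>\<^sub>0 'b" and r :: real
  let ?I = "Poly_Mapping.keys f \<union> Poly_Mapping.keys g"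
  note sup = inner_poly_mapping_superset[of ?I]
  show "inner f g = inner g f"
    by (simp add: sup inner_commute)
  have "Poly_Mapping.keys (f + g) \<subseteq> ?I"
    by (rule keys_add)
  then show "inner (f + g) h = inner f h + inner g h"
    by (simp add: sup lookup_add inner_add_left sum.distrib)
  have "Poly_Mapping.keys (r *\<^sub>R f) \<subseteq> Poly_Mapping.keys f"
    by (auto simp: in_keys_iff)
  then show "inner (r *\<^sub>R f) g = r * inner f g"
    by (simp add: inner_poly_mapping_superset[of "Poly_Mapping.keys f"] sum_distrib_left)
  show "0 \<le> inner f f"
    by (simp add: inner_poly_mapping_def sum_nonneg)
  show "inner f f = 0 \<longleftrightarrow> f = 0"
    by (auto simp: inner_poly_mapping_def sum_nonneg_eq_0_iff in_keys_iff
        intro!: poly_mapping_eqI)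
qed (simp_all add: norm_poly_mapping_def sgn_poly_mapping_def dist_poly_mapping_def
      uniformity_poly_mapping_def open_poly_mapping_def)

end

lemma norm_single: "norm (Poly_Mapping.single k v) = norm v"
  for v :: "'b::real_inner"
  by (cases "v = 0") (auto simp: norm_eq_sqrt_inner inner_poly_mapping_def)

instance poly_mapping ::
  (countable, "{real_inner, second_countable_topology}") second_countable_topology
proof
  obtain D :: "'b set" where D: "countable D" "\<And>X. open X \<Longrightarrow> X \<noteq> {} \<Longrightarrow> \<exists>d\<in>D. d \<in> X"
    using countable_dense_exists by blast
  define S :: "('a \<Rightarrow>\<^sub>0 'b) set" where
    "S = (\<lambda>xs. \<Sum>(k, v)\<leftarrow>xs. Poly_Mapping.single k v) ` lists (UNIV \<times> D)"
  have S: "countable S"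
    unfolding S_def using D(1) by (intro countable_image countable_lists countable_SIGMA) auto
  have dense: "\<exists>d\<in>S. dist d f < e" if "e > 0" for f and e :: real
    using that
  proof (induction f arbitrary: e rule: update_induct)
    case const
    have "0 \<in> S" unfolding S_def by (rule image_eqI[of _ _ "[]"]) auto
    then show ?case using const by (intro bexI[of _ 0]) auto
  next
    case (update f a b)
    obtain d where d: "d \<in> S" "dist d f < e / 2"
      using update.IH[of "e / 2"] update.prems by auto
    obtain v where v: "v \<in> D" "dist b v < e / 2"
      using D(2)[of "ball b (e / 2)"] update.prems by auto
    have eq: "Poly_Mapping.update a b f = Poly_Mapping.single a b + f"
      using update.hyps
      by (intro poly_mapping_eqI)
        (auto simp: lookup_update lookup_add lookup_single in_keys_iff when_def)
    from d(1) obtain xs where xs: "xs \<in> lists (UNIV \<times> D)"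
      "d = (\<Sum>(k, v)\<leftarrow>xs. Poly_Mapping.single k v)"
      by (auto simp: S_def)
    have "Poly_Mapping.single a v + d \<in> S"
      unfolding S_def by (rule image_eqI[of _ _ "(a, v) # xs"]) (use xs v in auto)
    moreover have "dist (Poly_Mapping.single a v + d) (Poly_Mapping.update a b f) < e"
    proof -
      have "dist (Poly_Mapping.single a v + d) (Poly_Mapping.update a b f)
        = norm (Poly_Mapping.single a (v - b) + (d - f))"
        by (simp add: eq dist_norm algebra_simps single_diff)
      also have "\<dots> \<le> norm (v - b) + norm (d - f)"
        by (metis norm_triangle_ineq norm_single)
      also have "\<dots> < e" using d v by (simp add: dist_norm norm_minus_commute)
      finally show ?thesis .
    qed
    ultimately show ?case by blast
  qed
  have "topological_basis ((\<lambda>(d, m). ball d (1 / Suc m)) ` (S \<times> (UNIV :: nat set)))"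
  proof (rule topological_basisI)
    fix U and x :: "'a \<Rightarrow>\<^sub>0 'b"
    assume "open U" "x \<in> U"
    then obtain e where e: "e > 0" "ball x e \<subseteq> U"
      using open_contains_ball by blast
    obtain m where m: "1 / Suc m < e / 2"
      using e(1) nat_approx_posE[of "e / 2"] by auto
    obtain d where d: "d \<in> S" "dist d x < 1 / Suc m"
      using dense[of "1 / Suc m" x] by auto
    have "ball d (1 / Suc m) \<subseteq> ball x e"
    proof
      fix y assume "y \<in> ball d (1 / Suc m)"
      then show "y \<in> ball x e"
        using d(2) m dist_triangle[of x y d] by (simp add: dist_commute)
    qed
    with d e show "\<exists>B'\<in>(\<lambda>(d, m). ball d (1 / Suc m)) ` (S \<times> (UNIV :: nat set)). x \<in> B' \<and> B' \<subseteq> U"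
      by (intro bexI[of _ "ball d (1 / Suc m)"]) auto
  qed auto
  from topological_basis_imp_subbasis[OF this]
  show "\<exists>B :: ('a \<Rightarrow>\<^sub>0 'b) set set. countable B \<and> open = generate_topology B"
    by (intro exI conjI) (use S in simp_all)
qed

definition Rn :: "nat \<Rightarrow> (nat \<Rightarrow>\<^sub>0 real) set"
  where "Rn n = {x. Poly_Mapping.keys x \<subseteq> {..<n}}"

lemma subspace_Rn: "subspace (Rn n)"
proof (rule subspaceI)
  show "0 \<in> Rn n" by (simp add: Rn_def)
  show "x + y \<in> Rn n" if "x \<in> Rn n" "y \<in> Rn n" for x y
    using that keys_add[of x y] unfolding Rn_def by blast
  show "r *\<^sub>R x \<in> Rn n" if "x \<in> Rn n" for r x
    using that unfolding Rn_def by (auto simp: in_keys_iff)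
qed

lemma Rn_eq_span: "Rn n = span ((\<lambda>i. Poly_Mapping.single i 1) ` {..<n})"
proof
  show "span ((\<lambda>i. Poly_Mapping.single i 1) ` {..<n}) \<subseteq> Rn n"
    by (intro span_minimal subspace_Rn) (auto simp: Rn_def)
  show "Rn n \<subseteq> span ((\<lambda>i. Poly_Mapping.single i 1) ` {..<n})"
  proof
    fix x :: "nat \<Rightarrow>\<^sub>0 real" assume x: "x \<in> Rn n"
    have "x = (\<Sum>i<n. Poly_Mapping.lookup x i *\<^sub>R Poly_Mapping.single i 1)"
    proof (rule poly_mapping_eqI)
      fix k
      show "Poly_Mapping.lookup x k =
        Poly_Mapping.lookup (\<Sum>i<n. Poly_Mapping.lookup x i *\<^sub>R Poly_Mapping.single i 1) k"
        using x by (cases "k < n")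
          (auto simp: Rn_def lookup_sum lookup_single when_def in_keys_iff if_distrib
            sum.delta intro: ccontr cong: if_cong)
    qed
    also have "\<dots> \<in> span ((\<lambda>i. Poly_Mapping.single i 1) ` {..<n})"
      by (intro span_sum span_scale span_base) auto
    finally show "x \<in> span ((\<lambda>i. Poly_Mapping.single i 1) ` {..<n})" .
  qed
qed

lemma dim_Rn: "dim (Rn n) = n"
proof -
  let ?B = "(\<lambda>i. Poly_Mapping.single i (1::real)) ` {..<n}"
  have "pairwise orthogonal ?B"
    by (auto simp: pairwise_def orthogonal_def inner_poly_mapping_def lookup_single when_def)
  moreover have "0 \<notin> ?B"
  proof
    assume "0 \<in> ?B"
    then obtain i :: nat where "0 = Poly_Mapping.single i (1::real)"
      by (elim imageE) blast
    then have "norm (Poly_Mapping.single i (1::real)) = 0" by simp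
    then show False by (simp add: norm_single)
  qed
  ultimately have "independent ?B"
    by (rule pairwise_orthogonal_independent)
  moreover have "inj_on (\<lambda>i. Poly_Mapping.single i (1::real)) {..<n}"
  proof (rule inj_onI)
    fix i j :: nat
    assume "Poly_Mapping.single i (1::real) = Poly_Mapping.single j 1"
    then have "Poly_Mapping.lookup (Poly_Mapping.single i (1::real)) i =
      Poly_Mapping.lookup (Poly_Mapping.single j 1) i" by (rule arg_cong)
    then show "i = j" by (simp add: lookup_single when_def split: if_splits)
  qed
  then have "card ?B = n" by (simp add: card_image)
  ultimately show ?thesis
    unfolding Rn_eq_span by (metis dim_span dim_eq_card_independent)
qed


section \<open>Orthonormal bases and Lebesgue measure of a subspace\<close>

definition is_onb :: "'a::real_inner set \<Rightarrow> (nat \<Rightarrow> 'a) \<Rightarrow> bool"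
  where "is_onb E b \<longleftrightarrow>
    (\<forall>i<dim E. \<forall>j<dim E. inner (b i) (b j) = (if i = j then 1 else 0)) \<and>
    span (b ` {..<dim E}) = E"

definition onb :: "'a::real_inner set \<Rightarrow> nat \<Rightarrow> 'a"
  where "onb E = (SOME b. is_onb E b)"

lemma is_onb_onb:
  fixes E :: "'a::real_inner set"
  assumes "subspace E" "finite B" "span B = E"
  shows "is_onb E (onb E)"
proof -
  obtain B' where B': "B' \<subseteq> B" "independent B'" "span B' = E"
    using assms by (metis maximal_independent_subset span_eq subset_trans)
  then have fin: "finite B'" and card: "card B' = dim E"
    using assms(2) finite_subset dim_eq_card[of B' E] by (auto simp: span_span)
  obtain C where C: "finite C" "card C \<le> card B'" "span C = span B'" "pairwise orthogonal C"
    using basis_orthogonal[OF fin] by blast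
  have "dim E \<le> card C"
    using C B' dim_le_card[of E C] by simp
  then have cardC: "card C = dim E" using C card by simp
  have zero: "0 \<notin> C"
  proof
    assume "0 \<in> C"
    then have "dim E \<le> card (C - {0})"
      using C B' by (intro dim_le_card) (auto simp: span_delete_0)
    with \<open>0 \<in> C\<close> cardC C(1) show False
      by (metis card_Diff1_less not_le)
  qed
  obtain g where g: "bij_betw g {..<dim E} C"
    using ex_bij_betw_nat_finite[OF C(1)] cardC by (auto simp: atLeast0LessThan)
  define b where "b i = g i /\<^sub>R norm (g i)" for i
  have gC: "g i \<in> C" if "i < dim E" for i
    using g that by (auto simp: bij_betw_def)
  have "inner (b i) (b j) = (if i = j then 1 else 0)" if "i < dim E" "j < dim E" for i j
  proof (cases "i = j")
    case True
    have "g i \<noteq> 0" using gC[OF that(1)] zero by auto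
    then show ?thesis
      using True by (simp add: b_def norm_eq_sqrt_inner field_simps)
  next
    case False
    then have "g i \<noteq> g j"
      using g that by (auto simp: bij_betw_def inj_on_def)
    then have "inner (g i) (g j) = 0"
      using C(4) gC that by (auto simp: pairwise_def orthogonal_def)
    then show ?thesis using False by (simp add: b_def)
  qed
  moreover have "span (b ` {..<dim E}) = E"
  proof -
    have "b ` {..<dim E} = (\<lambda>x. (1 / norm x) *\<^sub>R x) ` C"
      using g by (auto simp: bij_betw_def b_def divide_inverse)
    also have "span \<dots> = span C"
      using zero C(1) by (intro span_image_scale) auto
    finally show ?thesis using C B' by simp
  qed
  ultimately have "is_onb E b" by (simp add: is_onb_def)
  then show ?thesis unfolding onb_def by (rule someI[of "is_onb E"])
qed

text \<open>Lebesgue measure does not depend on the orthonormal basis used to identify \<open>E\<close> with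
  coordinate space. As a measure on the whole type it is concentrated on \<open>E\<close>.\<close>

definition lborel_on :: "'a::real_inner set \<Rightarrow> 'a measure"
  where "lborel_on E =
    distr (\<Pi>\<^sub>M i\<in>{..<dim E}. lborel) borel (\<lambda>c. \<Sum>i<dim E. c i *\<^sub>R onb E i)"

lemma measurable_onb_coords [measurable]:
  fixes E :: "'a::{real_inner, second_countable_topology} set"
  shows "(\<lambda>c. \<Sum>i<dim E. c i *\<^sub>R onb E i) \<in> (\<Pi>\<^sub>M i\<in>{..<dim E}. lborel) \<rightarrow>\<^sub>M borel"
  by measurable

definition vol :: "'a::real_inner set \<Rightarrow> 'a set \<Rightarrow> real"
  where "vol E A = measure (lborel_on E) A"

text \<open>The image of the uniform distribution on the unit ball of \<open>E\<close> under
  \<open>x \<mapsto> x / \<parallel>x\<parallel>\<close>: the rotationally invariant probability measure on the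
  unit sphere of \<open>E\<close>.\<close>

definition sphere_measure :: "'a::real_inner set \<Rightarrow> 'a measure"
  where "sphere_measure E = distr (uniform_measure (lborel_on E) (cball 0 1)) borel sgn"


section \<open>Convex bodies, surface area and projections\<close>

definition convex_body :: "'a::real_inner set \<Rightarrow> 'a set \<Rightarrow> bool"
  where "convex_body E K \<longleftrightarrow>
    K \<subseteq> E \<and> compact K \<and> convex K \<and> top_of_set E interior_of K \<noteq> {}"

text \<open>Minkowski's definition of surface area; by the polynomial expansion of
  \<open>t \<mapsto> |A + t B|\<close>, with \<open>B\<close> the unit ball of \<open>E\<close> and \<open>m = dim E\<close>,
  the limit is the mixed volume \<open>m V((A, m - 1), (B, 1))\<close>.\<close>

definition surface_area :: "'a::real_inner set \<Rightarrow> 'a set \<Rightarrow> real"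
  where "surface_area E A =
    Lim (at_right 0)
      (\<lambda>t. (vol E {x + t *\<^sub>R u | x u. x \<in> A \<and> u \<in> E \<and> norm u \<le> 1} - vol E A) / t)"

definition perp :: "'a::real_inner set \<Rightarrow> 'a \<Rightarrow> 'a set"
  where "perp E \<xi> = E \<inter> {\<xi>}\<^sup>\<bottom>"

definition perp_proj :: "'a::real_inner \<Rightarrow> 'a \<Rightarrow> 'a"
  where "perp_proj \<xi> x = x - (inner x \<xi> / inner \<xi> \<xi>) *\<^sub>R \<xi>"


section \<open>Positions\<close>

text \<open>Only the restriction of \<open>T\<close> to \<open>E\<close> matters; \<open>det_on E T\<close> is
  the determinant of this restriction.\<close>

definition det_on :: "'a::real_inner set \<Rightarrow> ('a \<Rightarrow> 'a) \<Rightarrow> real"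
  where "det_on E T =
    Determinant.det (Matrix.mat (dim E) (dim E) (\<lambda>(i, j). inner (onb E i) (T (onb E j))))"

definition SL_on :: "'a::real_inner set \<Rightarrow> ('a \<Rightarrow> 'a) set"
  where "SL_on E = {T. linear T \<and> T ` E \<subseteq> E \<and> det_on E T = 1}"

definition minimal_surface_area_position :: "'a::real_inner set \<Rightarrow> 'a set \<Rightarrow> bool"
  where "minimal_surface_area_position E K \<longleftrightarrow>
    (\<forall>T\<in>SL_on E. surface_area E K \<le> surface_area E (T ` K))"

text \<open>The barycenter is characterised by its inner products, since \<open>'a\<close> need not be complete
  as Bochner integrals of vectors require.\<close>

definition centered :: "'a::real_inner set \<Rightarrow> 'a set \<Rightarrow> bool"
  where "centered E K \<longleftrightarrow> (\<forall>\<xi>\<in>E. (LINT x:K|lborel_on E. inner x \<xi>) = 0)"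

definition isotropic_position :: "'a::real_inner set \<Rightarrow> 'a set \<Rightarrow> bool"
  where "isotropic_position E K \<longleftrightarrow>
    centered E K \<and> vol E K = 1 \<and>
    (\<exists>L>0. \<forall>\<xi>\<in>E. norm \<xi> = 1 \<longrightarrow> (LINT x:K|lborel_on E. (inner x \<xi>)\<^sup>2) = L\<^sup>2)"

definition ellipsoids :: "'a::real_inner set \<Rightarrow> 'a set set"
  where "ellipsoids E =
    {(\<lambda>x. a + T x) ` (E \<inter> cball 0 1) | a T. a \<in> E \<and> linear T \<and> T ` E = E}"

definition john_position :: "'a::real_inner set \<Rightarrow> 'a set \<Rightarrow> bool"
  where "john_position E K \<longleftrightarrow>
    (\<exists>r>0. is_arg_max (vol E) (\<lambda>D. D \<in> ellipsoids E \<and> D \<subseteq> K) (E \<inter> cball 0 r))"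

definition loewner_position :: "'a::real_inner set \<Rightarrow> 'a set \<Rightarrow> bool"
  where "loewner_position E K \<longleftrightarrow>
    (\<exists>r>0. is_arg_min (vol E) (\<lambda>D. D \<in> ellipsoids E \<and> K \<subseteq> D) (E \<inter> cball 0 r))"

definition symmetric :: "'a::real_inner set \<Rightarrow> bool"
  where "symmetric K \<longleftrightarrow> K = uminus ` K"

end

(*
  Write K_t = K + t B, f(t) = |K_t|, and let A(t) be the average over xi in the sphere of the
  (n-1)-volume of the projection of K_t to the hyperplane orthogonal to xi.
  Cauchy's formula A(t) = kappa S(K_t), where kappa <= 1 / sqrt n is the mean of the positive part of
  a coordinate on the sphere, comes from |K + s[0,xi]| = |K| + s |P_xi K|: a point x outside K with
  nearest point p and outer normal u lies in K + s[0,xi] only if |x - p| <= s <xi,u>, and for K_t with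
  t > 0 the converse holds up to O(s^2); averaging over xi removes the dependence on u.
  By Prekopa-Leindler f is log-concave, hence S(K_t) <= f(t) S(K) / f(0), and Fatou's lemma gives
    integral of S(P_xi K) <= liminf (A(h) - A(0)) / h <= kappa S(K)^2 / |K|.
  It remains to see that S(K) <= C n |K|^(1 - 1/n) in each position. This holds if K contains a ball of
  radius |K|^(1/n) / C, which is shown directly for the isotropic position and, by shrinking the ellipsoid
  along a direction of small width, for symmetric bodies in Loewner's position. A linear image of K of
  the same volume is isotropic, so John's ellipsoid is at least as large as that ball, and in the minimal
  position S(K) is at most the surface area of the isotropic image.
*)
theory Submission
  imports Defs "HOL-Probability.Probability_Measure"
begin

section \<open>The Prekopa-Leindler inequality on the line\<close>

text \<open>The averaged bound kappa S(K)^2 / |K| contains S(K) twice. Replacing one copy by C n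
  |K|^(1 - 1/n) leaves C n kappa S(K) / |K|^(1/n), and n kappa <= sqrt n is the order claimed, so C
  itself is the constant. The obstacle is that K is arbitrary: no smoothness is available and S is
  only a one-sided derivative of f. Volumes of layers therefore stand in for boundary integrals, and
  the normal at x comes from a pointwise choice that is rotated away under the integral over xi
  before the order of integration is changed. In K_t with t > 0 every boundary point is touched from
  inside by a ball of radius t, which is where O(s^2) comes from. The derivative of A at 0 uses the
  upper half of Cauchy's formula at h and the lower half at 0; the latter is reached only by a
  limit. In the isotropic case, suppose <x, xi> <= d on K for a unit vector xi. Log-concave tails
  bound the second moment along xi by 84 d^2 |K|, whereas it is at least |K|^(1 + 2/n) / 288; the
  constant 160 is a round number above sqrt (84 * 288).\<close>

definition bounded_profile :: "('a::real_normed_vector \<Rightarrow> real) \<Rightarrow> bool"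
  where "bounded_profile f \<longleftrightarrow> f \<in> borel_measurable borel \<and> (\<forall>x. 0 \<le> f x) \<and>
    (\<exists>M R. \<forall>x. f x \<le> M * indicator (cball 0 R) x)"

lemma bounded_profileE:
  assumes "bounded_profile f"
  obtains M R where "M > 0" "R > 0" "\<And>x. f x \<le> M * indicator (cball 0 R) x"
proof -
  obtain M R where MR: "\<And>x. f x \<le> M * indicator (cball 0 R) x"
    using assms unfolding bounded_profile_def by blast
  have "f x \<le> max M 1 * indicator (cball 0 (max R 1)) x" for x
    using MR[of x] by (auto simp: indicator_def max_def split: if_splits)
  then show thesis by (intro that[of "max M 1" "max R 1"]) auto
qed

lemma bounded_profile_nonneg: "bounded_profile f \<Longrightarrow> 0 \<le> f x"
  by (auto simp: bounded_profile_def)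

lemma bounded_profile_measurable: "bounded_profile f \<Longrightarrow> f \<in> borel_measurable borel"
  by (auto simp: bounded_profile_def)

lemma weighted_am_gm:
  fixes a b l :: real
  assumes "0 < l" "l < 1" "a \<ge> 0" "b \<ge> 0"
  shows "a powr (1 - l) * b powr l \<le> (1 - l) * a + l * b"
proof (cases "a = 0 \<or> b = 0")
  case True
  then show ?thesis using assms by auto
next
  case False
  then show ?thesis using assms Youngs_inequality_0[of "1 - l" l a b] by auto
qed

lemma emeasure_lborel_vimage_affine:
  fixes c t :: real
  assumes [measurable]: "S \<in> sets borel" and c: "c > 0"
  shows "emeasure lborel S = ennreal c * emeasure lborel {x. t + c * x \<in> S}"
proof -
  have "emeasure lborel S = (\<integral>\<^sup>+x. indicator S x \<partial>lborel)" by simp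
  also have "\<dots> = ennreal c * (\<integral>\<^sup>+x. indicator S (t + c * x) \<partial>lborel)"
    using c by (subst nn_integral_real_affine[where c = c and t = t]) auto
  also have "(\<integral>\<^sup>+x. indicator S (t + c * x) \<partial>lborel) = (\<integral>\<^sup>+x. indicator {x. t + c * x \<in> S} x \<partial>lborel)"
    by (intro nn_integral_cong) (auto simp: indicator_def)
  also have "\<dots> = emeasure lborel {x. t + c * x \<in> S}"
    by (rule nn_integral_indicator) simp
  finally show ?thesis .
qed

text \<open>\<open>C\<close> contains a scaled copy of a left part of \<open>A\<close>, placed at a
  point \<open>b\<close> near the infimum of \<open>B\<close>, and a scaled copy of a right part of
  \<open>B\<close>, placed at a point \<open>a\<close> near the supremum of \<open>A\<close>. The
  copies meet at most in (1 - l) a + l b, so their lengths add. \<open>C\<close> is any Borel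
  superset because a sum of Borel sets need not be Borel.\<close>

lemma brunn_minkowski_real:
  fixes A B C :: "real set" and l :: real
  assumes l: "0 < l" "l < 1"
    and A[measurable]: "A \<in> sets borel" and B[measurable]: "B \<in> sets borel"
    and C[measurable]: "C \<in> sets borel"
    and ne: "A \<noteq> {}" "B \<noteq> {}" and bd: "bounded A" "bounded B"
    and sub: "\<And>a b. a \<in> A \<Longrightarrow> b \<in> B \<Longrightarrow> (1 - l) * a + l * b \<in> C"
  shows "ennreal (1 - l) * emeasure lborel A + ennreal l * emeasure lborel B \<le> emeasure lborel C"
proof (rule ennreal_le_epsilon)
  fix e :: real assume e: "0 < e"
  have bdd: "bdd_above A" "bdd_below B"
    using bd by (auto intro: bounded_imp_bdd_above bounded_imp_bdd_below)
  obtain a where a: "a \<in> A" "a > Sup A - e"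
    using less_cSupD[OF ne(1), of "Sup A - e"] e by auto
  obtain b where b: "b \<in> B" "b < Inf B + e"
    using cInf_lessD[OF ne(2), of "Inf B + e"] e by auto
  define A1 where "A1 = A \<inter> {..a}"
  define B1 where "B1 = B \<inter> {b..}"
  define z where "z = (1 - l) * a + l * b"
  \<comment> \<open>\<open>S\<close> is the copy (1 - l) \<open>A1\<close> + l b and lies to the
    left of \<open>z\<close>; \<open>T\<close> is (1 - l) a + l \<open>B1\<close> without
    \<open>z\<close>. Both are written as preimages, which makes them Borel.\<close>
  define S where "S = {x. (x - l * b) / (1 - l) \<in> A1}"
  define T where "T = {x. (x - (1 - l) * a) / l \<in> B1 \<and> x \<noteq> z}"
  have m[measurable]: "A1 \<in> sets borel" "B1 \<in> sets borel" "S \<in> sets borel" "T \<in> sets borel"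
    unfolding A1_def B1_def S_def T_def by measurable
  have S: "emeasure lborel S = ennreal (1 - l) * emeasure lborel A1"
  proof -
    have "{x. l * b + (1 - l) * x \<in> S} = A1" using l by (auto simp: S_def)
    then show ?thesis
      using emeasure_lborel_vimage_affine[of S "1 - l" "l * b"] l by simp
  qed
  have T: "emeasure lborel T = ennreal l * emeasure lborel B1"
  proof -
    have "{x. (1 - l) * a + l * x \<in> T} = B1 - {b}" using l by (auto simp: T_def z_def)
    moreover have "emeasure lborel (B1 - {b}) = emeasure lborel B1"
      by (rule emeasure_Diff_null_set) auto
    ultimately show ?thesis
      using emeasure_lborel_vimage_affine[of T l "(1 - l) * a"] l by simp
  qed
  have "S \<subseteq> C"
  proof
    fix x assume "x \<in> S"
    then have "(1 - l) * ((x - l * b) / (1 - l)) + l * b \<in> C"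
      by (intro sub b) (auto simp: S_def A1_def)
    then show "x \<in> C" using l by simp
  qed
  moreover have "T \<subseteq> C"
  proof
    fix x assume "x \<in> T"
    then have "(1 - l) * a + l * ((x - (1 - l) * a) / l) \<in> C"
      by (intro sub a) (auto simp: T_def B1_def)
    then show "x \<in> C" using l by simp
  qed
  moreover have "S \<inter> T = {}"
  proof -
    have "x \<le> z" if "x \<in> S" for x
      using that l by (auto simp: S_def A1_def z_def field_simps)
    moreover have "x > z" if "x \<in> T" for x
      using that l by (auto simp: T_def B1_def z_def field_simps)
    ultimately show ?thesis by force
  qed
  ultimately have ST: "emeasure lborel S + emeasure lborel T \<le> emeasure lborel C"
    by (subst plus_emeasure) (auto intro!: emeasure_mono)
  \<comment> \<open>Cutting \<open>A\<close> at \<open>a\<close> loses only points of an interval of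
    length at most e, and likewise for \<open>B\<close>; the weights 1 - l and l sum to 1, so the
    total loss is at most e.\<close>
  have "emeasure lborel A \<le> emeasure lborel (A1 \<union> {a..Sup A})"
    using bdd by (intro emeasure_mono) (auto simp: A1_def intro: cSup_upper)
  also have "\<dots> \<le> emeasure lborel A1 + emeasure lborel {a..Sup A}"
    by (intro emeasure_subadditive) auto
  also have "emeasure lborel {a..Sup A} \<le> ennreal e"
    using a e bdd by (auto simp: emeasure_lborel_Icc_eq intro!: ennreal_leI)
  finally have A': "emeasure lborel A \<le> emeasure lborel A1 + ennreal e" by (simp add: add_left_mono)
  have "emeasure lborel B \<le> emeasure lborel (B1 \<union> {Inf B..b})"
    using bdd by (intro emeasure_mono) (auto simp: B1_def intro: cInf_lower)
  also have "\<dots> \<le> emeasure lborel B1 + emeasure lborel {Inf B..b}"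
    by (intro emeasure_subadditive) auto
  also have "emeasure lborel {Inf B..b} \<le> ennreal e"
    using b e bdd by (auto simp: emeasure_lborel_Icc_eq intro!: ennreal_leI)
  finally have B': "emeasure lborel B \<le> emeasure lborel B1 + ennreal e" by (simp add: add_left_mono)
  have "ennreal (1 - l) * emeasure lborel A + ennreal l * emeasure lborel B
    \<le> ennreal (1 - l) * (emeasure lborel A1 + ennreal e) + ennreal l * (emeasure lborel B1 + ennreal e)"
    using A' B' by (intro add_mono mult_left_mono) auto
  also have "\<dots> = emeasure lborel S + emeasure lborel T + (ennreal (1 - l) + ennreal l) * ennreal e"
    by (simp add: S T algebra_simps)
  also have "ennreal (1 - l) + ennreal l = 1"
    using l by (simp flip: ennreal_plus)
  finally show "ennreal (1 - l) * emeasure lborel A + ennreal l * emeasure lborel B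
    \<le> emeasure lborel C + ennreal e"
    using ST by (simp add: add_right_mono order_trans)
qed

text \<open>Layer cake formula with the levels rescaled to [0, 1), so that functions with different
  suprema can be compared at the same relative level t. The truncation at \<open>m\<close> lets the
  formula be used for a function that exceeds \<open>m\<close>.\<close>

lemma nn_integral_min_levels:
  fixes f :: "real \<Rightarrow> real" and m :: real
  assumes [measurable]: "f \<in> borel_measurable borel" and f: "\<And>x. 0 \<le> f x" and m: "m > 0"
  shows "(\<integral>\<^sup>+x. ennreal (min (f x) m) \<partial>lborel) =
    ennreal m * (\<integral>\<^sup>+t. emeasure lborel {x. m * t < f x} * indicator {0..<1} t \<partial>lborel)"
proof -
  have inner: "(\<integral>\<^sup>+t. indicator {x. m * t < f x} x * indicator {0..<1} t \<partial>lborel)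
    = ennreal (min (f x) m / m)" for x
  proof -
    have "(\<integral>\<^sup>+t. indicator {x. m * t < f x} x * indicator {0..<1} t \<partial>lborel)
      = (\<integral>\<^sup>+t. indicator {0..<min (f x) m / m} t \<partial>lborel)"
    proof (intro nn_integral_cong)
      fix t :: real
      have "t < min (f x) m / m \<longleftrightarrow> m * t < f x \<and> t < 1"
        using m by (auto simp: pos_less_divide_eq mult.commute)
      then show "indicator {x. m * t < f x} x * indicator {0..<1} t
        = (indicator {0..<min (f x) m / m} t :: ennreal)"
        by (auto simp: indicator_def)
    qed
    also have "\<dots> = ennreal (min (f x) m / m)"
      using f[of x] m by simp
    finally show ?thesis .
  qed
  have "(\<integral>\<^sup>+t. emeasure lborel {x. m * t < f x} * indicator {0..<1} t \<partial>lborel)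
    = (\<integral>\<^sup>+t. (\<integral>\<^sup>+x. indicator {x. m * t < f x} x * indicator {0..<1} t \<partial>lborel) \<partial>lborel)"
    by (intro nn_integral_cong) (simp add: nn_integral_multc)
  also have "\<dots> = (\<integral>\<^sup>+x. (\<integral>\<^sup>+t. indicator {x. m * t < f x} x * indicator {0..<1} t \<partial>lborel) \<partial>lborel)"
    by (rule lborel_pair.Fubini') (simp add: indicator_def case_prod_beta')
  also have "\<dots> = (\<integral>\<^sup>+x. ennreal (min (f x) m / m) \<partial>lborel)"
    by (simp only: inner)
  also have "ennreal m * \<dots> = (\<integral>\<^sup>+x. ennreal m * ennreal (min (f x) m / m) \<partial>lborel)"
    by (rule nn_integral_cmult[symmetric]) simp
  also have "\<dots> = (\<integral>\<^sup>+x. ennreal (min (f x) m) \<partial>lborel)"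
    using m f by (intro nn_integral_cong) (auto simp flip: ennreal_mult simp: min_def)
  finally show ?thesis by simp
qed

lemma bounded_profile_integrable:
  fixes f :: "'a::real_normed_vector \<Rightarrow> real"
  assumes f: "bounded_profile f" and M: "sets M = sets borel" and fin: "\<And>r. emeasure M (cball 0 r) < \<infinity>"
  shows "integrable M f"
proof -
  obtain B R where BR: "\<And>x. f x \<le> B * indicator (cball 0 R) x"
    using f by (elim bounded_profileE) blast
  have [measurable]: "f \<in> borel_measurable M"
    using bounded_profile_measurable[OF f] measurable_cong_sets[OF M refl] by blast
  have [measurable]: "cball 0 R \<in> sets M" by (simp add: M)
  show ?thesis
  proof (rule Bochner_Integration.integrable_bound)
    show "integrable M (\<lambda>x. B * indicator (cball 0 R) x :: real)"
      using fin[of R] by (intro integrable_mult_right integrable_real_indicator) auto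
    show "AE x in M. norm (f x) \<le> norm (B * indicator (cball 0 R) x :: real)"
      using BR bounded_profile_nonneg[OF f] by (auto intro!: AE_I2 order_trans[OF BR abs_ge_self])
  qed measurable
qed

text \<open>Relative to the suprema \<open>p\<close> of f and \<open>q\<close> of g, the superlevel
  sets at one relative level t < 1 are both nonempty, so the Brunn-Minkowski inequality on the line
  applies for every t. Integration over t gives (1 - l) I / p + l J / q <= K / m with m = p^(1 - l)
  q^l, and the weighted AM-GM inequality turns this into the multiplicative form.\<close>

lemma prekopa_leindler_real:
  fixes f g h :: "real \<Rightarrow> real"
  assumes l: "0 < l" "l < 1"
    and f: "bounded_profile f" and g: "bounded_profile g" and h: "bounded_profile h"
    and fgh: "\<And>x y. f x powr (1 - l) * g y powr l \<le> h ((1 - l) * x + l * y)"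
  shows "(LINT x|lborel. f x) powr (1 - l) * (LINT x|lborel. g x) powr l \<le> (LINT x|lborel. h x)"
proof (cases "(LINT x|lborel. f x) = 0 \<or> (LINT x|lborel. g x) = 0")
  case True
  then show ?thesis using bounded_profile_nonneg[OF h] by auto
next
  case False
  note [measurable] = bounded_profile_measurable[OF f] bounded_profile_measurable[OF g]
    bounded_profile_measurable[OF h]
  note nonneg = bounded_profile_nonneg[OF f] bounded_profile_nonneg[OF g] bounded_profile_nonneg[OF h]
  have int: "integrable lborel f" "integrable lborel g" "integrable lborel h"
    using f g h by (auto intro!: bounded_profile_integrable emeasure_lborel_cball_finite[unfolded infinity_ennreal_def top.not_eq_extremum])
  \<comment> \<open>The witness is the supremum of k. Bounded support makes the superlevel sets
    bounded, as the inequality on the line assumes.\<close>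
  have sup: "\<exists>m>0. (\<forall>x. k x \<le> m) \<and> (\<forall>t<1. t \<ge> 0 \<longrightarrow> (\<exists>x. m * t < k x) \<and> bounded {x. m * t < k x})"
    if k: "bounded_profile k" and nz: "(LINT x|lborel. k x) \<noteq> 0" for k :: "real \<Rightarrow> real"
  proof -
    obtain B R where BR: "B > 0" "\<And>x. k x \<le> B * indicator (cball 0 R) x"
      using k by (elim bounded_profileE) blast
    have le: "k x \<le> B" for x
      using BR(2)[of x] BR(1) by (cases "norm x \<le> R") auto
    then have bdd: "bdd_above (range k)" by (auto intro!: bdd_aboveI)
    define m where "m = Sup (range k)"
    have up: "k x \<le> m" for x
      unfolding m_def using bdd by (auto intro: cSup_upper)
    have "\<exists>x. k x \<noteq> 0" using nz by (metis Bochner_Integration.integral_zero Bochner_Integration.integral_cong)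
    then have m: "m > 0" using up bounded_profile_nonneg[OF k] by (metis less_eq_real_def order_trans antisym)
    have "\<exists>x. m * t < k x" if "t < 1" for t
    proof -
      have "m * t < m" using that m by simp
      then show ?thesis using less_cSupD[of "range k" "m * t"] unfolding m_def by auto
    qed
    moreover have "bounded {x. m * t < k x}" if "t \<ge> 0" for t
    proof (rule bounded_subset[OF bounded_cball])
      show "{x. m * t < k x} \<subseteq> cball 0 R"
      proof
        fix x assume "x \<in> {x. m * t < k x}"
        then have "0 < k x" using m that by (auto intro: le_less_trans[OF mult_nonneg_nonneg[of m t]])
        then show "x \<in> cball 0 R"
          using BR(2)[of x] by (cases "norm x \<le> R") auto
      qed
    qed
    ultimately show ?thesis using m up by blast
  qed
  obtain p where p: "p > 0" "\<And>x. f x \<le> p"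
    "\<And>t. t < 1 \<Longrightarrow> t \<ge> 0 \<Longrightarrow> (\<exists>x. p * t < f x) \<and> bounded {x. p * t < f x}"
    using sup[OF f] False by blast
  obtain q where q: "q > 0" "\<And>x. g x \<le> q"
    "\<And>t. t < 1 \<Longrightarrow> t \<ge> 0 \<Longrightarrow> (\<exists>x. q * t < g x) \<and> bounded {x. q * t < g x}"
    using sup[OF g] False by blast
  define m where "m = p powr (1 - l) * q powr l"
  have m: "m > 0" using p q by (simp add: m_def)
  let ?F = "\<integral>\<^sup>+t. emeasure lborel {x. p * t < f x} * indicator {0..<1} t \<partial>lborel"
  let ?G = "\<integral>\<^sup>+t. emeasure lborel {x. q * t < g x} * indicator {0..<1} t \<partial>lborel"
  let ?H = "\<integral>\<^sup>+t. emeasure lborel {x. m * t < h x} * indicator {0..<1} t \<partial>lborel"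
  have level: "ennreal (1 - l) * emeasure lborel {x. p * t < f x} + ennreal l * emeasure lborel {x. q * t < g x}
    \<le> emeasure lborel {x. m * t < h x}" if t: "0 \<le> t" "t < 1" for t
  proof (rule brunn_minkowski_real[OF l])
    fix a b assume "a \<in> {x. p * t < f x}" "b \<in> {x. q * t < g x}"
    then have ab: "p * t < f a" "q * t < g b" by auto
    have pq: "0 \<le> p * t" "0 \<le> q * t" using p q t by auto
    \<comment> \<open>The exponents sum to 1, so the common factor t passes through the geometric
      mean; hence all three functions can be cut at the same t.\<close>
    have "m * t = (p * t) powr (1 - l) * (q * t) powr l"
    proof -
      have "t = t powr (1 - l) * t powr l"
        using t l by (cases "t = 0") (auto simp flip: powr_add)
      then show ?thesis using p q t by (simp add: m_def powr_mult mult_ac)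
    qed
    also have "\<dots> < f a powr (1 - l) * g b powr l"
      using ab pq l by (intro mult_strict_mono powr_less_mono2) auto
    also have "\<dots> \<le> h ((1 - l) * a + l * b)" by (rule fgh)
    finally show "(1 - l) * a + l * b \<in> {x. m * t < h x}" by simp
  qed (use p(3) q(3) t in auto)
  have "ennreal (1 - l) * ?F + ennreal l * ?G =
    (\<integral>\<^sup>+t. (ennreal (1 - l) * emeasure lborel {x. p * t < f x} + ennreal l * emeasure lborel {x. q * t < g x})
       * indicator {0..<1} t \<partial>lborel)"
    by (simp add: nn_integral_add nn_integral_cmult distrib_right mult.assoc)
  also have "\<dots> \<le> ?H"
    using level by (intro nn_integral_mono) (auto simp: indicator_def)
  finally have FGH: "ennreal (1 - l) * ?F + ennreal l * ?G \<le> ?H" .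
  define I where "I = (LINT x|lborel. f x)"
  define J where "J = (LINT x|lborel. g x)"
  define K where "K = (LINT x|lborel. h x)"
  have nn: "0 \<le> I" "0 \<le> J" "0 \<le> K" using nonneg by (auto simp: I_def J_def K_def)
  have F: "ennreal I = ennreal p * ?F"
    using nn_integral_min_levels[of f p] p nonneg int(1)
    by (simp add: I_def nn_integral_eq_integral min_absorb1)
  have G: "ennreal J = ennreal q * ?G"
    using nn_integral_min_levels[of g q] q nonneg int(2)
    by (simp add: J_def nn_integral_eq_integral min_absorb1)
  have H: "ennreal m * ?H \<le> ennreal K"
  proof -
    have "(\<integral>\<^sup>+x. ennreal (min (h x) m) \<partial>lborel) \<le> (\<integral>\<^sup>+x. ennreal (h x) \<partial>lborel)"
      by (intro nn_integral_mono ennreal_leI) simp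
    then show ?thesis
      using nn_integral_min_levels[of h m] m nonneg int(3)
      by (simp add: K_def nn_integral_eq_integral)
  qed
  have F': "?F = ennreal (I / p)"
  proof -
    have "ennreal (1 / p) * ennreal I = ennreal (1 / p) * ennreal p * ?F" using F by (simp add: mult.assoc)
    then show ?thesis using p nn by (simp flip: ennreal_mult)
  qed
  have G': "?G = ennreal (J / q)"
  proof -
    have "ennreal (1 / q) * ennreal J = ennreal (1 / q) * ennreal q * ?G" using G by (simp add: mult.assoc)
    then show ?thesis using q nn by (simp flip: ennreal_mult)
  qed
  have "ennreal (m * ((1 - l) * (I / p) + l * (J / q))) = ennreal m * (ennreal (1 - l) * ?F + ennreal l * ?G)"
  proof -
    have "0 \<le> I / p" "0 \<le> J / q" using p q nn by auto
    then have "ennreal (1 - l) * ennreal (I / p) + ennreal l * ennreal (J / q)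
      = ennreal ((1 - l) * (I / p) + l * (J / q))" and "0 \<le> (1 - l) * (I / p) + l * (J / q)"
      using l by (simp_all flip: ennreal_mult ennreal_plus del: times_divide_eq_right)
    then show ?thesis using m by (simp only: F' G' flip: ennreal_mult)
  qed
  also have "\<dots> \<le> ennreal m * ?H"
    using FGH by (intro mult_left_mono) auto
  also have "\<dots> \<le> ennreal K" by (rule H)
  finally have K: "m * ((1 - l) * (I / p) + l * (J / q)) \<le> K" using nn by simp
  have "I powr (1 - l) * J powr l = m * ((I / p) powr (1 - l) * (J / q) powr l)"
    using p q nn by (simp add: m_def powr_divide)
  also have "\<dots> \<le> m * ((1 - l) * (I / p) + l * (J / q))"
    using m l nn p q by (intro mult_left_mono weighted_am_gm) auto
  also note K
  finally show ?thesis by (simp add: I_def J_def K_def)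
qed

section \<open>Lebesgue measure of a finite-dimensional subspace\<close>

lemma nn_integral_translation_invariant:
  fixes M :: "'a::{real_inner, second_countable_topology} measure"
  assumes M: "sets M = sets borel" "distr M borel ((+) v) = M"
    and g[measurable]: "g \<in> borel_measurable borel"
  shows "(\<integral>\<^sup>+x. g (v + x) \<partial>M) = (\<integral>\<^sup>+x. g x \<partial>M)"
proof -
  have [measurable_cong]: "sets M = sets borel" by fact
  have "(\<integral>\<^sup>+x. g x \<partial>M) = (\<integral>\<^sup>+x. g x \<partial>distr M borel ((+) v))" by (simp add: M)
  also have "\<dots> = (\<integral>\<^sup>+x. g (v + x) \<partial>M)" by (rule nn_integral_distr) measurable
  finally show ?thesis by simp
qed

text \<open>Haar uniqueness: substitute \<open>y \<rightarrow> x + y\<close>, then \<open>x \<rightarrow> x - y\<close>, in the integral of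
  \<open>1\<^sub>A(x) 1\<^sub>B(y)\<close> against the product measure.\<close>

lemma translation_invariant_measures:
  fixes M N :: "'a::{real_inner, second_countable_topology} measure"
  assumes M: "sigma_finite_measure M" "sets M = sets borel" "AE x in M. x \<in> E"
      "\<And>v. v \<in> E \<Longrightarrow> distr M borel ((+) v) = M"
    and N: "sigma_finite_measure N" "sets N = sets borel" "AE x in N. x \<in> E"
      "\<And>v. v \<in> E \<Longrightarrow> distr N borel ((+) v) = N"
    and E: "subspace E"
    and A[measurable]: "A \<in> sets borel" and B[measurable]: "B \<in> sets borel"
  shows "emeasure M A * emeasure N B = emeasure M B * emeasure N (uminus -` A)"
proof -
  interpret M: sigma_finite_measure M by fact
  interpret N: sigma_finite_measure N by fact
  interpret pair_sigma_finite M N ..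
  have [measurable_cong]: "sets M = sets borel" "sets N = sets borel" by fact+
  have "emeasure M A * emeasure N B = (\<integral>\<^sup>+x. indicator A x * (\<integral>\<^sup>+y. indicator B y \<partial>N) \<partial>M)"
    by (simp add: nn_integral_multc)
  also have "\<dots> = (\<integral>\<^sup>+x. indicator A x * (\<integral>\<^sup>+y. indicator B (x + y) \<partial>N) \<partial>M)"
    using M(3) by (intro nn_integral_cong_AE, eventually_elim)
      (simp add: nn_integral_translation_invariant[OF N(2) N(4), of _ "indicator B"])
  also have "\<dots> = (\<integral>\<^sup>+x. (\<integral>\<^sup>+y. indicator A x * indicator B (x + y) \<partial>N) \<partial>M)"
    by (simp add: nn_integral_cmult)
  also have "\<dots> = (\<integral>\<^sup>+y. (\<integral>\<^sup>+x. indicator A x * indicator B (x + y) \<partial>M) \<partial>N)"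
    by (rule Fubini'[symmetric]) measurable
  also have "\<dots> = (\<integral>\<^sup>+y. (\<integral>\<^sup>+x. indicator A (x - y) * indicator B x \<partial>M) \<partial>N)"
  proof (rule nn_integral_cong_AE)
    show "AE y in N. (\<integral>\<^sup>+x. indicator A x * indicator B (x + y) \<partial>M) = (\<integral>\<^sup>+x. indicator A (x - y) * indicator B x \<partial>M)"
      using N(3)
    proof eventually_elim
      case (elim y)
      then show ?case
        using nn_integral_translation_invariant[OF M(2) M(4)[of y], of "\<lambda>x. indicator A (x - y) * indicator B x"]
        by (simp add: add.commute)
    qed
  qed
  also have "\<dots> = (\<integral>\<^sup>+x. (\<integral>\<^sup>+y. indicator A (x - y) * indicator B x \<partial>N) \<partial>M)"
    by (rule Fubini') measurable
  also have "\<dots> = (\<integral>\<^sup>+x. (\<integral>\<^sup>+y. indicator A (x - y) \<partial>N) * indicator B x \<partial>M)"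
    by (simp add: nn_integral_multc)
  also have "\<dots> = (\<integral>\<^sup>+x. (\<integral>\<^sup>+y. indicator A (- y) \<partial>N) * indicator B x \<partial>M)"
  proof (rule nn_integral_cong_AE)
    show "AE x in M. (\<integral>\<^sup>+y. indicator A (x - y) \<partial>N) * indicator B x = (\<integral>\<^sup>+y. indicator A (- y) \<partial>N) * indicator B x"
      using M(3)
    proof eventually_elim
      case (elim x)
      then show ?case
        using nn_integral_translation_invariant[OF N(2) N(4)[of x], of "\<lambda>y. indicator A (x - y)"]
        by simp
    qed
  qed
  also have "(\<integral>\<^sup>+y. indicator A (- y) \<partial>N) = (\<integral>\<^sup>+y. indicator (uminus -` A) y \<partial>N)"
    by (intro nn_integral_cong) (auto simp: indicator_def)
  also have "\<dots> = emeasure N (uminus -` A)"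
    by (rule nn_integral_indicator) (use measurable_sets[of uminus borel borel A] in \<open>simp add: N(2)\<close>)
  also have "(\<integral>\<^sup>+x. emeasure N (uminus -` A) * indicator B x \<partial>M) = emeasure N (uminus -` A) * emeasure M B"
    by (rule nn_integral_cmult_indicator) (simp add: M(2))
  finally show ?thesis by (simp add: mult.commute)
qed

lemma ennreal_cancel: "a * u = u * c \<Longrightarrow> u \<noteq> 0 \<Longrightarrow> u \<noteq> \<infinity> \<Longrightarrow> a = c" for a u c :: ennreal
  by (auto simp: mult.commute[of a] ennreal_mult_cancel_left)

lemma distr_PiM_translate:
  fixes a :: "'i \<Rightarrow> real"
  assumes I: "finite I"
  shows "distr (\<Pi>\<^sub>M i\<in>I. lborel) (\<Pi>\<^sub>M i\<in>I. lborel) (\<lambda>c. \<lambda>i\<in>I. a i + c i) = (\<Pi>\<^sub>M i\<in>I. lborel)"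
proof -
  interpret product_sigma_finite "\<lambda>_::'i. lborel :: real measure" ..
  show ?thesis
  proof (rule PiM_eqI[OF I])
    fix A :: "'i \<Rightarrow> real set" assume A: "\<And>i. i \<in> I \<Longrightarrow> A i \<in> sets lborel"
    have "(\<lambda>c. \<lambda>i\<in>I. a i + c i) -` Pi\<^sub>E I A \<inter> space (\<Pi>\<^sub>M i\<in>I. lborel) = Pi\<^sub>E I (\<lambda>i. {x. a i + x \<in> A i})"
      by (auto simp: space_PiM PiE_def Pi_def)
    moreover have m: "{x. a i + x \<in> A i} \<in> sets lborel" if "i \<in> I" for i
      using measurable_sets[of "\<lambda>x. a i + x" borel borel "A i"] A[OF that] by (simp add: vimage_def)
    ultimately have "emeasure (distr (\<Pi>\<^sub>M i\<in>I. lborel) (\<Pi>\<^sub>M i\<in>I. lborel) (\<lambda>c. \<lambda>i\<in>I. a i + c i)) (Pi\<^sub>E I A)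
      = (\<Prod>i\<in>I. emeasure lborel {x. a i + x \<in> A i})"
      using A I by (subst emeasure_distr) (auto intro!: sets_PiM_I_finite emeasure_PiM)
    also have "\<dots> = (\<Prod>i\<in>I. emeasure lborel (A i))"
    proof (rule prod.cong[OF refl])
      fix i assume "i \<in> I"
      then show "emeasure lborel {x. a i + x \<in> A i} = emeasure lborel (A i)"
        using emeasure_lborel_vimage_affine[of "A i" 1 "a i"] A by simp
    qed
    finally show "emeasure (distr (\<Pi>\<^sub>M i\<in>I. lborel) (\<Pi>\<^sub>M i\<in>I. lborel) (\<lambda>c. \<lambda>i\<in>I. a i + c i)) (Pi\<^sub>E I A)
      = (\<Prod>i\<in>I. emeasure lborel (A i))" .
  qed simp
qed

lemma orthonormal_is_onb:
  fixes b :: "nat \<Rightarrow> 'a::real_inner"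
  assumes b: "\<And>i j. i < k \<Longrightarrow> j < k \<Longrightarrow> inner (b i) (b j) = (if i = j then 1 else 0)"
    and E: "span (b ` {..<k}) = E"
  shows "dim E = k" "is_onb E b"
proof -
  have inj: "inj_on b {..<k}"
    by (rule inj_onI) (metis b lessThan_iff zero_neq_one)
  have "0 \<notin> b ` {..<k}"
  proof
    assume "0 \<in> b ` {..<k}"
    then obtain i where "i < k" "b i = 0" by auto
    then show False using b[of i i] by simp
  qed
  moreover have "pairwise orthogonal (b ` {..<k})"
    unfolding pairwise_def orthogonal_def using b by auto
  ultimately have "independent (b ` {..<k})" using pairwise_orthogonal_independent by blast
  then show "dim E = k"
    unfolding E[symmetric] using inj by (simp add: dim_eq_card_independent card_image)
  then show "is_onb E b" using b E by (simp add: is_onb_def)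
qed

section \<open>Finite-dimensional subspaces, their orthonormal bases and the uniqueness of Lebesgue
  measure\<close>

locale fd_subspace =
  fixes E :: "'a::{real_inner, second_countable_topology} set"
  assumes subspace: "subspace E" and finite_span: "\<exists>B. finite B \<and> span B = E"
begin

lemma is_onb_E: "is_onb E (onb E)"
  using is_onb_onb[OF subspace] finite_span by blast

context
  fixes b assumes b: "is_onb E b"
begin

lemma onb_inner: "i < dim E \<Longrightarrow> j < dim E \<Longrightarrow> inner (b i) (b j) = (if i = j then 1 else 0)"
  using b by (auto simp: is_onb_def)

lemma onb_mem: "i < dim E \<Longrightarrow> b i \<in> E"
  using b by (metis is_onb_def image_eqI lessThan_iff span_base)

lemma onb_norm: "i < dim E \<Longrightarrow> norm (b i) = 1"
  by (simp add: norm_eq_sqrt_inner onb_inner)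

lemma onb_comb_mem: "(\<Sum>i<dim E. c i *\<^sub>R b i) \<in> E"
  by (intro subspace_sum subspace subspace_scale onb_mem) auto

lemma onb_comb_inner: "j < dim E \<Longrightarrow> inner (\<Sum>i<dim E. c i *\<^sub>R b i) (b j) = c j"
proof -
  assume j: "j < dim E"
  have "inner (\<Sum>i<dim E. c i *\<^sub>R b i) (b j) = (\<Sum>i<dim E. if i = j then c i else 0)"
    unfolding inner_sum_left using j by (intro sum.cong) (auto simp: onb_inner)
  with j show ?thesis by simp
qed

lemma onb_expand:
  assumes "x \<in> E"
  shows "(\<Sum>i<dim E. inner x (b i) *\<^sub>R b i) = x"
proof -
  let ?y = "x - (\<Sum>i<dim E. inner x (b i) *\<^sub>R b i)"
  have yE: "?y \<in> E" by (intro subspace_diff subspace assms onb_comb_mem)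
  have "orthogonal ?y z" if "z \<in> b ` {..<dim E}" for z
  proof -
    from that obtain j where "j < dim E" "z = b j" by blast
    then show ?thesis by (simp add: orthogonal_def inner_diff_left onb_comb_inner)
  qed
  moreover have "?y \<in> span (b ` {..<dim E})" using yE b by (simp add: is_onb_def)
  ultimately have "orthogonal ?y ?y" by (rule orthogonal_to_span[rotated])
  then show ?thesis by (simp add: orthogonal_self)
qed

lemma onb_inner_expand:
  assumes "x \<in> E"
  shows "inner x y = (\<Sum>i<dim E. inner x (b i) * inner y (b i))"
proof -
  have "inner x y = inner (\<Sum>i<dim E. inner x (b i) *\<^sub>R b i) y" by (simp only: onb_expand[OF assms])
  also have "\<dots> = (\<Sum>i<dim E. inner x (b i) * inner y (b i))"
    unfolding inner_sum_left inner_scaleR_left by (intro sum.cong refl) (simp add: inner_commute)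
  finally show ?thesis .
qed

lemma onb_norm_comb: "(norm (\<Sum>i<dim E. c i *\<^sub>R b i))\<^sup>2 = (\<Sum>i<dim E. (c i)\<^sup>2)"
  unfolding power2_norm_eq_inner
  unfolding power2_norm_eq_inner power2_eq_square
  by (rule trans[OF onb_inner_expand[OF onb_comb_mem]], intro sum.cong)
    (simp_all only: onb_comb_inner lessThan_iff)

lemma onb_norm_expand: "x \<in> E \<Longrightarrow> (norm x)\<^sup>2 = (\<Sum>i<dim E. (inner x (b i))\<^sup>2)"
  using onb_norm_comb[of "\<lambda>i. inner x (b i)"] by (simp only: onb_expand)

lemma measurable_comb [measurable]: "(\<lambda>c. \<Sum>i<dim E. c i *\<^sub>R b i) \<in> (\<Pi>\<^sub>M i\<in>{..<dim E}. lborel) \<rightarrow>\<^sub>M borel"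
  by measurable

end

lemma closed_E: "closed E"
proof -
  have "E = {x. (\<Sum>i<dim E. inner x (onb E i) *\<^sub>R onb E i) = x}"
  proof (intro equalityI subsetI)
    fix x assume "x \<in> E"
    then show "x \<in> {x. (\<Sum>i<dim E. inner x (onb E i) *\<^sub>R onb E i) = x}"
      using onb_expand[OF is_onb_E] by blast
  next
    fix x assume "x \<in> {x. (\<Sum>i<dim E. inner x (onb E i) *\<^sub>R onb E i) = x}"
    then show "x \<in> E" using onb_comb_mem[OF is_onb_E, of "\<lambda>i. inner x (onb E i)"] by simp
  qed
  also have "closed \<dots>" by (intro closed_Collect_eq continuous_intros)
  finally show ?thesis .
qed

lemma E_borel [measurable]: "E \<in> sets borel"
  using closed_E by simp

lemma zero_E: "0 \<in> E"
  by (rule subspace_0[OF subspace])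

text \<open>\<open>lborel_on\<close> with the chosen basis replaced by any orthonormal basis
  \<open>b\<close>. That \<open>b\<close> does not matter is what makes isometries and the splitting
  off of one direction available.\<close>

definition frame_measure :: "(nat \<Rightarrow> 'a) \<Rightarrow> 'a measure"
  where "frame_measure b = distr (\<Pi>\<^sub>M i\<in>{..<dim E}. lborel) borel (\<lambda>c. \<Sum>i<dim E. c i *\<^sub>R b i)"

lemma lborel_on_frame: "lborel_on E = frame_measure (onb E)"
  by (simp add: lborel_on_def frame_measure_def)

lemma sets_frame [simp, measurable_cong]: "sets (frame_measure b) = sets borel"
  by (simp add: frame_measure_def)

text \<open>The coordinate set on the right does not mention \<open>b\<close>: all orthonormal bases
  give the unit ball the same mass, which is the normalisation used for uniqueness.\<close>

lemma emeasure_frame_cball: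
  assumes b: "is_onb E b" and r: "r \<ge> 0"
  shows "emeasure (frame_measure b) (cball 0 r) =
    emeasure (\<Pi>\<^sub>M i\<in>{..<dim E}. lborel) {c \<in> space (\<Pi>\<^sub>M i\<in>{..<dim E}. lborel). (\<Sum>i<dim E. (c i)\<^sup>2) \<le> r\<^sup>2}"
proof -
  have "norm (\<Sum>i<dim E. c i *\<^sub>R b i) \<le> r \<longleftrightarrow> (\<Sum>i<dim E. (c i)\<^sup>2) \<le> r\<^sup>2" for c
    unfolding onb_norm_comb[OF b, symmetric] using r by (simp only: power2_le_iff_abs_le abs_norm_cancel)
  then have "(\<lambda>c. \<Sum>i<dim E. c i *\<^sub>R b i) -` cball 0 r \<inter> space (\<Pi>\<^sub>M i\<in>{..<dim E}. lborel)
    = {c \<in> space (\<Pi>\<^sub>M i\<in>{..<dim E}. lborel). (\<Sum>i<dim E. (c i)\<^sup>2) \<le> r\<^sup>2}"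
    by (simp only: set_eq_iff vimage_def mem_cball dist_0_norm mem_Collect_eq Int_iff conj_commute simp_thms)
  then show ?thesis
    unfolding frame_measure_def
    by (subst emeasure_distr) (simp_all only: measurable_comb[OF b] borel_closed closed_cball)
qed

interpretation product_sigma_finite "\<lambda>_::nat. lborel :: real measure" ..

lemma emeasure_frame_cball_finite: "is_onb E b \<Longrightarrow> emeasure (frame_measure b) (cball 0 r) < \<infinity>"
proof (cases "r \<ge> 0")
  case r: True
  assume b: "is_onb E b"
  have "emeasure (frame_measure b) (cball 0 r) \<le> emeasure (\<Pi>\<^sub>M i\<in>{..<dim E}. lborel) (Pi\<^sub>E {..<dim E} (\<lambda>_. {-r..r}))"
    unfolding emeasure_frame_cball[OF b r]
  proof (rule emeasure_mono)
    show "{c \<in> space (\<Pi>\<^sub>M i\<in>{..<dim E}. lborel). (\<Sum>i<dim E. (c i)\<^sup>2) \<le> r\<^sup>2} \<subseteq> Pi\<^sub>E {..<dim E} (\<lambda>_. {-r..r})"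
    proof
      fix c assume c: "c \<in> {c \<in> space (\<Pi>\<^sub>M i\<in>{..<dim E}. lborel). (\<Sum>i<dim E. (c i)\<^sup>2) \<le> r\<^sup>2}"
      have "c i \<in> {-r..r}" if "i < dim E" for i
      proof -
        have "(c i)\<^sup>2 \<le> (\<Sum>i<dim E. (c i)\<^sup>2)" using that by (intro member_le_sum) auto
        with c have "(c i)\<^sup>2 \<le> r\<^sup>2" by simp
        then show ?thesis using r by (simp add: abs_le_iff flip: abs_le_square_iff)
      qed
      with c show "c \<in> Pi\<^sub>E {..<dim E} (\<lambda>_. {-r..r})" by (auto simp: space_PiM PiE_def)
    qed
  qed (auto intro!: sets_PiM_I_finite)
  also have "\<dots> = (\<Prod>i<dim E. emeasure lborel {-r..r})" by (rule emeasure_PiM) auto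
  also have "\<dots> = ennreal ((2 * r) ^ dim E)"
    using r by (simp add: ennreal_power)
  finally show ?thesis by (simp add: le_less_trans[OF _ ennreal_less_top])
qed simp

lemma emeasure_frame_cball_pos:
  assumes b: "is_onb E b" and r: "r > 0"
  shows "emeasure (frame_measure b) (cball 0 r) > 0"
proof -
  \<comment> \<open>The cube of half side \<open>s\<close> has to fit into the ball: n s^2 <= (n +
    1)^2 s^2 = r^2 with n = \<open>dim E\<close>. The added 1 avoids a division by 0 in dimension
    0.\<close>
  define s where "s = r / (real (dim E) + 1)"
  have s: "s > 0" using r by (simp add: s_def)
  have "0 < ennreal ((2 * s) ^ dim E)" using s by simp
  also have "\<dots> = (\<Prod>i<dim E. emeasure lborel {-s..s})"
    using s by (simp add: ennreal_power)
  also have "\<dots> = emeasure (\<Pi>\<^sub>M i\<in>{..<dim E}. lborel) (Pi\<^sub>E {..<dim E} (\<lambda>_. {-s..s}))"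
    by (rule emeasure_PiM[symmetric]) auto
  also have "\<dots> \<le> emeasure (frame_measure b) (cball 0 r)"
    unfolding emeasure_frame_cball[OF b less_imp_le[OF r]]
  proof (rule emeasure_mono)
    show "Pi\<^sub>E {..<dim E} (\<lambda>_. {-s..s}) \<subseteq> {c \<in> space (\<Pi>\<^sub>M i\<in>{..<dim E}. lborel). (\<Sum>i<dim E. (c i)\<^sup>2) \<le> r\<^sup>2}"
    proof
      fix c assume c: "c \<in> Pi\<^sub>E {..<dim E} (\<lambda>_. {-s..s})"
      have "(\<Sum>i<dim E. (c i)\<^sup>2) \<le> (\<Sum>i<dim E. s\<^sup>2)"
        using c s by (intro sum_mono) (auto simp: abs_le_square_iff[symmetric] abs_le_iff PiE_def Pi_def intro: power2_le_iff_abs_le[THEN iffD2])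
      also have "\<dots> = real (dim E) * s\<^sup>2" by simp
      also have "\<dots> \<le> (real (dim E) + 1)\<^sup>2 * s\<^sup>2"
        by (intro mult_right_mono) (auto simp: power2_eq_square algebra_simps)
      also have "\<dots> = r\<^sup>2" by (simp add: s_def power_divide add_eq_0_iff_both_eq_0)
      finally show "c \<in> {c \<in> space (\<Pi>\<^sub>M i\<in>{..<dim E}. lborel). (\<Sum>i<dim E. (c i)\<^sup>2) \<le> r\<^sup>2}"
        using c by (auto simp: space_PiM PiE_def)
    qed
  qed measurable
  finally show ?thesis .
qed

lemma sigma_finite_frame:
  assumes b: "is_onb E b"
  shows "sigma_finite_measure (frame_measure b)"
proof
  have "\<exists>k::nat. norm x \<le> k" for x :: 'a by (rule real_arch_simple)
  then show "\<exists>A. countable A \<and> A \<subseteq> sets (frame_measure b) \<and> \<Union>A = space (frame_measure b) \<and>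
      (\<forall>a\<in>A. emeasure (frame_measure b) a \<noteq> \<infinity>)"
    using emeasure_frame_cball_finite[OF b]
    by (intro exI[of _ "range (\<lambda>k::nat. cball 0 (real k))"]) (auto simp: frame_measure_def top.not_eq_extremum)
qed

lemma AE_frame:
  assumes b: "is_onb E b"
  shows "AE x in frame_measure b. x \<in> E"
  unfolding frame_measure_def
  by (subst AE_distr_iff) (auto intro!: onb_comb_mem[OF b])

lemma frame_translate:
  assumes b: "is_onb E b" and v: "v \<in> E"
  shows "distr (frame_measure b) borel ((+) v) = frame_measure b"
proof -
  let ?P = "\<Pi>\<^sub>M i\<in>{..<dim E}. lborel :: real measure"
  let ?t = "\<lambda>c. \<lambda>i\<in>{..<dim E}. inner v (b i) + c i"
  let ?g = "\<lambda>c. \<Sum>i<dim E. c i *\<^sub>R b i"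
  have "distr (frame_measure b) borel ((+) v) = distr ?P borel ((+) v \<circ> ?g)"
    unfolding frame_measure_def by (subst distr_distr) auto
  also have "(+) v \<circ> ?g = ?g \<circ> ?t"
  proof
    fix c
    show "((+) v \<circ> ?g) c = (?g \<circ> ?t) c"
      using onb_expand[OF b v] by (simp add: scaleR_add_left sum.distrib)
  qed
  also have "distr ?P borel (?g \<circ> ?t) = distr (distr ?P ?P ?t) borel ?g"
    by (subst distr_distr) auto
  finally show ?thesis by (simp add: distr_PiM_translate frame_measure_def)
qed

text \<open>Both measures are translation invariant on \<open>E\<close> and agree on the unit ball.
  The uniqueness identity for the reference measure against itself shows that it is invariant under
  x -> - x, which removes the reflected set from the identity for the two measures.\<close>

theorem frame_measure_eq:
  assumes b: "is_onb E b"
  shows "frame_measure b = lborel_on E"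
proof (rule measure_eqI)
  let ?M = "frame_measure b" and ?N = "frame_measure (onb E)"
  note e = is_onb_E
  let ?U = "cball 0 1 :: 'a set"
  have U: "emeasure ?N ?U \<noteq> 0" "emeasure ?N ?U \<noteq> \<infinity>"
    using emeasure_frame_cball_pos[OF e, of 1] emeasure_frame_cball_finite[OF e, of 1] by auto
  have MU: "emeasure ?M ?U = emeasure ?N ?U"
    by (simp add: emeasure_frame_cball[OF b] emeasure_frame_cball[OF e])
  fix A assume "A \<in> sets ?M"
  then have A: "A \<in> sets borel" by simp
  have "emeasure ?N A * emeasure ?N ?U = emeasure ?N ?U * emeasure ?N (uminus -` A)"
    using A by (intro translation_invariant_measures[where E = E] sigma_finite_frame e AE_frame frame_translate subspace) auto
  then have refl: "emeasure ?N (uminus -` A) = emeasure ?N A"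
    using ennreal_cancel[OF _ U] by metis
  have "emeasure ?M A * emeasure ?N ?U = emeasure ?M ?U * emeasure ?N (uminus -` A)"
    using A by (intro translation_invariant_measures[where E = E] sigma_finite_frame e b AE_frame frame_translate subspace) auto
  then show "emeasure ?M A = emeasure (lborel_on E) A"
    unfolding MU refl lborel_on_frame by (rule ennreal_cancel[OF _ U])
qed (simp add: lborel_on_def)

lemma sets_lborel_on [simp, measurable_cong]: "sets (lborel_on E) = sets borel"
  by (simp add: lborel_on_def)

lemma space_lborel_on [simp]: "space (lborel_on E) = UNIV"
  by (simp add: lborel_on_def)

lemma AE_E: "AE x in lborel_on E. x \<in> E"
  unfolding lborel_on_frame by (rule AE_frame[OF is_onb_E])

lemma emeasure_E_cong:
  assumes "A \<in> sets borel" "B \<in> sets borel" "A \<inter> E = B \<inter> E"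
  shows "emeasure (lborel_on E) A = emeasure (lborel_on E) B"
proof (rule emeasure_eq_AE)
  show "AE x in lborel_on E. x \<in> A \<longleftrightarrow> x \<in> B"
    using AE_E by eventually_elim (use assms(3) in blast)
qed (simp_all add: assms)

lemma sigma_finite_E: "sigma_finite_measure (lborel_on E)"
  unfolding lborel_on_frame by (rule sigma_finite_frame[OF is_onb_E])

lemma emeasure_cball_finite: "emeasure (lborel_on E) (cball 0 r) < \<infinity>"
  unfolding lborel_on_frame by (rule emeasure_frame_cball_finite[OF is_onb_E])

lemma emeasure_cball_pos: "r > 0 \<Longrightarrow> emeasure (lborel_on E) (cball 0 r) > 0"
  unfolding lborel_on_frame by (rule emeasure_frame_cball_pos[OF is_onb_E])

lemma emeasure_bounded: "bounded A \<Longrightarrow> emeasure (lborel_on E) A < \<infinity>"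
proof -
  assume "bounded A"
  then obtain r where "\<forall>x\<in>A. norm x \<le> r" by (auto simp: bounded_iff)
  then have "A \<subseteq> cball 0 r" by auto
  then show ?thesis
    using emeasure_mono[of A "cball 0 r" "lborel_on E"] emeasure_cball_finite[of r] by (auto intro: le_less_trans)
qed

lemma emeasure_eq_vol: "bounded A \<Longrightarrow> emeasure (lborel_on E) A = ennreal (vol E A)"
  unfolding vol_def using emeasure_bounded[of A] by (intro emeasure_eq_ennreal_measure) auto

lemma vol_nonneg [simp]: "vol E A \<ge> 0"
  by (simp add: vol_def)

lemma vol_mono: "A \<subseteq> B \<Longrightarrow> B \<in> sets borel \<Longrightarrow> bounded B \<Longrightarrow> vol E A \<le> vol E B"
proof -
  assume "A \<subseteq> B" "B \<in> sets borel" "bounded B"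
  then have "emeasure (lborel_on E) A \<le> emeasure (lborel_on E) B" by (intro emeasure_mono) auto
  moreover have "bounded A" using \<open>A \<subseteq> B\<close> \<open>bounded B\<close> bounded_subset by blast
  ultimately show ?thesis using \<open>bounded B\<close> by (simp add: emeasure_eq_vol)
qed

lemma lborel_on_translate: "v \<in> E \<Longrightarrow> distr (lborel_on E) borel ((+) v) = lborel_on E"
  unfolding lborel_on_frame by (rule frame_translate[OF is_onb_E])

lemma emeasure_translate:
  assumes "v \<in> E" "A \<in> sets borel"
  shows "emeasure (lborel_on E) {x. v + x \<in> A} = emeasure (lborel_on E) A"
  by (subst (2) lborel_on_translate[OF assms(1), symmetric]) (use assms in \<open>simp add: emeasure_distr vimage_def\<close>)

text \<open>\<open>R\<close> maps the basis \<open>onb E\<close> to another orthonormal basis, and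
  the measure built from the latter is the image measure.\<close>

lemma lborel_on_isometry:
  assumes R: "linear R" "R \<in> borel_measurable borel" "R ` E = E"
    and iso: "\<And>x y. x \<in> E \<Longrightarrow> y \<in> E \<Longrightarrow> inner (R x) (R y) = inner x y"
  shows "distr (lborel_on E) borel R = lborel_on E"
proof -
  let ?b = "R \<circ> onb E"
  have "is_onb E ?b"
    unfolding is_onb_def
  proof (intro conjI allI impI)
    show "inner (?b i) (?b j) = (if i = j then 1 else 0)" if "i < dim E" "j < dim E" for i j
      using that by (simp add: iso onb_mem[OF is_onb_E] onb_inner[OF is_onb_E])
    have "span (?b ` {..<dim E}) = R ` span (onb E ` {..<dim E})"
      unfolding image_comp[symmetric] by (rule linear_span_image[OF R(1)])
    then show "span (?b ` {..<dim E}) = E" using is_onb_E R(3) by (simp add: is_onb_def)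
  qed
  then have "lborel_on E = frame_measure ?b" by (rule frame_measure_eq[symmetric])
  also have "\<dots> = distr (lborel_on E) borel R"
    unfolding lborel_on_frame frame_measure_def
    by (subst distr_distr) (use R(2) in \<open>auto simp: o_def linear_sum[OF R(1)] linear_scale[OF R(1)]\<close>)
  finally show ?thesis by simp
qed

end

section \<open>Orthogonal projection to a hyperplane and Fubini along its normal\<close>

lemma linear_perp_proj: "linear (perp_proj \<xi>)"
  by (rule linearI) (simp_all add: perp_proj_def inner_add_left algebra_simps add_divide_distrib scaleR_add_left)

lemma continuous_perp_proj: "continuous_on A (perp_proj \<xi>)"
  unfolding perp_proj_def by (cases "\<xi> = 0") (auto intro!: continuous_intros)

lemma nn_integral_exp_abs: "(\<integral>\<^sup>+t. ennreal (exp (- \<bar>t\<bar>)) \<partial>lborel) \<le> 2"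
proof -
  have pos: "(\<integral>\<^sup>+t. ennreal (exp (- t)) * indicator {0..} t \<partial>lborel) = ennreal (0 - (- exp (- 0)))"
  proof (rule nn_integral_FTC_atLeast)
    show "((\<lambda>x. - exp (- x)) has_real_derivative exp (- x)) (at x)" for x :: real
      by (auto intro!: derivative_eq_intros)
    have "((\<lambda>x::real. - exp (- x)) \<longlongrightarrow> - 0) at_top"
      by (intro tendsto_minus filterlim_compose[OF exp_at_bot] filterlim_uminus_at_bot_at_top)
    then show "((\<lambda>x::real. - exp (- x)) \<longlongrightarrow> 0) at_top" by simp
  qed auto
  have neg: "(\<integral>\<^sup>+t. ennreal (exp t) * indicator {..0} t \<partial>lborel) = (\<integral>\<^sup>+t. ennreal (exp (- t)) * indicator {0..} t \<partial>lborel)"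
    by (subst nn_integral_real_affine[where c = "-1" and t = 0]) (auto intro!: nn_integral_cong simp: indicator_def)
  have "(\<integral>\<^sup>+t. ennreal (exp (- \<bar>t\<bar>)) \<partial>lborel) \<le>
    (\<integral>\<^sup>+t. ennreal (exp (- t)) * indicator {0..} t + ennreal (exp t) * indicator {..0} t \<partial>lborel)"
    by (intro nn_integral_mono) (auto simp: indicator_def abs_if)
  also have "\<dots> = 2"
    by (subst nn_integral_add) (auto simp: neg pos)
  finally show ?thesis .
qed

context fd_subspace
begin

lemma mem_perp: "x \<in> perp E \<xi> \<longleftrightarrow> x \<in> E \<and> inner x \<xi> = 0"
  by (auto simp: perp_def orthogonal_comp_def orthogonal_def inner_commute)

lemma perp_proj_unit: "norm \<theta> = 1 \<Longrightarrow> perp_proj \<theta> x = x - inner x \<theta> *\<^sub>R \<theta>"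
  by (simp add: perp_proj_def norm_eq_sqrt_inner)

context
  fixes \<theta> assumes \<theta>: "\<theta> \<in> E" "norm \<theta> = 1"
begin

lemma inner_\<theta>: "inner \<theta> \<theta> = 1"
  using \<theta>(2) by (simp add: norm_eq_sqrt_inner)

lemma perp_proj_mem: "x \<in> E \<Longrightarrow> perp_proj \<theta> x \<in> perp E \<theta>"
  unfolding mem_perp perp_proj_unit[OF \<theta>(2)]
  by (auto simp: inner_diff_left inner_\<theta> intro!: subspace_diff subspace subspace_scale \<theta>(1))

lemma perp_proj_perp: "x \<in> perp E \<theta> \<Longrightarrow> perp_proj \<theta> x = x"
  by (simp add: mem_perp perp_proj_def)

lemma fd_perp: "fd_subspace (perp E \<theta>)"
proof
  show "subspace (perp E \<theta>)"
    by (rule subspaceI)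
      (auto simp: mem_perp inner_add_left zero_E subspace_add[OF subspace] subspace_scale[OF subspace])
  obtain B where B: "finite B" "span B = E" using finite_span by blast
  have "span (perp_proj \<theta> ` B) = perp_proj \<theta> ` E"
    using linear_span_image[OF linear_perp_proj, of \<theta> B] B by simp
  also have "\<dots> = perp E \<theta>"
    using perp_proj_mem perp_proj_perp mem_perp by (metis (no_types, lifting) image_iff subsetI subset_antisym image_subsetI)
  finally show "\<exists>B. finite B \<and> span B = perp E \<theta>" using B by blast
qed

interpretation P: fd_subspace "perp E \<theta>" by (rule fd_perp)

text \<open>An orthonormal basis of the hyperplane extended by \<open>\<theta>\<close>, which gets
  the last index, so that dropping the last coordinate is the orthogonal projection.\<close>

definition perp_frame :: "nat \<Rightarrow> 'a"
  where "perp_frame = (onb (perp E \<theta>))(dim (perp E \<theta>) := \<theta>)"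

lemma perp_frame_onb: "dim E = Suc (dim (perp E \<theta>))" "is_onb E perp_frame"
proof -
  let ?m = "dim (perp E \<theta>)"
  have mem: "onb (perp E \<theta>) i \<in> perp E \<theta>" if "i < ?m" for i
    using P.onb_mem[OF P.is_onb_E that] .
  have ortho: "inner (perp_frame i) (perp_frame j) = (if i = j then 1 else 0)" if ij: "i < Suc ?m" "j < Suc ?m" for i j
  proof -
    have orth: "inner (onb (perp E \<theta>) l) \<theta> = 0" "inner \<theta> (onb (perp E \<theta>) l) = 0" if "l < ?m" for l
      using mem[OF that] by (auto simp: mem_perp inner_commute)
    consider "i < ?m" "j < ?m" | "i = ?m" "j < ?m" | "i < ?m" "j = ?m" | "i = ?m" "j = ?m"
      using ij by linarith
    then show ?thesis
      by cases (simp_all add: orth perp_frame_def P.onb_inner[OF P.is_onb_E] inner_\<theta>)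
  qed
  have sp: "span (perp_frame ` {..<Suc ?m}) = E"
  proof
    show "span (perp_frame ` {..<Suc ?m}) \<subseteq> E"
      using mem \<theta>(1) by (intro span_minimal subspace) (auto simp: perp_frame_def mem_perp less_Suc_eq)
    show "E \<subseteq> span (perp_frame ` {..<Suc ?m})"
    proof
      fix x assume x: "x \<in> E"
      have "onb (perp E \<theta>) ` {..<?m} \<subseteq> perp_frame ` {..<Suc ?m}"
        by (auto simp: perp_frame_def image_iff intro!: bexI)
      then have "span (onb (perp E \<theta>) ` {..<?m}) \<subseteq> span (perp_frame ` {..<Suc ?m})" by (rule span_mono)
      moreover have "perp_proj \<theta> x \<in> span (onb (perp E \<theta>) ` {..<?m})"
        using perp_proj_mem[OF x] P.is_onb_E by (simp add: is_onb_def)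
      moreover have "inner x \<theta> *\<^sub>R \<theta> \<in> span (perp_frame ` {..<Suc ?m})"
        by (intro span_scale span_base) (auto simp: perp_frame_def image_iff intro!: bexI[of _ ?m])
      ultimately have "perp_proj \<theta> x + inner x \<theta> *\<^sub>R \<theta> \<in> span (perp_frame ` {..<Suc ?m})"
        by (blast intro: span_add)
      then show "x \<in> span (perp_frame ` {..<Suc ?m})" by (simp add: perp_proj_unit[OF \<theta>(2)])
    qed
  qed
  show "dim E = Suc ?m" "is_onb E perp_frame"
    using orthonormal_is_onb[of "Suc ?m" perp_frame E, OF ortho sp] by auto
qed

lemma dim_perp: "dim (perp E \<theta>) = dim E - 1"
  using perp_frame_onb(1) by simp

text \<open>Computed in the basis \<open>perp_frame\<close>, whose last coordinate is split off from
  the product measure.\<close>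

lemma nn_integral_split:
  assumes g[measurable]: "g \<in> borel_measurable borel"
  shows "(\<integral>\<^sup>+x. g x \<partial>lborel_on E) = (\<integral>\<^sup>+y. (\<integral>\<^sup>+t. g (y + t *\<^sub>R \<theta>) \<partial>lborel) \<partial>lborel_on (perp E \<theta>))"
proof -
  interpret product_sigma_finite "\<lambda>_::nat. lborel :: real measure" ..
  let ?m = "dim (perp E \<theta>)"
  have [measurable]: "(\<lambda>x. \<integral>\<^sup>+t. g (x + t *\<^sub>R \<theta>) \<partial>lborel) \<in> borel_measurable borel"
    by measurable
  have "(\<integral>\<^sup>+x. g x \<partial>lborel_on E) = (\<integral>\<^sup>+x. g x \<partial>frame_measure perp_frame)"
    by (simp add: frame_measure_eq[OF perp_frame_onb(2)])
  also have "\<dots> = (\<integral>\<^sup>+c. g (\<Sum>i<Suc ?m. c i *\<^sub>R perp_frame i) \<partial>(\<Pi>\<^sub>M i\<in>{..<Suc ?m}. lborel))"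
    unfolding frame_measure_def perp_frame_onb(1) by (subst nn_integral_distr) auto
  also have "{..<Suc ?m} = insert ?m {..<?m}" by auto
  also have "(\<integral>\<^sup>+c. g (\<Sum>i\<in>insert ?m {..<?m}. c i *\<^sub>R perp_frame i) \<partial>(\<Pi>\<^sub>M i\<in>insert ?m {..<?m}. lborel)) =
    (\<integral>\<^sup>+c. (\<integral>\<^sup>+t. g (\<Sum>i\<in>insert ?m {..<?m}. (c(?m := t)) i *\<^sub>R perp_frame i) \<partial>lborel) \<partial>(\<Pi>\<^sub>M i\<in>{..<?m}. lborel))"
    by (rule product_nn_integral_insert) auto
  also have "\<dots> = (\<integral>\<^sup>+c. (\<integral>\<^sup>+t. g ((\<Sum>i<?m. c i *\<^sub>R onb (perp E \<theta>) i) + t *\<^sub>R \<theta>) \<partial>lborel) \<partial>(\<Pi>\<^sub>M i\<in>{..<?m}. lborel))"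
    by (simp add: perp_frame_def add.commute cong: sum.cong_simp)
  also have "\<dots> = (\<integral>\<^sup>+y. (\<integral>\<^sup>+t. g (y + t *\<^sub>R \<theta>) \<partial>lborel) \<partial>lborel_on (perp E \<theta>))"
    unfolding lborel_on_def by (subst nn_integral_distr) auto
  finally show ?thesis .
qed

lemma emeasure_split:
  assumes A[measurable]: "A \<in> sets borel"
  shows "emeasure (lborel_on E) A = (\<integral>\<^sup>+y. emeasure lborel {t. y + t *\<^sub>R \<theta> \<in> A} \<partial>lborel_on (perp E \<theta>))"
proof -
  have "emeasure (lborel_on E) A = (\<integral>\<^sup>+x. indicator A x \<partial>lborel_on E)" by simp
  also have "\<dots> = (\<integral>\<^sup>+y. (\<integral>\<^sup>+t. indicator A (y + t *\<^sub>R \<theta>) \<partial>lborel) \<partial>lborel_on (perp E \<theta>))"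
    by (rule nn_integral_split) simp
  also have "(\<lambda>y. \<integral>\<^sup>+t. indicator A (y + t *\<^sub>R \<theta>) \<partial>lborel) = (\<lambda>y. emeasure lborel {t. y + t *\<^sub>R \<theta> \<in> A})"
  proof
    fix y
    have "(\<integral>\<^sup>+t. indicator A (y + t *\<^sub>R \<theta>) \<partial>lborel) = (\<integral>\<^sup>+t. indicator {t. y + t *\<^sub>R \<theta> \<in> A} t \<partial>lborel)"
      by (intro nn_integral_cong) (auto simp: indicator_def)
    also have "\<dots> = emeasure lborel {t. y + t *\<^sub>R \<theta> \<in> A}"
      by (rule nn_integral_indicator) simp
    finally show "(\<integral>\<^sup>+t. indicator A (y + t *\<^sub>R \<theta>) \<partial>lborel) = emeasure lborel {t. y + t *\<^sub>R \<theta> \<in> A}" .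
  qed
  finally show ?thesis .
qed

text \<open>On a line y + t \<open>\<theta>\<close> with y in the hyperplane the map acts as t ->
  <y, w> + a t, so it multiplies every fibre length by a. As a matrix it differs from the identity
  in a single row.\<close>

lemma emeasure_shear_stretch:
  assumes a: "a > 0" and w: "inner \<theta> w = 0" and A[measurable]: "A \<in> sets borel"
  shows "ennreal a * emeasure (lborel_on E) {x. x + ((a - 1) * inner x \<theta> + inner x w) *\<^sub>R \<theta> \<in> A}
    = emeasure (lborel_on E) A"
proof -
  have fiber: "ennreal a * emeasure lborel {t. y + t *\<^sub>R \<theta> \<in> {x. x + ((a - 1) * inner x \<theta> + inner x w) *\<^sub>R \<theta> \<in> A}}
    = emeasure lborel {t. y + t *\<^sub>R \<theta> \<in> A}" if y: "y \<in> perp E \<theta>" for y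
  proof -
    have eq: "y + t *\<^sub>R \<theta> + ((a - 1) * inner (y + t *\<^sub>R \<theta>) \<theta> + inner (y + t *\<^sub>R \<theta>) w) *\<^sub>R \<theta>
      = y + (inner y w + a * t) *\<^sub>R \<theta>" for t
    proof -
      have "y + t *\<^sub>R \<theta> + ((a - 1) * inner (y + t *\<^sub>R \<theta>) \<theta> + inner (y + t *\<^sub>R \<theta>) w) *\<^sub>R \<theta>
        = y + (t + ((a - 1) * t + inner y w)) *\<^sub>R \<theta>"
        using y w by (simp add: mem_perp inner_add_left inner_\<theta> scaleR_add_left)
      also have "t + ((a - 1) * t + inner y w) = inner y w + a * t" by (simp add: algebra_simps)
      finally show ?thesis .
    qed
    have "{t. y + t *\<^sub>R \<theta> \<in> A} \<in> sets borel" by measurable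
    from emeasure_lborel_vimage_affine[OF this a, of "inner y w"] show ?thesis
      unfolding mem_Collect_eq eq by (rule sym)
  qed
  have [measurable]: "(\<lambda>y. emeasure lborel {t. y + t *\<^sub>R \<theta> \<in> {x. x + ((a - 1) * inner x \<theta> + inner x w) *\<^sub>R \<theta> \<in> A}})
    \<in> borel_measurable borel" by measurable
  let ?B = "{x. x + ((a - 1) * inner x \<theta> + inner x w) *\<^sub>R \<theta> \<in> A}"
  have B: "?B \<in> sets borel" by measurable
  have "ennreal a * emeasure (lborel_on E) ?B
    = (\<integral>\<^sup>+y. ennreal a * emeasure lborel {t. y + t *\<^sub>R \<theta> \<in> ?B} \<partial>lborel_on (perp E \<theta>))"
    unfolding emeasure_split[OF B] by (rule nn_integral_cmult[symmetric]) measurable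
  also have "\<dots> = emeasure (lborel_on E) A"
    unfolding emeasure_split[OF A]
  proof (rule nn_integral_cong_AE)
    show "AE y in lborel_on (perp E \<theta>). ennreal a * emeasure lborel {t. y + t *\<^sub>R \<theta> \<in> ?B} = emeasure lborel {t. y + t *\<^sub>R \<theta> \<in> A}"
      using P.AE_E by eventually_elim (rule fiber)
  qed
  finally show ?thesis .
qed

end

text \<open>The map has a triangular matrix, hence is a product of maps that change one row each.
  Every factor is a shear and stretch along some \<open>e k\<close>, and the factors multiply to the
  product of the diagonal entries. Gram-Schmidt delivers the isotropic map in just this
  form.\<close>

lemma emeasure_triangular:
  assumes e: "is_onb E e"
    and w: "\<And>i. i < dim E \<Longrightarrow> w i \<in> E" "\<And>i j. i < j \<Longrightarrow> j < dim E \<Longrightarrow> inner (w i) (e j) = 0"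
      "\<And>i. i < dim E \<Longrightarrow> inner (w i) (e i) > 0"
    and A: "A \<in> sets borel"
  shows "ennreal (\<Prod>i<dim E. inner (w i) (e i)) * emeasure (lborel_on E) {x. (\<Sum>i<dim E. inner x (w i) *\<^sub>R e i) \<in> A}
    = emeasure (lborel_on E) A"
proof -
  \<comment> \<open>Rows of index less than \<open>k\<close> are those of the identity:
    \<open>V (dim E)\<close> is the identity on \<open>E\<close>, \<open>V 0\<close> is the given
    map, and \<open>V k\<close> is \<open>V (Suc k)\<close> followed by the change \<open>U\<close>
    of row \<open>k\<close>.\<close>
  define V where "V k x = (\<Sum>i<dim E. inner x (if i < k then e i else w i) *\<^sub>R e i)" for k x
  have Vm[measurable]: "V k \<in> borel_measurable borel" for k unfolding V_def by measurable
  have "ennreal (\<Prod>i\<in>{k..<dim E}. inner (w i) (e i)) * emeasure (lborel_on E) {x. V k x \<in> A} = emeasure (lborel_on E) A"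
    if "k \<le> dim E" "A \<in> sets borel" for k A
    using that
  proof (induction k arbitrary: A rule: inc_induct)
    case base
    note [measurable] = \<open>A \<in> sets borel\<close>
    have "V (dim E) x = x" if "x \<in> E" for x
      using onb_expand[OF e that] by (simp add: V_def cong: sum.cong_simp)
    then have "emeasure (lborel_on E) {x. V (dim E) x \<in> A} = emeasure (lborel_on E) A"
      by (intro emeasure_E_cong) auto
    then show ?case by simp
  next
    case (step k)
    note [measurable] = \<open>A \<in> sets borel\<close>
    let ?a = "inner (w k) (e k)" and ?u = "w k - inner (w k) (e k) *\<^sub>R e k"
    define U where "U x = x + ((?a - 1) * inner x (e k) + inner x ?u) *\<^sub>R e k" for x
    have [measurable]: "U \<in> borel_measurable borel" unfolding U_def by measurable
    have V_inner: "inner (V j x) (e i) = inner x (if i < j then e i else w i)" if "i < dim E" for i j x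
      unfolding V_def by (rule onb_comb_inner[OF e that])
    have uE: "?u \<in> E" using step.hyps by (intro subspace_diff subspace subspace_scale w onb_mem[OF e])
    have uk: "inner (e k) ?u = 0"
      using step.hyps by (simp add: inner_diff_right inner_commute[of "e k" "w k"] onb_inner[OF e])
    have ui: "inner ?u (e i) = 0" if "k \<le> i" "i < dim E" for i
    proof (cases "i = k")
      case True
      then show ?thesis using uk by (simp add: inner_commute)
    next
      case False
      then show ?thesis
        using that step.hyps w(2)[of k i] by (simp add: inner_diff_left onb_inner[OF e])
    qed
    \<comment> \<open>\<open>?u\<close> is the off-diagonal part of \<open>w k\<close>, by
      triangularity a combination of the \<open>e i\<close> with i < k; \<open>V (Suc k)\<close>
      leaves those coordinates unchanged.\<close>
    have Vu: "inner (V (Suc k) x) ?u = inner x ?u" for x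
    proof -
      have "inner (V (Suc k) x) ?u = (\<Sum>i<dim E. inner ?u (e i) * inner (V (Suc k) x) (e i))"
        by (subst inner_commute) (rule onb_inner_expand[OF e uE])
      also have "\<dots> = (\<Sum>i<dim E. inner ?u (e i) * inner x (e i))"
      proof (rule sum.cong[OF refl])
        fix i assume "i \<in> {..<dim E}"
        then show "inner ?u (e i) * inner (V (Suc k) x) (e i) = inner ?u (e i) * inner x (e i)"
          using ui[of i] by (cases "i < k") (auto simp: V_inner)
      qed
      also have "\<dots> = inner x ?u"
        by (subst inner_commute) (rule onb_inner_expand[OF e uE, symmetric])
      finally show ?thesis .
    qed
    have VU: "V k x = U (V (Suc k) x)" for x
    proof -
      have mem: "V j x \<in> E" for j unfolding V_def by (rule onb_comb_mem[OF e])
      have "U (V (Suc k) x) \<in> E" unfolding U_def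
        using step.hyps by (intro subspace_add subspace mem subspace_scale onb_mem[OF e])
      have "inner (V k x) (e i) = inner (U (V (Suc k) x)) (e i)" if i: "i < dim E" for i
      proof (cases "i = k")
        case True
        then show ?thesis
          using step.hyps by (simp add: U_def inner_add_left V_inner Vu onb_inner[OF e])
            (simp add: inner_diff_right algebra_simps)
      next
        case False
        then show ?thesis
          using step.hyps i by (simp add: U_def inner_add_left V_inner onb_inner[OF e])
      qed
      then have "(\<Sum>i<dim E. inner (V k x) (e i) *\<^sub>R e i) = (\<Sum>i<dim E. inner (U (V (Suc k) x)) (e i) *\<^sub>R e i)"
        by (intro sum.cong) auto
      then show ?thesis using onb_expand[OF e mem] onb_expand[OF e \<open>U (V (Suc k) x) \<in> E\<close>] by simp
    qed
    have "{k..<dim E} = insert k {Suc k..<dim E}" using step.hyps by auto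
    then have "ennreal (\<Prod>i\<in>{k..<dim E}. inner (w i) (e i)) * emeasure (lborel_on E) {x. V k x \<in> A}
      = ennreal ?a * (ennreal (\<Prod>i\<in>{Suc k..<dim E}. inner (w i) (e i)) * emeasure (lborel_on E) {x. V (Suc k) x \<in> {x. U x \<in> A}})"
      using w(3)[of k] step.hyps prod_nonneg[of "{Suc k..<dim E}" "\<lambda>i. inner (w i) (e i)"] w(3)
      by (simp add: VU ennreal_mult less_imp_le mult.assoc)
    also have "\<dots> = ennreal ?a * emeasure (lborel_on E) {x. U x \<in> A}"
      by (subst step.IH) auto
    also have "\<dots> = emeasure (lborel_on E) A"
      unfolding U_def using step.hyps uk w(3)
      by (intro emeasure_shear_stretch onb_mem[OF e] onb_norm[OF e]) auto
    finally show ?case .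
  qed
  from this[of 0 A] show ?thesis using A by (simp add: V_def atLeast0LessThan)
qed

section \<open>Scaling, translation and the volume of the unit ball\<close>

lemma emeasure_scale:
  assumes c: "c > 0" and A[measurable]: "A \<in> sets borel"
  shows "ennreal (c ^ dim E) * emeasure (lborel_on E) {x. c *\<^sub>R x \<in> A} = emeasure (lborel_on E) A"
proof -
  let ?e = "onb E"
  note e = is_onb_E
  have "ennreal (\<Prod>i<dim E. inner (c *\<^sub>R ?e i) (?e i)) *
    emeasure (lborel_on E) {x. (\<Sum>i<dim E. inner x (c *\<^sub>R ?e i) *\<^sub>R ?e i) \<in> A} = emeasure (lborel_on E) A"
    using c by (intro emeasure_triangular e A) (auto simp: onb_inner[OF e] onb_mem[OF e] intro!: subspace_scale subspace)
  moreover have "(\<Prod>i<dim E. inner (c *\<^sub>R ?e i) (?e i)) = c ^ dim E"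
    by (simp add: onb_inner[OF e])
  moreover have "emeasure (lborel_on E) {x. (\<Sum>i<dim E. inner x (c *\<^sub>R ?e i) *\<^sub>R ?e i) \<in> A} = emeasure (lborel_on E) {x. c *\<^sub>R x \<in> A}"
  proof (rule emeasure_E_cong)
    have "(\<Sum>i<dim E. inner x (c *\<^sub>R ?e i) *\<^sub>R ?e i) = c *\<^sub>R x" if "x \<in> E" for x
    proof -
      have "(\<Sum>i<dim E. inner x (c *\<^sub>R ?e i) *\<^sub>R ?e i) = c *\<^sub>R (\<Sum>i<dim E. inner x (?e i) *\<^sub>R ?e i)"
        by (simp add: scaleR_sum_right)
      then show ?thesis by (simp only: onb_expand[OF e that])
    qed
    then show "{x. (\<Sum>i<dim E. inner x (c *\<^sub>R ?e i) *\<^sub>R ?e i) \<in> A} \<inter> E = {x. c *\<^sub>R x \<in> A} \<inter> E"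
      by auto
  qed measurable
  ultimately show ?thesis by simp
qed

lemma vol_scale:
  assumes c: "c > 0" and A: "A \<in> sets borel" "bounded A"
  shows "vol E ((*\<^sub>R) c ` A) = c ^ dim E * vol E A"
proof -
  have eq: "(*\<^sub>R) c ` A = {x. (1 / c) *\<^sub>R x \<in> A}"
    using c by (auto simp: image_iff intro!: bexI[where x = "(1 / c) *\<^sub>R _"])
  have m[measurable]: "(*\<^sub>R) c ` A \<in> sets borel"
    unfolding eq using measurable_sets[of "(*\<^sub>R) (1 / c)" borel borel A] A by (simp add: vimage_def)
  have "{x. c *\<^sub>R x \<in> (*\<^sub>R) c ` A} = A" using c by auto
  then have "ennreal (c ^ dim E) * ennreal (vol E A) = ennreal (vol E ((*\<^sub>R) c ` A))"
    using emeasure_scale[OF c m] A by (simp add: emeasure_eq_vol bounded_scaling)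
  then show ?thesis using c by (simp flip: ennreal_mult)
qed

lemma vol_translate:
  assumes v: "v \<in> E" and A: "A \<in> sets borel" "bounded A"
  shows "vol E ((+) v ` A) = vol E A"
proof -
  have eq: "(+) v ` A = {x. - v + x \<in> A}"
    by (auto simp: image_iff intro!: bexI[where x = "_ - v"])
  have "- v \<in> E" using v subspace subspace_neg by blast
  then show ?thesis using emeasure_translate[of "- v" A] A(1) by (simp add: vol_def measure_def eq)
qed

lemma vol_cball: "r > 0 \<Longrightarrow> vol E (cball 0 r) = r ^ dim E * vol E (cball 0 1)"
proof -
  assume r: "r > 0"
  have "(*\<^sub>R) r ` cball 0 1 = (cball 0 r :: 'a set)" using cball_scale[of r 0 1] r by simp
  then show ?thesis using vol_scale[OF r, of "cball 0 1"] by (simp only: borel_closed closed_cball bounded_cball)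
qed

lemma vol_E_Int: "A \<in> sets borel \<Longrightarrow> vol E (E \<inter> A) = vol E A"
  unfolding vol_def measure_def by (subst emeasure_E_cong[of _ A]) auto

text \<open>An exponential Markov bound: on the ball of radius sqrt n the sum of the |c_i| is at
  most n, because |t| <= (1 + t^2) / 2. Hence e^(-n) times its volume is at most the integral of the
  product of the e^(-|c_i|), which is at most 2^n. What counts later is the order n^(-n/2).\<close>

lemma vol_unit_ball:
  assumes "dim E \<ge> 1"
  shows "vol E (cball 0 1) \<le> (2 * exp 1 / sqrt (dim E)) ^ dim E"
proof -
  interpret product_sigma_finite "\<lambda>_::nat. lborel :: real measure" ..
  let ?n = "dim E"
  let ?P = "\<Pi>\<^sub>M i\<in>{..<?n}. lborel :: real measure"
  let ?S = "{c \<in> space ?P. (\<Sum>i<?n. (c i)\<^sup>2) \<le> (sqrt ?n)\<^sup>2}"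
  have "ennreal (exp (- real ?n)) * emeasure ?P ?S = (\<integral>\<^sup>+c. ennreal (exp (- real ?n)) * indicator ?S c \<partial>?P)"
    by (rule nn_integral_cmult_indicator[symmetric]) measurable
  also have "\<dots> \<le> (\<integral>\<^sup>+c. (\<Prod>i<?n. ennreal (exp (- \<bar>c i\<bar>))) \<partial>?P)"
  proof (rule nn_integral_mono)
    fix c
    show "ennreal (exp (- real ?n)) * indicator ?S c \<le> (\<Prod>i<?n. ennreal (exp (- \<bar>c i\<bar>)))"
    proof (cases "c \<in> ?S")
      case True
      have "\<bar>t\<bar> \<le> (1 + t\<^sup>2) / 2" for t :: real
        using zero_le_power2[of "\<bar>t\<bar> - 1"] by (simp add: power2_eq_square algebra_simps abs_mult_self_eq)
      then have "(\<Sum>i<?n. \<bar>c i\<bar>) \<le> (\<Sum>i<?n. (1 + (c i)\<^sup>2) / 2)" by (intro sum_mono)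
      also have "\<dots> = (real ?n + (\<Sum>i<?n. (c i)\<^sup>2)) / 2" by (simp add: sum.distrib flip: sum_divide_distrib)
      also have "\<dots> \<le> real ?n" using True by simp
      finally have "exp (- real ?n) \<le> exp (\<Sum>i<?n. - \<bar>c i\<bar>)" by (simp add: sum_negf)
      also have "\<dots> = (\<Prod>i<?n. exp (- \<bar>c i\<bar>))" by (simp add: exp_sum)
      finally have "ennreal (exp (- real ?n)) \<le> ennreal (\<Prod>i<?n. exp (- \<bar>c i\<bar>))" by (rule ennreal_leI)
      then show ?thesis using True by (simp add: prod_ennreal)
    next
      case False
      then have "indicator ?S c = (0::ennreal)" by (rule indicator_simps(2))
      then show ?thesis by (simp only: mult_zero_right zero_le)
    qed
  qed
  also have "\<dots> = (\<Prod>i<?n. \<integral>\<^sup>+t. ennreal (exp (- \<bar>t\<bar>)) \<partial>lborel)"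
    by (rule product_nn_integral_prod) auto
  also have "\<dots> \<le> ennreal (2 ^ ?n)"
    using power_mono[OF nn_integral_exp_abs, of ?n] by (simp flip: ennreal_power)
  finally have "ennreal (exp (- real ?n)) * emeasure (frame_measure (onb E)) (cball 0 (sqrt ?n)) \<le> ennreal (2 ^ ?n)"
    by (subst emeasure_frame_cball[OF is_onb_E]) auto
  then have "exp (- real ?n) * vol E (cball 0 (sqrt ?n)) \<le> 2 ^ ?n"
    by (simp add: emeasure_eq_vol flip: lborel_on_frame ennreal_mult)
  then have "exp (- real ?n) * (sqrt ?n ^ ?n * vol E (cball 0 1)) \<le> 2 ^ ?n"
    using assms by (simp add: vol_cball[of "sqrt ?n"])
  then have "vol E (cball 0 1) \<le> (2 * exp 1) ^ ?n / sqrt ?n ^ ?n"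
    using assms by (simp add: field_simps exp_minus power_mult_distrib flip: exp_of_nat_mult)
  then show ?thesis by (simp add: power_divide)
qed

end

section \<open>Brunn-Minkowski and parallel bodies\<close>

text \<open>By concavity of ln f the slopes of ln f from 0 increase as h decreases to 0; bounded by
  \<open>B\<close>, they converge to their supremum. The last conclusion keeps the information that
  every slope lies below the limit.\<close>

lemma log_concave_right_derivative:
  fixes f :: "real \<Rightarrow> real"
  assumes pos: "\<And>t. t \<ge> 0 \<Longrightarrow> f t > 0" and mono: "\<And>t. t \<ge> 0 \<Longrightarrow> f 0 \<le> f t"
    and conc: "\<And>s t l. 0 \<le> s \<Longrightarrow> 0 \<le> t \<Longrightarrow> 0 < l \<Longrightarrow> l < 1 \<Longrightarrow> f s powr (1 - l) * f t powr l \<le> f ((1 - l) * s + l * t)"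
    and bound: "\<And>t. t \<ge> 0 \<Longrightarrow> f t \<le> f 0 * exp (B * t)"
  obtains c where "((\<lambda>h. (f h - f 0) / h) \<longlongrightarrow> c) (at_right 0)" "0 \<le> c" "c \<le> B * f 0"
    "\<And>h. h > 0 \<Longrightarrow> f 0 * ((ln (f h) - ln (f 0)) / h) \<le> c"
proof -
  define S where "S h = (ln (f h) - ln (f 0)) / h" for h
  have f0: "f 0 > 0" using pos by simp
  have S_decr: "S k \<le> S h" if "0 < h" "h < k" for h k
  proof -
    define l where "l = h / k"
    have l: "0 < l" "l < 1" using that by (auto simp: l_def)
    have hl: "h = (1 - l) * 0 + l * k" using that by (simp add: l_def)
    have "(1 - l) * ln (f 0) + l * ln (f k) = ln (f 0 powr (1 - l) * f k powr l)"
      using pos[of k] f0 that by (simp add: ln_mult ln_powr)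
    also have "\<dots> \<le> ln (f h)"
      using conc[of 0 k l] l that pos[of k] pos[of h] f0 unfolding hl[symmetric] by (subst ln_le_cancel_iff) auto
    finally have "l * (ln (f k) - ln (f 0)) \<le> ln (f h) - ln (f 0)" by (simp add: algebra_simps)
    then have "l * (ln (f k) - ln (f 0)) / h \<le> S h" unfolding S_def using that by (intro divide_right_mono) auto
    then show ?thesis using that by (simp add: l_def S_def)
  qed
  have S_le: "S h \<le> B" if "h > 0" for h
  proof -
    have "ln (f h) \<le> ln (f 0 * exp (B * h))" using bound[of h] pos[of h] that f0 by simp
    also have "\<dots> = ln (f 0) + B * h" using f0 by (simp add: ln_mult)
    finally show ?thesis using that by (simp add: S_def field_simps)
  qed
  have S_ge: "0 \<le> S h" if "h > 0" for h
    using mono[of h] pos[of h] f0 that by (simp add: S_def)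
  define p where "p = Sup (S ` {0<..})"
  have bdd: "bdd_above (S ` {0<..})" using S_le by (auto intro!: bdd_aboveI)
  have S_p: "S h \<le> p" if "h > 0" for h
    unfolding p_def using that bdd by (auto intro: cSup_upper)
  have p_B: "p \<le> B" unfolding p_def using S_le by (intro cSup_least) auto
  have p_0: "0 \<le> p" using S_p[of 1] S_ge[of 1] by simp
  have S_lim: "(S \<longlongrightarrow> p) (at_right 0)"
  proof (rule order_tendstoI)
    fix a assume "a < p"
    then obtain h where h: "h > 0" "a < S h"
      using less_cSupD[of "S ` {0<..}" a] unfolding p_def by auto
    have "a < S k" if "0 < k" "k < h" for k
      using S_decr[OF that] h by simp
    then show "\<forall>\<^sub>F k in at_right 0. a < S k"
      using eventually_at_right_real[OF h(1)] by (auto elim!: eventually_mono)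
  next
    fix a assume "p < a"
    then have "S k < a" if "0 < k" for k using S_p[OF that] by simp
    then show "\<forall>\<^sub>F k in at_right 0. S k < a"
      by (auto simp: eventually_at_right_field intro: exI[of _ 1])
  qed
  then have "((\<lambda>t. ln (f t)) has_real_derivative p) (at 0 within {0<..})"
    by (simp add: has_field_derivative_iff S_def[abs_def])
  \<comment> \<open>Exponentiating turns the one-sided derivative p of ln f into the derivative f(0)
    p of f.\<close>
  then have "((\<lambda>t. exp (ln (f t))) has_real_derivative exp (ln (f 0)) * p) (at 0 within {0<..})"
    by (rule DERIV_chain2[OF DERIV_exp])
  then have "((\<lambda>h. (exp (ln (f h)) - exp (ln (f 0))) / h) \<longlongrightarrow> f 0 * p) (at_right 0)"
    using f0 by (simp add: has_field_derivative_iff)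
  then have lim: "((\<lambda>h. (f h - f 0) / h) \<longlongrightarrow> f 0 * p) (at_right 0)"
    by (rule Lim_transform_eventually)
      (use pos f0 in \<open>auto simp: eventually_at_right_field less_imp_le intro!: exI[of _ 1]\<close>)
  show thesis
  proof (rule that[OF lim])
    show "0 \<le> f 0 * p" "f 0 * p \<le> B * f 0" using f0 p_0 p_B by auto
    show "f 0 * ((ln (f h) - ln (f 0)) / h) \<le> f 0 * p" if "h > 0" for h
      using S_p[OF that] f0 unfolding S_def by (intro mult_left_mono) auto
  qed
qed

text \<open>Both a and h are convex combinations of 0 and a + h, with the two weights exchanged; in
  the product of the two inequalities the exponents add up to 1.\<close>

lemma log_concave_mult:
  fixes f :: "real \<Rightarrow> real"
  assumes pos: "\<And>t. t \<ge> 0 \<Longrightarrow> f t > 0"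
    and conc: "\<And>s t l. 0 \<le> s \<Longrightarrow> 0 \<le> t \<Longrightarrow> 0 < l \<Longrightarrow> l < 1 \<Longrightarrow> f s powr (1 - l) * f t powr l \<le> f ((1 - l) * s + l * t)"
    and ah: "a \<ge> 0" "h > 0"
  shows "f (a + h) * f 0 \<le> f a * f h"
proof (cases "a = 0")
  case False
  define l where "l = h / (a + h)"
  have l: "0 < l" "l < 1" using ah False by (auto simp: l_def)
  have e: "(1 - l) * 0 + l * (a + h) = h" "(1 - (1 - l)) * 0 + (1 - l) * (a + h) = a"
    using ah False by (auto simp: l_def field_simps)
  let ?u = "f 0" and ?v = "f (a + h)"
  have uv: "?u > 0" "?v > 0" using pos ah by auto
  have "?u powr (1 - l) * ?v powr l \<le> f h" "?u powr (1 - (1 - l)) * ?v powr (1 - l) \<le> f a"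
    using conc[of 0 "a + h" l] conc[of 0 "a + h" "1 - l"] l ah unfolding e by auto
  then have "(?u powr (1 - (1 - l)) * ?v powr (1 - l)) * (?u powr (1 - l) * ?v powr l) \<le> f a * f h"
    using pos[of a] ah by (intro mult_mono) auto
  moreover have "(?u powr (1 - (1 - l)) * ?v powr (1 - l)) * (?u powr (1 - l) * ?v powr l)
    = (?u powr (1 - (1 - l)) * ?u powr (1 - l)) * (?v powr (1 - l) * ?v powr l)" by (simp only: mult_ac)
  moreover have "\<dots> = ?u * ?v" using uv by (simp flip: powr_add)
  ultimately show ?thesis by (simp only: mult.commute[of "f (a + h)"])
qed (simp add: mult.commute)

section \<open>Prekopa-Leindler in a subspace, by slicing\<close>

context fd_subspace
begin

text \<open>Being bounded with bounded support passes to slices and marginals, which keeps an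
  induction on the dimension inside one class of functions. For the marginal it matters that y is
  orthogonal to \<open>\<theta>\<close>: then |y + t \<open>\<theta>\<close>| dominates both |y| and
  |t|.\<close>

lemma marginal:
  assumes \<theta>: "\<theta> \<in> E" "norm \<theta> = 1" and f: "bounded_profile f"
  shows "bounded_profile (\<lambda>y. f (y + t *\<^sub>R \<theta>))"
    and "bounded_profile (\<lambda>t. LINT y|lborel_on (perp E \<theta>). f (y + t *\<^sub>R \<theta>))"
    and "(LINT t|lborel. LINT y|lborel_on (perp E \<theta>). f (y + t *\<^sub>R \<theta>)) = (LINT x|lborel_on E. f x)"
proof -
  interpret P: fd_subspace "perp E \<theta>" by (rule fd_perp[OF \<theta>])
  interpret PM: sigma_finite_measure "lborel_on (perp E \<theta>)" by (rule P.sigma_finite_E)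
  interpret pair_sigma_finite "lborel_on (perp E \<theta>)" "lborel :: real measure" ..
  note [measurable] = bounded_profile_measurable[OF f]
  note nn = bounded_profile_nonneg[OF f]
  obtain M R where MR: "M > 0" "R > 0" "\<And>x. f x \<le> M * indicator (cball 0 R) x"
    using f by (elim bounded_profileE) blast
  have slice: "bounded_profile (\<lambda>y. f (y + t *\<^sub>R \<theta>))" for t
  proof -
    have "f (y + t *\<^sub>R \<theta>) \<le> M * indicator (cball 0 (R + \<bar>t\<bar>)) y" for y
    proof -
      have "norm y \<le> norm (y + t *\<^sub>R \<theta>) + \<bar>t\<bar>"
        using norm_triangle_ineq4[of "y + t *\<^sub>R \<theta>" "t *\<^sub>R \<theta>"] \<theta>(2) by simp
      then have "indicator (cball 0 R) (y + t *\<^sub>R \<theta>) \<le> (indicator (cball 0 (R + \<bar>t\<bar>)) y :: real)"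
        by (cases "norm (y + t *\<^sub>R \<theta>) \<le> R") auto
      then show ?thesis
        using MR(3)[of "y + t *\<^sub>R \<theta>"] MR(1) by (meson mult_left_mono order_trans less_imp_le)
    qed
    then show ?thesis unfolding bounded_profile_def using nn by (auto intro!: exI)
  qed
  then show "bounded_profile (\<lambda>y. f (y + t *\<^sub>R \<theta>))" .
  let ?F = "\<lambda>t. LINT y|lborel_on (perp E \<theta>). f (y + t *\<^sub>R \<theta>)"
  have F_nn: "?F t \<ge> 0" for t using nn by (intro Bochner_Integration.integral_nonneg) auto
  have int: "integrable (lborel_on (perp E \<theta>)) (\<lambda>y. f (y + t *\<^sub>R \<theta>))" for t
    using slice by (rule bounded_profile_integrable) (auto simp: P.emeasure_cball_finite[simplified])
  have Fm[measurable]: "?F \<in> borel_measurable borel"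
    by (rule PM.borel_measurable_lebesgue_integral) measurable
  show F: "bounded_profile ?F"
    unfolding bounded_profile_def
  proof (intro conjI exI allI)
    fix t
    have "?F t \<le> (LINT y|lborel_on (perp E \<theta>). M * indicator (cball 0 R) t * indicator (cball 0 R) y)"
    proof (rule integral_mono_AE[OF int])
      show "integrable (lborel_on (perp E \<theta>)) (\<lambda>y. M * indicator (cball 0 R) t * indicator (cball 0 R) y :: real)"
        by (intro integrable_mult_right integrable_real_indicator) (auto simp: P.emeasure_cball_finite[simplified])
      show "AE y in lborel_on (perp E \<theta>). f (y + t *\<^sub>R \<theta>) \<le> M * indicator (cball 0 R) t * indicator (cball 0 R) y"
        using P.AE_E
      proof eventually_elim
        case (elim y)
        have "inner (y + t *\<^sub>R \<theta>) (y + t *\<^sub>R \<theta>) = inner y y + t * t"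
          using elim by (simp add: inner_add_left inner_add_right mem_perp inner_commute[of \<theta> y] inner_\<theta>[OF \<theta>])
        then have sq: "(norm (y + t *\<^sub>R \<theta>))\<^sup>2 = (norm y)\<^sup>2 + t\<^sup>2"
          by (simp add: power2_norm_eq_inner power2_eq_square[of t])
        have "norm y \<le> norm (y + t *\<^sub>R \<theta>)" "\<bar>t\<bar> \<le> norm (y + t *\<^sub>R \<theta>)"
          by (rule power2_le_imp_le, simp add: sq, simp)+
        then show ?case using MR(3)[of "y + t *\<^sub>R \<theta>"] MR(1)
          by (cases "norm (y + t *\<^sub>R \<theta>) \<le> R") (auto intro: order_trans)
      qed
    qed
    also have "\<dots> = M * indicator (cball 0 R) t * vol (perp E \<theta>) (cball 0 R)"
      by (simp add: vol_def)
    finally show "?F t \<le> (M * vol (perp E \<theta>) (cball 0 R)) * indicator (cball 0 R) t" by (simp add: mult_ac)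
  qed (use F_nn in auto)
  have "ennreal (LINT t|lborel. ?F t) = (\<integral>\<^sup>+t. ennreal (?F t) \<partial>lborel)"
    using F_nn by (intro nn_integral_eq_integral[symmetric] bounded_profile_integrable[OF F])
      (auto intro!: emeasure_lborel_cball_finite[unfolded infinity_ennreal_def top.not_eq_extremum])
  also have "\<dots> = (\<integral>\<^sup>+t. (\<integral>\<^sup>+y. f (y + t *\<^sub>R \<theta>) \<partial>lborel_on (perp E \<theta>)) \<partial>lborel)"
    using nn by (intro nn_integral_cong nn_integral_eq_integral[symmetric] int) auto
  also have "\<dots> = (\<integral>\<^sup>+y. (\<integral>\<^sup>+t. f (y + t *\<^sub>R \<theta>) \<partial>lborel) \<partial>lborel_on (perp E \<theta>))"
    by (rule Fubini') measurable
  also have "\<dots> = (\<integral>\<^sup>+x. f x \<partial>lborel_on E)"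
    by (rule nn_integral_split[OF \<theta>, symmetric]) measurable
  also have "\<dots> = ennreal (LINT x|lborel_on E. f x)"
    using nn by (intro nn_integral_eq_integral bounded_profile_integrable[OF f])
      (auto simp: emeasure_cball_finite[simplified])
  finally show "(LINT t|lborel. ?F t) = (LINT x|lborel_on E. f x)"
    using F_nn nn by simp
qed

end

text \<open>Induction on the dimension with the subspace varying: the hypothesis for the hyperplane
  compares slices at heights s, t and (1 - l) s + l t, which is the assumption of the inequality on
  the line for the three marginals. In dimension 0 the measure is the unit mass at 0.\<close>

lemma prekopa_leindler:
  fixes E :: "'a::{real_inner, second_countable_topology} set" and f g h :: "'a \<Rightarrow> real"
  assumes "fd_subspace E" "0 < l" "l < 1" "bounded_profile f" "bounded_profile g" "bounded_profile h"
    and "\<And>x y. x \<in> E \<Longrightarrow> y \<in> E \<Longrightarrow> f x powr (1 - l) * g y powr l \<le> h ((1 - l) *\<^sub>R x + l *\<^sub>R y)"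
  shows "(LINT x|lborel_on E. f x) powr (1 - l) * (LINT x|lborel_on E. g x) powr l \<le> (LINT x|lborel_on E. h x)"
  using assms
proof (induction "dim E" arbitrary: E f g h)
  case 0
  interpret fd_subspace E by fact
  have "(LINT x|lborel_on E. k x) = k 0" if "bounded_profile k" for k
  proof -
    have [measurable]: "k \<in> borel_measurable borel" by (rule bounded_profile_measurable[OF that])
    show ?thesis
      unfolding lborel_on_def using 0(1)[symmetric]
      by (subst integral_distr) (simp_all add: PiM_empty lebesgue_integral_count_space_finite)
  qed
  then show ?case using 0(5,6,7) 0(8)[OF zero_E zero_E] by simp
next
  case (Suc m)
  interpret fd_subspace E by fact
  define \<theta> where "\<theta> = onb E 0"
  have \<theta>: "\<theta> \<in> E" "norm \<theta> = 1"
    using onb_mem[OF is_onb_E, of 0] onb_norm[OF is_onb_E, of 0] Suc.hyps(2) by (auto simp: \<theta>_def)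
  have m: "m = dim (perp E \<theta>)" using dim_perp[OF \<theta>] Suc.hyps(2) by simp
  note marg = marginal[OF \<theta>]
  have "(LINT t|lborel. LINT y|lborel_on (perp E \<theta>). f (y + t *\<^sub>R \<theta>)) powr (1 - l) *
    (LINT t|lborel. LINT y|lborel_on (perp E \<theta>). g (y + t *\<^sub>R \<theta>)) powr l
    \<le> (LINT t|lborel. LINT y|lborel_on (perp E \<theta>). h (y + t *\<^sub>R \<theta>))"
  proof (rule prekopa_leindler_real)
    fix s t
    show "(LINT y|lborel_on (perp E \<theta>). f (y + s *\<^sub>R \<theta>)) powr (1 - l) *
      (LINT y|lborel_on (perp E \<theta>). g (y + t *\<^sub>R \<theta>)) powr l
      \<le> (LINT y|lborel_on (perp E \<theta>). h (y + ((1 - l) * s + l * t) *\<^sub>R \<theta>))"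
    proof (rule Suc.hyps(1)[OF m fd_perp[OF \<theta>] Suc.prems(2,3)])
      fix x y assume "x \<in> perp E \<theta>" "y \<in> perp E \<theta>"
      then have "x + s *\<^sub>R \<theta> \<in> E" "y + t *\<^sub>R \<theta> \<in> E"
        using \<theta> by (auto simp: mem_perp intro!: subspace_add subspace subspace_scale)
      from Suc.prems(7)[OF this]
      show "f (x + s *\<^sub>R \<theta>) powr (1 - l) * g (y + t *\<^sub>R \<theta>) powr l
        \<le> h ((1 - l) *\<^sub>R x + l *\<^sub>R y + ((1 - l) * s + l * t) *\<^sub>R \<theta>)"
        by (simp add: scaleR_add_left scaleR_add_right add_ac)
    qed (intro marg Suc.prems)+
  qed (intro marg Suc.prems)+
  then show ?case using marg(3) Suc.prems by simp
qed

section \<open>Parallel bodies: volume growth and surface area\<close>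

definition parallel_body :: "'a::real_inner set \<Rightarrow> 'a set \<Rightarrow> real \<Rightarrow> 'a set"
  where "parallel_body E K t = {x + t *\<^sub>R u | x u. x \<in> K \<and> u \<in> E \<and> norm u \<le> 1}"

lemma surface_area_parallel_body:
  "surface_area E K = Lim (at_right 0) (\<lambda>t. (vol E (parallel_body E K t) - vol E K) / t)"
  by (simp add: surface_area_def parallel_body_def)

context fd_subspace
begin

text \<open>Multiplicative, dimension-free form: Prekopa-Leindler for indicator functions, with any
  bounded Borel \<open>C\<close> that contains the combinations.\<close>

lemma brunn_minkowski:
  assumes l: "0 < l" "l < 1"
    and A: "A \<in> sets borel" "bounded A" and B: "B \<in> sets borel" "bounded B" and C: "C \<in> sets borel" "bounded C"
    and sub: "\<And>a b. a \<in> A \<Longrightarrow> b \<in> B \<Longrightarrow> (1 - l) *\<^sub>R a + l *\<^sub>R b \<in> C"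
  shows "vol E A powr (1 - l) * vol E B powr l \<le> vol E C"
proof -
  have prof: "bounded_profile (indicator S :: 'a \<Rightarrow> real)" if S: "S \<in> sets borel" "bounded S" for S
  proof -
    obtain R where "\<forall>x\<in>S. norm x \<le> R" using S(2) by (auto simp: bounded_iff)
    then have "(indicator S x :: real) \<le> 1 * indicator (cball 0 R) x" for x
      by (cases "x \<in> S") auto
    then show ?thesis unfolding bounded_profile_def using S(1)
      by (intro conjI exI[of _ 1] exI[of _ R] allI) auto
  qed
  have "(LINT x|lborel_on E. indicator A x) powr (1 - l) * (LINT x|lborel_on E. indicator B x) powr l
    \<le> (LINT x|lborel_on E. indicator C x :: real)"
  proof (rule prekopa_leindler[OF fd_subspace_axioms l prof[OF A] prof[OF B] prof[OF C]])
    fix x y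
    show "(indicator A x :: real) powr (1 - l) * indicator B y powr l \<le> indicator C ((1 - l) *\<^sub>R x + l *\<^sub>R y)"
      using sub[of x y] by (cases "x \<in> A"; cases "y \<in> B") auto
  qed
  then show ?thesis by (simp add: vol_def)
qed

text \<open>The ambient space may be infinite-dimensional, where closed and bounded does not give
  compact. The ball is a closed subset of a coordinate box, which is a finite Minkowski sum of
  segments.\<close>

lemma compact_E_cball: "compact (E \<inter> cball 0 r)"
proof -
  define b where "b = onb E"
  have b: "is_onb E b" using is_onb_E by (simp add: b_def)
  have S: "compact {\<Sum>i<k. c i *\<^sub>R b i | c. \<forall>i<k. \<bar>c i\<bar> \<le> r}" for k :: nat
  proof (induction k)
    case 0
    show ?case by simp
  next
    case (Suc k)
    have "compact ((\<lambda>t. t *\<^sub>R b k) ` {-r..r})" by (intro compact_continuous_image continuous_intros) simp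
    from compact_sums[OF Suc this]
    have "compact {x + y |x y. x \<in> {\<Sum>i<k. c i *\<^sub>R b i | c. \<forall>i<k. \<bar>c i\<bar> \<le> r} \<and> y \<in> (\<lambda>t. t *\<^sub>R b k) ` {-r..r}}" .
    also have "{x + y |x y. x \<in> {\<Sum>i<k. c i *\<^sub>R b i | c. \<forall>i<k. \<bar>c i\<bar> \<le> r} \<and> y \<in> (\<lambda>t. t *\<^sub>R b k) ` {-r..r}}
      = {\<Sum>i<Suc k. c i *\<^sub>R b i | c. \<forall>i<Suc k. \<bar>c i\<bar> \<le> r}" (is "?L = ?R")
    proof (intro equalityI subsetI)
      fix z assume "z \<in> ?L"
      then obtain c t where "z = (\<Sum>i<k. c i *\<^sub>R b i) + t *\<^sub>R b k" "\<forall>i<k. \<bar>c i\<bar> \<le> r" "\<bar>t\<bar> \<le> r"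
        by (auto simp: abs_le_iff)
      then show "z \<in> ?R"
        by (intro CollectI exI[of _ "c(k := t)"]) (auto simp: less_Suc_eq)
    next
      fix z assume "z \<in> ?R"
      then obtain c where "z = (\<Sum>i<Suc k. c i *\<^sub>R b i)" "\<forall>i<Suc k. \<bar>c i\<bar> \<le> r" by blast
      moreover have "c k *\<^sub>R b k \<in> (\<lambda>t. t *\<^sub>R b k) ` {-r..r}"
      proof (rule imageI)
        have "\<bar>c k\<bar> \<le> r" using calculation(2) by simp
        then show "c k \<in> {-r..r}" by (simp add: abs_le_iff)
      qed
      moreover have "(\<Sum>i<k. c i *\<^sub>R b i) \<in> {\<Sum>i<k. c i *\<^sub>R b i | c. \<forall>i<k. \<bar>c i\<bar> \<le> r}"
        using calculation(2) less_Suc_eq by blast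
      ultimately show "z \<in> ?L" unfolding sum.lessThan_Suc by blast
    qed
    finally show ?case .
  qed
  have "E \<inter> cball 0 r = {\<Sum>i<dim E. c i *\<^sub>R b i | c. \<forall>i<dim E. \<bar>c i\<bar> \<le> r} \<inter> (E \<inter> cball 0 r)" (is "?L = ?S \<inter> ?L")
  proof -
    have "x \<in> ?S" if "x \<in> ?L" for x
    proof -
      have "\<bar>inner x (b i)\<bar> \<le> r" if "i < dim E" for i
        using Cauchy_Schwarz_ineq2[of x "b i"] onb_norm[OF b that] \<open>x \<in> ?L\<close> by simp
      then show ?thesis using onb_expand[OF b, of x] \<open>x \<in> ?L\<close>
        by (intro CollectI exI[of _ "\<lambda>i. inner x (b i)"]) auto
    qed
    then show ?thesis by blast
  qed
  also have "compact \<dots>"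
    by (intro compact_Int_closed S closed_Int closed_E closed_cball)
  finally show ?thesis .
qed

text \<open>Working form of \<open>convex_body\<close>: the interior point relative to
  \<open>E\<close> comes with an explicit ball of \<open>E\<close>, whose radius enters the growth
  estimates.\<close>

definition body :: "'a set \<Rightarrow> bool"
  where "body K \<longleftrightarrow> K \<subseteq> E \<and> compact K \<and> convex K \<and> (\<exists>x\<in>K. \<exists>r>0. \<forall>u\<in>E. norm u \<le> r \<longrightarrow> x + u \<in> K)"

lemma bodyD:
  assumes "body K"
  shows "K \<subseteq> E" "compact K" "convex K" "K \<in> sets borel" "bounded K" "closed K"
  using assms by (auto simp: body_def compact_imp_closed compact_imp_bounded)

lemma body_ballE:
  assumes "body K"
  obtains x r where "x \<in> K" "r > 0" "\<And>u. u \<in> E \<Longrightarrow> norm u \<le> r \<Longrightarrow> x + u \<in> K"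
  using assms unfolding body_def by blast

lemma convex_body_body:
  assumes "convex_body E K"
  shows "body K"
proof -
  from assms obtain x where K: "K \<subseteq> E" "compact K" "convex K" and x: "x \<in> top_of_set E interior_of K"
    by (auto simp: convex_body_def)
  then obtain T where T: "openin (top_of_set E) T" "x \<in> T" "T \<subseteq> K"
    by (auto simp: interior_of_def)
  then obtain r where r: "r > 0" "ball x r \<inter> E \<subseteq> T"
    by (metis openin_contains_ball)
  have xE: "x \<in> E" using T K by blast
  have "x + u \<in> K" if "u \<in> E" "norm u \<le> r / 2" for u
  proof -
    have "x + u \<in> ball x r \<inter> E" using that r xE by (auto simp: dist_norm intro!: subspace_add subspace)
    then show ?thesis using r T by blast
  qed
  then show ?thesis unfolding body_def using K T r by (auto intro!: bexI[of _ x] exI[of _ "r / 2"])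
qed

lemma parallel_body_0 [simp]: "parallel_body E K 0 = K"
  unfolding parallel_body_def using zero_E by (auto intro!: exI[of _ "0 :: 'a"])

lemma subset_parallel_body: "K \<subseteq> parallel_body E K t"
  unfolding parallel_body_def using zero_E by (force intro: exI[of _ "0 :: 'a"])

lemma parallel_body_add:
  assumes st: "s \<ge> 0" "t \<ge> 0"
  shows "parallel_body E (parallel_body E K s) t = parallel_body E K (s + t)"
proof (cases "s + t = 0")
  case True
  then have "s = 0" "t = 0" using st by auto
  then show ?thesis by simp
next
  case False
  then have pos: "s + t > 0" using st by simp
  show ?thesis
  proof (intro equalityI subsetI)
    fix z assume "z \<in> parallel_body E (parallel_body E K s) t"
    then obtain x u v where z: "z = x + s *\<^sub>R u + t *\<^sub>R v" "x \<in> K" "u \<in> E" "v \<in> E" "norm u \<le> 1" "norm v \<le> 1"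
      unfolding parallel_body_def by blast
    define w where "w = (1 / (s + t)) *\<^sub>R (s *\<^sub>R u + t *\<^sub>R v)"
    have "norm (s *\<^sub>R u + t *\<^sub>R v) \<le> s * norm u + t * norm v"
      using norm_triangle_ineq[of "s *\<^sub>R u" "t *\<^sub>R v"] st by simp
    also have "\<dots> \<le> s * 1 + t * 1" using st z by (intro add_mono mult_left_mono) auto
    finally have "norm w \<le> 1" using pos by (simp add: w_def)
    moreover have "w \<in> E" unfolding w_def using z by (intro subspace_scale subspace_add subspace)
    moreover have "z = x + (s + t) *\<^sub>R w" using z pos by (simp add: w_def)
    ultimately show "z \<in> parallel_body E K (s + t)" using z unfolding parallel_body_def by blast
  next
    fix z assume "z \<in> parallel_body E K (s + t)"
    then obtain x u where z: "z = x + (s + t) *\<^sub>R u" "x \<in> K" "u \<in> E" "norm u \<le> 1"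
      unfolding parallel_body_def by blast
    then have "z = (x + s *\<^sub>R u) + t *\<^sub>R u" by (simp add: scaleR_add_left)
    then show "z \<in> parallel_body E (parallel_body E K s) t" using z unfolding parallel_body_def by blast
  qed
qed

lemma parallel_body_mono: "0 \<le> s \<Longrightarrow> s \<le> t \<Longrightarrow> parallel_body E K s \<subseteq> parallel_body E K t"
  using parallel_body_add[of s "t - s" K] subset_parallel_body[of "parallel_body E K s" "t - s"] by simp

lemma parallel_body_combine:
  assumes K: "convex K" and st: "s \<ge> 0" "t \<ge> 0" and l: "0 \<le> l" "l \<le> 1"
    and a: "a \<in> parallel_body E K s" and b: "b \<in> parallel_body E K t"
  shows "(1 - l) *\<^sub>R a + l *\<^sub>R b \<in> parallel_body E K ((1 - l) * s + l * t)"
proof -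
  obtain x u y v where ab: "a = x + s *\<^sub>R u" "x \<in> K" "u \<in> E" "norm u \<le> 1"
    "b = y + t *\<^sub>R v" "y \<in> K" "v \<in> E" "norm v \<le> 1"
    using a b unfolding parallel_body_def by blast
  let ?z = "(1 - l) *\<^sub>R x + l *\<^sub>R y"
  have "?z \<in> K" using K ab l by (intro convexD) auto
  then have "?z + ((1 - l) * s) *\<^sub>R u \<in> parallel_body E K ((1 - l) * s)"
    unfolding parallel_body_def using ab by blast
  then have "?z + ((1 - l) * s) *\<^sub>R u + (l * t) *\<^sub>R v \<in> parallel_body E (parallel_body E K ((1 - l) * s)) (l * t)"
    unfolding parallel_body_def[of E "parallel_body E K ((1 - l) * s)"] using ab by blast
  moreover have "?z + ((1 - l) * s) *\<^sub>R u + (l * t) *\<^sub>R v = (1 - l) *\<^sub>R a + l *\<^sub>R b"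
    by (simp add: ab algebra_simps)
  ultimately show ?thesis using st l by (simp add: parallel_body_add)
qed

lemma body_parallel_body:
  assumes K: "body K" and t: "t \<ge> 0"
  shows "body (parallel_body E K t)"
proof -
  note k = bodyD[OF K]
  have "parallel_body E K t = {x + y |x y. x \<in> K \<and> y \<in> (*\<^sub>R) t ` (E \<inter> cball 0 1)}"
    unfolding parallel_body_def by fastforce
  moreover have "compact \<dots>"
    by (intro compact_sums k compact_scaling compact_E_cball)
  ultimately have "compact (parallel_body E K t)" by simp
  moreover have "parallel_body E K t \<subseteq> E"
    unfolding parallel_body_def using k(1) by (auto intro!: subspace_add subspace subspace_scale)
  moreover have "convex (parallel_body E K t)"
  proof (rule convexI)
    fix a b u v :: _ assume "a \<in> parallel_body E K t" "b \<in> parallel_body E K t" and uv: "0 \<le> u" "0 \<le> v" "u + v = (1::real)"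
    then have "(1 - v) *\<^sub>R a + v *\<^sub>R b \<in> parallel_body E K ((1 - v) * t + v * t)"
      by (intro parallel_body_combine k t) auto
    moreover have "1 - v = u" using uv by simp
    ultimately show "u *\<^sub>R a + v *\<^sub>R b \<in> parallel_body E K t" using uv by (simp flip: distrib_right)
  qed
  moreover have "\<exists>x\<in>parallel_body E K t. \<exists>r>0. \<forall>u\<in>E. norm u \<le> r \<longrightarrow> x + u \<in> parallel_body E K t"
    using subset_parallel_body[of K t] K unfolding body_def by blast
  ultimately show ?thesis by (simp add: body_def)
qed

lemma vol_body_pos:
  assumes "body K"
  shows "vol E K > 0"
proof -
  obtain x r where xr: "x \<in> K" "r > 0" "\<And>u. u \<in> E \<Longrightarrow> norm u \<le> r \<Longrightarrow> x + u \<in> K"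
    using assms by (elim body_ballE) blast
  have "0 < vol E (cball 0 r)"
    using emeasure_cball_pos[OF xr(2)] by (simp add: emeasure_eq_vol)
  also have "\<dots> = vol E (E \<inter> cball 0 r)" by (simp add: vol_E_Int)
  also have "\<dots> = vol E ((+) x ` (E \<inter> cball 0 r))"
    using xr(1) bodyD[OF assms] by (intro vol_translate[symmetric]) (auto intro: bounded_subset[OF bounded_cball])
  also have "\<dots> \<le> vol E K" using xr bodyD[OF assms] by (intro vol_mono) auto
  finally show ?thesis .
qed

text \<open>If x + r B lies in K, then t B lies in (t / r) (K - x), so K + t B lies in x + (1 + t /
  r) (K - x) by convexity.\<close>

lemma vol_parallel_body_bound:
  assumes K: "body K" and r: "r > 0" and x: "x \<in> K" "\<And>u. u \<in> E \<Longrightarrow> norm u \<le> r \<Longrightarrow> x + u \<in> K" and t: "t \<ge> 0"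
  shows "vol E (parallel_body E K t) \<le> (1 + t / r) ^ dim E * vol E K"
proof -
  note k = bodyD[OF K]
  let ?c = "1 + t / r" and ?L = "(+) (- x) ` K"
  have c: "?c > 0" using t r by (simp add: add_pos_nonneg)
  have xE: "x \<in> E" "- x \<in> E" using x k subspace_neg[OF subspace] by auto
  have "parallel_body E K t \<subseteq> (+) x ` (*\<^sub>R) ?c ` ?L"
  proof
    fix z assume "z \<in> parallel_body E K t"
    then obtain y u where z: "z = y + t *\<^sub>R u" "y \<in> K" "u \<in> E" "norm u \<le> 1"
      unfolding parallel_body_def by blast
    have "x + r *\<^sub>R u \<in> K" using z r by (intro x(2) subspace_scale subspace) auto
    then have "(r / (r + t)) *\<^sub>R y + (t / (r + t)) *\<^sub>R (x + r *\<^sub>R u) \<in> K"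
      using z r t by (intro convexD[OF k(3)]) (auto simp flip: add_divide_distrib)
    moreover have "z = x + ?c *\<^sub>R (- x + ((r / (r + t)) *\<^sub>R y + (t / (r + t)) *\<^sub>R (x + r *\<^sub>R u)))"
    proof -
      have "?c * (r / (r + t)) = 1" "?c * (t / (r + t)) = t / r" using r t by (auto simp: field_simps add_pos_nonneg add_nonneg_eq_0_iff)
      then have "?c *\<^sub>R ((r / (r + t)) *\<^sub>R y + (t / (r + t)) *\<^sub>R (x + r *\<^sub>R u)) = y + (t / r) *\<^sub>R (x + r *\<^sub>R u)"
        by (simp only: scaleR_add_right[of ?c] scaleR_scaleR scaleR_one)
      also have "\<dots> = y + (t / r) *\<^sub>R x + t *\<^sub>R u" using r by (simp add: scaleR_add_right)
      finally show ?thesis unfolding scaleR_add_right[of ?c "- x"] using z by (simp add: scaleR_add_left)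
    qed
    ultimately show "z \<in> (+) x ` (*\<^sub>R) ?c ` ?L" by blast
  qed
  moreover have cL: "compact ?L" "compact ((*\<^sub>R) ?c ` ?L)" "compact ((+) x ` (*\<^sub>R) ?c ` ?L)"
    by (intro compact_translation compact_scaling k)+
  ultimately have "vol E (parallel_body E K t) \<le> vol E ((+) x ` (*\<^sub>R) ?c ` ?L)"
    by (intro vol_mono) (auto simp: compact_imp_bounded compact_imp_closed)
  also have "\<dots> = vol E ((*\<^sub>R) ?c ` ?L)"
    using cL by (intro vol_translate xE) (auto simp: compact_imp_bounded compact_imp_closed)
  also have "\<dots> = ?c ^ dim E * vol E ?L"
    using cL by (intro vol_scale c) (auto simp: compact_imp_bounded compact_imp_closed)
  also have "vol E ?L = vol E K"
    by (intro vol_translate xE k)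
  finally show ?thesis .
qed

lemma parallel_volume_log_concave:
  assumes K: "body K" and st: "0 \<le> s" "0 \<le> t" and l: "0 < l" "l < 1"
  shows "vol E (parallel_body E K s) powr (1 - l) * vol E (parallel_body E K t) powr l
    \<le> vol E (parallel_body E K ((1 - l) * s + l * t))"
proof -
  have "(1 - l) * s + l * t \<ge> 0" using st l by simp
  then show ?thesis
    using st l bodyD[OF body_parallel_body[OF K]]
    by (intro brunn_minkowski parallel_body_combine bodyD(3)[OF K]) auto
qed

text \<open>\<open>surface_area\<close> is given by \<open>Lim\<close>, which carries information
  only once the limit exists; log-concavity of t -> |K + t B| provides it. The growth bound (1 + t /
  r)^n <= exp (n t / r) becomes S(K) <= n |K| / r, the form in which a large inner ball is used
  later.\<close>

lemma surface_area_body: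
  assumes K: "body K" and r: "r > 0" and x: "x \<in> K" "\<And>u. u \<in> E \<Longrightarrow> norm u \<le> r \<Longrightarrow> x + u \<in> K"
  shows surface_area_limit: "((\<lambda>h. (vol E (parallel_body E K h) - vol E K) / h) \<longlongrightarrow> surface_area E K) (at_right 0)"
    and surface_area_nonneg: "0 \<le> surface_area E K"
    and surface_area_le_inball: "surface_area E K \<le> dim E / r * vol E K"
    and surface_area_ge: "\<And>h. h > 0 \<Longrightarrow> vol E K * ((ln (vol E (parallel_body E K h)) - ln (vol E K)) / h) \<le> surface_area E K"
proof -
  let ?f = "\<lambda>t. vol E (parallel_body E K t)"
  have "\<exists>c. ((\<lambda>h. (?f h - ?f 0) / h) \<longlongrightarrow> c) (at_right 0) \<and> 0 \<le> c \<and> c \<le> dim E / r * ?f 0 \<and>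
    (\<forall>h>0. ?f 0 * ((ln (?f h) - ln (?f 0)) / h) \<le> c)"
  proof (rule log_concave_right_derivative[of ?f "dim E / r"])
    fix t :: real assume t: "t \<ge> 0"
    show "?f t > 0" by (intro vol_body_pos body_parallel_body K t)
    show "?f 0 \<le> ?f t"
      using bodyD[OF body_parallel_body[OF K t]] t by (intro vol_mono parallel_body_mono) auto
    have "?f t \<le> (1 + t / r) ^ dim E * vol E K" by (rule vol_parallel_body_bound[OF K r x t])
    also have "\<dots> \<le> exp (t / r) ^ dim E * vol E K"
      using t r by (intro mult_right_mono power_mono exp_ge_add_one_self) auto
    also have "exp (t / r) ^ dim E = exp (dim E / r * t)" by (simp flip: exp_of_nat_mult)
    finally show "?f t \<le> ?f 0 * exp (dim E / r * t)" by (simp add: mult.commute)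
  next
    fix s t l :: real assume "0 \<le> s" "0 \<le> t" "0 < l" "l < 1"
    then show "?f s powr (1 - l) * ?f t powr l \<le> ?f ((1 - l) * s + l * t)"
      by (rule parallel_volume_log_concave[OF K])
  qed blast
  then obtain c where c: "((\<lambda>h. (?f h - vol E K) / h) \<longlongrightarrow> c) (at_right 0)" "0 \<le> c" "c \<le> dim E / r * vol E K"
    "\<And>h. h > 0 \<Longrightarrow> vol E K * ((ln (?f h) - ln (vol E K)) / h) \<le> c" by auto
  have "surface_area E K = c"
    unfolding surface_area_parallel_body by (rule tendsto_Lim[OF _ c(1)]) simp
  with c show "((\<lambda>h. (?f h - vol E K) / h) \<longlongrightarrow> surface_area E K) (at_right 0)" "0 \<le> surface_area E K"
    "surface_area E K \<le> dim E / r * vol E K"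
    "\<And>h. h > 0 \<Longrightarrow> vol E K * ((ln (?f h) - ln (vol E K)) / h) \<le> surface_area E K" by auto
qed

lemma parallel_volume_mult:
  assumes K: "body K" and ah: "a \<ge> 0" "h > 0"
  shows "vol E (parallel_body E K (a + h)) * vol E K \<le> vol E (parallel_body E K a) * vol E (parallel_body E K h)"
  using log_concave_mult[of "\<lambda>t. vol E (parallel_body E K t)" a h, OF vol_body_pos[OF body_parallel_body[OF K]]
      parallel_volume_log_concave[OF K] ah] by simp

text \<open>From f(a + h) f(0) <= f(a) f(h), the difference quotient of f at a is at most f(a) /
  f(0) times the one at 0.\<close>

lemma surface_area_parallel_body_le:
  assumes K: "body K" and a: "a \<ge> 0"
  shows "surface_area E (parallel_body E K a) \<le> vol E (parallel_body E K a) / vol E K * surface_area E K"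
proof -
  let ?f = "\<lambda>t. vol E (parallel_body E K t)"
  have lim: "((\<lambda>h. (vol E (parallel_body E L h) - vol E L) / h) \<longlongrightarrow> surface_area E L) (at_right 0)" if "body L" for L
    using that surface_area_limit[OF that] by (auto elim!: body_ballE)
  have f0: "vol E K > 0" by (rule vol_body_pos[OF K])
  show ?thesis
  proof (rule tendsto_le)
    show "((\<lambda>h. (vol E (parallel_body E (parallel_body E K a) h) - ?f a) / h) \<longlongrightarrow> surface_area E (parallel_body E K a)) (at_right 0)"
      by (intro lim body_parallel_body K a)
    show "((\<lambda>h. ?f a / vol E K * ((?f h - vol E K) / h)) \<longlongrightarrow> ?f a / vol E K * surface_area E K) (at_right 0)"
      by (intro tendsto_mult_left lim K)
    have "(vol E (parallel_body E (parallel_body E K a) h) - ?f a) / h \<le> ?f a / vol E K * ((?f h - vol E K) / h)"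
      if h: "h > 0" for h
    proof -
      have "(?f (a + h) - ?f a) * vol E K \<le> ?f a * (?f h - vol E K)"
        using parallel_volume_mult[OF K a h] by (simp add: algebra_simps)
      then have "?f (a + h) - ?f a \<le> ?f a / vol E K * (?f h - vol E K)"
        using f0 by (simp add: field_simps)
      then have "(?f (a + h) - ?f a) / h \<le> ?f a / vol E K * (?f h - vol E K) / h"
        using h by (intro divide_right_mono) auto
      then show ?thesis using h a by (simp add: parallel_body_add)
    qed
    then show "\<forall>\<^sub>F h in at_right 0. (vol E (parallel_body E (parallel_body E K a) h) - ?f a) / h \<le> ?f a / vol E K * ((?f h - vol E K) / h)"
      by (auto simp: eventually_at_right_field intro!: exI[of _ 1])
  qed simp
qed

end

section \<open>The sphere and hyperplane projections\<close>

definition segment_sum :: "'a::real_inner set \<Rightarrow> real \<Rightarrow> 'a \<Rightarrow> 'a set"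
  where "segment_sum K s \<xi> = {x + a *\<^sub>R \<xi> | x a. x \<in> K \<and> 0 \<le> a \<and> a \<le> s}"

text \<open>At \<open>w = 0\<close> the formula gives the identity, so it also covers the exchange
  of two equal vectors.\<close>

definition reflection :: "'a::real_inner \<Rightarrow> 'a \<Rightarrow> 'a"
  where "reflection w x = x - (2 * inner x w / inner w w) *\<^sub>R w"

lemma linear_reflection: "linear (reflection w)"
  by (rule linearI) (simp_all add: reflection_def inner_add_left algebra_simps add_divide_distrib scaleR_add_left)

lemma inner_reflection: "inner (reflection w x) (reflection w y) = inner x y"
  by (cases "w = 0") (simp_all add: reflection_def inner_diff_left inner_diff_right inner_commute)

lemma reflection_reflection: "reflection w (reflection w x) = x"
  by (cases "w = 0") (simp_all add: reflection_def inner_diff_left algebra_simps flip: scaleR_add_left)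

lemma norm_reflection: "norm (reflection w x) = norm x"
  by (simp add: norm_eq_sqrt_inner inner_reflection)

lemma reflection_swap:
  assumes "norm u = norm v"
  shows "reflection (u - v) u = v"
proof (cases "u = v")
  case False
  have "inner u u = inner v v" using assms by (simp add: norm_eq_sqrt_inner)
  then have "2 * inner u (u - v) = inner (u - v) (u - v)"
    by (simp add: inner_diff_left inner_diff_right inner_commute)
  moreover have "inner (u - v) (u - v) \<noteq> 0" using False by simp
  ultimately show ?thesis by (simp add: reflection_def)
qed (simp add: reflection_def)

lemma measurable_reflection [measurable]:
  "reflection w \<in> borel_measurable (borel :: 'a::{real_inner, second_countable_topology} measure)"
  unfolding reflection_def by measurable

text \<open>The indicator records that an empty fibre stays empty while every nonempty interval
  grows by exactly s. Integrated over the fibres it becomes the volume of the projection.\<close>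

lemma emeasure_segment_sum_line:
  fixes T :: "real set"
  assumes T: "compact T" "convex T" and s: "s \<ge> 0"
  shows "emeasure lborel {t + a | t a. t \<in> T \<and> 0 \<le> a \<and> a \<le> s} = emeasure lborel T + ennreal s * indicator {T. T \<noteq> {}} T"
proof -
  obtain a b where ab: "T = {a..b}"
    using T convex_connected connected_compact_interval_1 by metis
  show ?thesis
  proof (cases "a \<le> b")
    case True
    have "{t + r | t r. t \<in> {a..b} \<and> 0 \<le> r \<and> r \<le> s} = {a..b + s}"
    proof (intro equalityI subsetI)
      fix z assume z: "z \<in> {a..b + s}"
      have "z = min z b + (z - min z b)" "min z b \<in> {a..b}" "0 \<le> z - min z b" "z - min z b \<le> s"
        using z s True by (auto simp: min_def)
      then show "z \<in> {t + r | t r. t \<in> {a..b} \<and> 0 \<le> r \<and> r \<le> s}" by blast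
    qed auto
    then show ?thesis using True s by (simp add: ab flip: ennreal_plus)
  next
    case False
    then have "T = {}" by (simp add: ab)
    then show ?thesis by simp
  qed
qed

context fd_subspace
begin

lemma nearest_point:
  assumes K: "body K"
  obtains p where "p \<in> K" "norm (x - p) = infdist x K" "\<And>z. z \<in> K \<Longrightarrow> inner (x - p) (z - p) \<le> 0"
proof -
  have "K \<noteq> {}" using K by (auto simp: body_def)
  then obtain p where p: "p \<in> K" "\<forall>z\<in>K. dist x p \<le> dist x z"
    using continuous_attains_inf[OF bodyD(2)[OF K], of "dist x"] continuous_on_dist[OF continuous_on_const continuous_on_id]
    by blast
  show thesis
  proof (rule that[OF p(1)])
    show "inner (x - p) (z - p) \<le> 0" if "z \<in> K" for z
      by (rule any_closest_point_dot[OF bodyD(3,6)[OF K] p(1) that p(2)])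
    have "infdist x K = dist x p"
      using p \<open>K \<noteq> {}\<close> by (intro antisym infdist_le) (auto simp: infdist_def intro: cINF_greatest)
    then show "norm (x - p) = infdist x K" by (simp add: dist_norm)
  qed
qed

text \<open>Through this description shells around a body become sets cut out by the distance, a
  continuous function.\<close>

lemma mem_parallel_body_iff:
  assumes K: "body K" and t: "t \<ge> 0"
  shows "x \<in> parallel_body E K t \<longleftrightarrow> x \<in> E \<and> infdist x K \<le> t"
proof
  assume "x \<in> parallel_body E K t"
  then obtain y u where x: "x = y + t *\<^sub>R u" "y \<in> K" "u \<in> E" "norm u \<le> 1"
    unfolding parallel_body_def by blast
  have "infdist x K \<le> dist x y" using x by (intro infdist_le)
  also have "\<dots> \<le> t" using x t by (simp add: dist_norm mult_left_le)
  finally show "x \<in> E \<and> infdist x K \<le> t" using bodyD(1)[OF body_parallel_body[OF K t]] \<open>x \<in> parallel_body E K t\<close> by blast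
next
  assume x: "x \<in> E \<and> infdist x K \<le> t"
  obtain p where p: "p \<in> K" "norm (x - p) = infdist x K" using nearest_point[OF K, of x] by metis
  show "x \<in> parallel_body E K t"
  proof (cases "t = 0")
    case True
    then have "x = p" using x p infdist_nonneg[of x K] by simp
    then show ?thesis using p True by simp
  next
    case False
    have "x = p + t *\<^sub>R ((1 / t) *\<^sub>R (x - p))" using False by simp
    moreover have "(1 / t) *\<^sub>R (x - p) \<in> E" using x p bodyD(1)[OF K] by (intro subspace_scale subspace_diff subspace) auto
    moreover have "norm ((1 / t) *\<^sub>R (x - p)) \<le> 1" using x p False t by simp
    ultimately show ?thesis unfolding parallel_body_def using p by blast
  qed
qed

text \<open>Projection commutes with passing to parallel bodies, so the derivative at 0 of h -> |P(K
  + h B)| is the surface area of the projection of K.\<close>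

lemma perp_proj_parallel_body:
  assumes \<theta>: "\<theta> \<in> E" "norm \<theta> = 1"
  shows "perp_proj \<theta> ` parallel_body E K t = parallel_body (perp E \<theta>) (perp_proj \<theta> ` K) t"
proof (intro equalityI subsetI)
  have lin: "perp_proj \<theta> (x + t *\<^sub>R u) = perp_proj \<theta> x + t *\<^sub>R perp_proj \<theta> u" for x u
    by (simp add: linear_add[OF linear_perp_proj] linear_scale[OF linear_perp_proj])
  fix z assume "z \<in> perp_proj \<theta> ` parallel_body E K t"
  then obtain x u where z: "z = perp_proj \<theta> x + t *\<^sub>R perp_proj \<theta> u" "x \<in> K" "u \<in> E" "norm u \<le> 1"
    unfolding parallel_body_def using lin by auto
  have "(norm (perp_proj \<theta> u))\<^sup>2 \<le> (norm u)\<^sup>2"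
    unfolding perp_proj_unit[OF \<theta>(2)]
    by (simp add: power2_norm_eq_inner inner_diff_left inner_diff_right inner_commute[of \<theta> u] inner_\<theta>[OF \<theta>])
  then have "norm (perp_proj \<theta> u) \<le> 1" using z(4) power2_le_imp_le[of "norm (perp_proj \<theta> u)" "norm u"] by simp
  then show "z \<in> parallel_body (perp E \<theta>) (perp_proj \<theta> ` K) t"
    unfolding parallel_body_def using z perp_proj_mem[OF \<theta> z(3)] by blast
next
  fix z assume "z \<in> parallel_body (perp E \<theta>) (perp_proj \<theta> ` K) t"
  then obtain x u where z: "z = perp_proj \<theta> x + t *\<^sub>R u" "x \<in> K" "u \<in> perp E \<theta>" "norm u \<le> 1"
    unfolding parallel_body_def by blast
  have "z = perp_proj \<theta> (x + t *\<^sub>R u)"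
    by (simp add: linear_add[OF linear_perp_proj] linear_scale[OF linear_perp_proj] perp_proj_perp[OF \<theta> z(3)] z(1))
  then show "z \<in> perp_proj \<theta> ` parallel_body E K t"
    using z unfolding parallel_body_def mem_perp by blast
qed

lemma body_perp_proj:
  assumes \<theta>: "\<theta> \<in> E" "norm \<theta> = 1" and K: "body K"
  shows "fd_subspace.body (perp E \<theta>) (perp_proj \<theta> ` K)"
    and "\<lbrakk>x \<in> K; \<And>u. u \<in> E \<Longrightarrow> norm u \<le> r \<Longrightarrow> x + u \<in> K; v \<in> perp E \<theta>; norm v \<le> r\<rbrakk> \<Longrightarrow> perp_proj \<theta> x + v \<in> perp_proj \<theta> ` K"
proof -
  interpret P: fd_subspace "perp E \<theta>" by (rule fd_perp[OF \<theta>])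
  have ball: "perp_proj \<theta> x + v \<in> perp_proj \<theta> ` K"
    if "x \<in> K" "\<And>u. u \<in> E \<Longrightarrow> norm u \<le> r \<Longrightarrow> x + u \<in> K" "v \<in> perp E \<theta>" "norm v \<le> r" for x v r
  proof -
    have "perp_proj \<theta> (x + v) = perp_proj \<theta> x + v"
      by (simp add: linear_add[OF linear_perp_proj] perp_proj_perp[OF \<theta> that(3)])
    then show ?thesis using that by (metis image_eqI mem_perp)
  qed
  show "\<lbrakk>x \<in> K; \<And>u. u \<in> E \<Longrightarrow> norm u \<le> r \<Longrightarrow> x + u \<in> K; v \<in> perp E \<theta>; norm v \<le> r\<rbrakk> \<Longrightarrow> perp_proj \<theta> x + v \<in> perp_proj \<theta> ` K"
    by (rule ball)
  obtain x r where xr: "x \<in> K" "r > 0" "\<And>u. u \<in> E \<Longrightarrow> norm u \<le> r \<Longrightarrow> x + u \<in> K"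
    using K by (elim body_ballE) blast
  show "P.body (perp_proj \<theta> ` K)"
    unfolding P.body_def
  proof (intro conjI)
    show "perp_proj \<theta> ` K \<subseteq> perp E \<theta>" using perp_proj_mem[OF \<theta>] bodyD(1)[OF K] by blast
    show "compact (perp_proj \<theta> ` K)"
      by (intro compact_continuous_image continuous_perp_proj bodyD[OF K])
    show "convex (perp_proj \<theta> ` K)" by (intro convex_linear_image linear_perp_proj bodyD[OF K])
    show "\<exists>x\<in>perp_proj \<theta> ` K. \<exists>r>0. \<forall>u\<in>perp E \<theta>. norm u \<le> r \<longrightarrow> x + u \<in> perp_proj \<theta> ` K"
      using xr ball[OF xr(1) xr(3)] by blast
  qed
qed

lemma compact_segment_sum:
  assumes "body K"
  shows "compact (segment_sum K s \<xi>)"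
proof -
  have "segment_sum K s \<xi> = {x + y | x y. x \<in> K \<and> y \<in> (\<lambda>a. a *\<^sub>R \<xi>) ` {0..s}}"
    unfolding segment_sum_def by fastforce
  moreover have "compact ((\<lambda>a. a *\<^sub>R \<xi>) ` {0..s})" by (intro compact_continuous_image continuous_intros) simp
  ultimately show ?thesis using compact_sums[OF bodyD(2)[OF assms]] by simp
qed

text \<open>The fibres over the hyperplane are compact intervals, and the nonempty ones are those
  over the projection; each of these grows by s.\<close>

lemma emeasure_segment_sum:
  assumes \<theta>: "\<theta> \<in> E" "norm \<theta> = 1" and K: "body K" and s: "s \<ge> 0"
  shows "emeasure (lborel_on E) (segment_sum K s \<theta> - K) = ennreal (s * vol (perp E \<theta>) (perp_proj \<theta> ` K))"
proof -
  interpret P: fd_subspace "perp E \<theta>" by (rule fd_perp[OF \<theta>])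
  note k = bodyD[OF K] and pk = P.bodyD[OF body_perp_proj(1)[OF \<theta> K]]
  have S: "segment_sum K s \<theta> \<in> sets borel" "bounded (segment_sum K s \<theta>)"
    using compact_segment_sum[OF K] by (auto simp: compact_imp_closed compact_imp_bounded)
  have KS: "K \<subseteq> segment_sum K s \<theta>" unfolding segment_sum_def using s by force
  have fiber: "emeasure lborel {t. y + t *\<^sub>R \<theta> \<in> segment_sum K s \<theta>}
    = emeasure lborel {t. y + t *\<^sub>R \<theta> \<in> K} + ennreal s * indicator (perp_proj \<theta> ` K) y" if y: "y \<in> perp E \<theta>" for y
  proof -
    let ?T = "{t. y + t *\<^sub>R \<theta> \<in> K}"
    have "closed ?T"
      using continuous_closed_vimage[OF k(6), of "\<lambda>t. y + t *\<^sub>R \<theta>"] by (simp add: vimage_def)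
    moreover have "bounded ?T"
    proof -
      obtain R where R: "\<And>x. x \<in> K \<Longrightarrow> norm x \<le> R" using k(5) by (auto simp: bounded_iff)
      have "\<bar>t\<bar> \<le> R + norm y" if "t \<in> ?T" for t
        using R[of "y + t *\<^sub>R \<theta>"] that norm_triangle_ineq4[of "y + t *\<^sub>R \<theta>" y] \<theta>(2) by simp
      then show ?thesis by (auto simp: bounded_iff)
    qed
    ultimately have "compact ?T" by (simp add: compact_eq_bounded_closed)
    moreover have "convex ?T"
    proof (rule convexI)
      fix a b u v :: real assume "a \<in> ?T" "b \<in> ?T" and uv: "0 \<le> u" "0 \<le> v" "u + v = 1"
      then have "u *\<^sub>R (y + a *\<^sub>R \<theta>) + v *\<^sub>R (y + b *\<^sub>R \<theta>) \<in> K" by (intro convexD[OF k(3)]) auto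
      moreover have "u *\<^sub>R (y + a *\<^sub>R \<theta>) + v *\<^sub>R (y + b *\<^sub>R \<theta>) = (u + v) *\<^sub>R y + (u * a + v * b) *\<^sub>R \<theta>"
        by (simp add: algebra_simps)
      ultimately show "u *\<^sub>R a + v *\<^sub>R b \<in> ?T" using uv by simp
    qed
    moreover have "{t. y + t *\<^sub>R \<theta> \<in> segment_sum K s \<theta>} = {t + a | t a. t \<in> ?T \<and> 0 \<le> a \<and> a \<le> s}"
    proof (intro equalityI subsetI)
      fix r assume "r \<in> {t. y + t *\<^sub>R \<theta> \<in> segment_sum K s \<theta>}"
      then obtain x a where xa: "y + r *\<^sub>R \<theta> = x + a *\<^sub>R \<theta>" "x \<in> K" "0 \<le> a" "a \<le> s"
        unfolding segment_sum_def by blast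
      have "x = (y + r *\<^sub>R \<theta>) - a *\<^sub>R \<theta>" using xa(1) by simp
      then have "x = y + (r - a) *\<^sub>R \<theta>" by (simp add: scaleR_diff_left)
      then have "r - a \<in> ?T" using xa(2) by simp
      moreover have "r = (r - a) + a" by simp
      ultimately show "r \<in> {t + a | t a. t \<in> ?T \<and> 0 \<le> a \<and> a \<le> s}" using xa(3,4) by blast
    next
      fix r assume "r \<in> {t + a | t a. t \<in> ?T \<and> 0 \<le> a \<and> a \<le> s}"
      then obtain t a where ta: "r = t + a" "y + t *\<^sub>R \<theta> \<in> K" "0 \<le> a" "a \<le> s" by blast
      have "y + r *\<^sub>R \<theta> = (y + t *\<^sub>R \<theta>) + a *\<^sub>R \<theta>" by (simp add: ta(1) scaleR_add_left)
      then show "r \<in> {t. y + t *\<^sub>R \<theta> \<in> segment_sum K s \<theta>}"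
        unfolding segment_sum_def using ta by blast
    qed
    moreover have "?T \<noteq> {} \<longleftrightarrow> y \<in> perp_proj \<theta> ` K"
    proof
      assume "?T \<noteq> {}"
      then obtain t where t: "y + t *\<^sub>R \<theta> \<in> K" by blast
      have "perp_proj \<theta> (y + t *\<^sub>R \<theta>) = y"
        using y by (simp add: perp_proj_unit[OF \<theta>(2)] inner_add_left mem_perp inner_\<theta>[OF \<theta>])
      then show "y \<in> perp_proj \<theta> ` K" using t by (metis image_eqI)
    next
      assume "y \<in> perp_proj \<theta> ` K"
      then obtain x where x: "x \<in> K" "y = x - inner x \<theta> *\<^sub>R \<theta>" by (auto simp: perp_proj_unit[OF \<theta>(2)])
      then have "inner x \<theta> \<in> ?T" by simp
      then show "?T \<noteq> {}" by blast
    qed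
    ultimately show ?thesis
      using emeasure_segment_sum_line[of ?T s] s by (auto simp: indicator_def)
  qed
  have "emeasure (lborel_on E) (segment_sum K s \<theta>) =
    (\<integral>\<^sup>+y. emeasure lborel {t. y + t *\<^sub>R \<theta> \<in> K} + ennreal s * indicator (perp_proj \<theta> ` K) y \<partial>lborel_on (perp E \<theta>))"
    unfolding emeasure_split[OF \<theta> S(1)]
  proof (rule nn_integral_cong_AE)
    show "AE y in lborel_on (perp E \<theta>). emeasure lborel {t. y + t *\<^sub>R \<theta> \<in> segment_sum K s \<theta>} =
      emeasure lborel {t. y + t *\<^sub>R \<theta> \<in> K} + ennreal s * indicator (perp_proj \<theta> ` K) y"
      using P.AE_E by eventually_elim (rule fiber)
  qed
  also have "\<dots> = emeasure (lborel_on E) K + ennreal s * emeasure (lborel_on (perp E \<theta>)) (perp_proj \<theta> ` K)"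
  proof -
    note [measurable] = k(4) pk(4)
    have "(\<integral>\<^sup>+y. emeasure lborel {t. y + t *\<^sub>R \<theta> \<in> K} + ennreal s * indicator (perp_proj \<theta> ` K) y \<partial>lborel_on (perp E \<theta>))
      = (\<integral>\<^sup>+y. emeasure lborel {t. y + t *\<^sub>R \<theta> \<in> K} \<partial>lborel_on (perp E \<theta>)) +
        (\<integral>\<^sup>+y. ennreal s * indicator (perp_proj \<theta> ` K) y \<partial>lborel_on (perp E \<theta>))"
      by (rule nn_integral_add) measurable
    then show ?thesis
      using pk(4) by (simp add: emeasure_split[OF \<theta> k(4)] nn_integral_cmult_indicator)
  qed
  also have "\<dots> = ennreal (vol E K) + ennreal (s * vol (perp E \<theta>) (perp_proj \<theta> ` K))"
    using s k pk by (simp add: emeasure_eq_vol P.emeasure_eq_vol ennreal_mult)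
  finally have "emeasure (lborel_on E) (segment_sum K s \<theta>) - emeasure (lborel_on E) K
    = ennreal (s * vol (perp E \<theta>) (perp_proj \<theta> ` K))"
    using k by (simp add: emeasure_eq_vol)
  then show ?thesis
    using emeasure_bounded[OF k(5)] k(4) S KS by (subst emeasure_Diff) auto
qed

section \<open>The rotation invariant measure on the sphere\<close>

abbreviation unit_sphere :: "'a measure"
  where "unit_sphere \<equiv> sphere_measure E"

lemma sets_sphere [simp, measurable_cong]: "sets unit_sphere = sets borel"
  by (simp add: sphere_measure_def)

lemma space_sphere [simp]: "space unit_sphere = UNIV"
  by (simp add: sphere_measure_def)

lemma prob_space_sphere: "prob_space unit_sphere"
  unfolding sphere_measure_def
proof (rule prob_space.prob_space_distr)
  show "prob_space (uniform_measure (lborel_on E) (cball 0 1))"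
    using emeasure_cball_pos[of 1] emeasure_cball_finite[of 1] by (intro prob_space_uniform_measure) auto
qed simp

lemma AE_sphere:
  assumes n: "dim E \<ge> 1"
  shows "AE \<xi> in unit_sphere. \<xi> \<in> E \<and> norm \<xi> = 1"
proof -
  \<comment> \<open>Doubling fixes the origin but multiplies its measure by 2^n, so the origin has
    measure 0 as n >= 1. It has to be excluded because \<open>sgn 0 = 0\<close>.\<close>
  have "ennreal (2 ^ dim E) * emeasure (lborel_on E) {0} = emeasure (lborel_on E) {0}"
    using emeasure_scale[of 2 "{0}"] by simp
  then have "2 ^ dim E * vol E {0} = vol E {0}" by (simp add: emeasure_eq_vol flip: ennreal_mult)
  moreover have "(1::real) < 2 ^ dim E" using n by (intro one_less_power) auto
  ultimately have "vol E {0} = 0" by simp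
  then have "AE x in lborel_on E. x \<noteq> 0"
    by (intro AE_I[of _ _ "{0}"]) (auto simp: emeasure_eq_vol)
  then have ae: "AE x in lborel_on E. sgn x \<in> E \<and> norm (sgn x) = 1"
    using AE_E by eventually_elim (auto simp: sgn_div_norm norm_sgn intro!: subspace_scale subspace)
  have "AE x in uniform_measure (lborel_on E) (cball 0 1). sgn x \<in> E \<and> norm (sgn x) = 1"
    using ae by (intro AE_uniform_measureI) auto
  then show ?thesis
    unfolding sphere_measure_def by (subst AE_distr_iff) auto
qed

text \<open>Reflections preserve Lebesgue measure and the unit ball, and commute with
  normalisation.\<close>

lemma sphere_reflection:
  assumes w: "w \<in> E"
  shows "distr unit_sphere borel (reflection w) = unit_sphere"
proof -
  let ?U = "uniform_measure (lborel_on E) (cball 0 1)"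
  have R: "distr (lborel_on E) borel (reflection w) = lborel_on E"
  proof (rule lborel_on_isometry[OF linear_reflection measurable_reflection])
    have mem: "reflection w x \<in> E" if "x \<in> E" for x
      unfolding reflection_def using that w by (intro subspace_diff subspace_scale subspace)
    show "reflection w ` E = E"
      using mem reflection_reflection by (metis image_eqI image_subsetI subsetI subset_antisym)
  qed (rule inner_reflection)
  have U: "distr ?U borel (reflection w) = ?U"
  proof (rule measure_eqI)
    fix A assume "A \<in> sets (distr ?U borel (reflection w))"
    then have A[measurable]: "A \<in> sets borel" by simp
    have pre: "reflection w -` A \<in> sets borel"
      using measurable_sets[OF measurable_reflection A] by simp
    have "emeasure (distr ?U borel (reflection w)) A = emeasure ?U (reflection w -` A)"
      by (subst emeasure_distr) auto
    also have "\<dots> = emeasure (lborel_on E) (cball 0 1 \<inter> reflection w -` A) / emeasure (lborel_on E) (cball 0 1)"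
      using pre by (intro emeasure_uniform_measure) auto
    also have "cball 0 1 \<inter> reflection w -` A = reflection w -` (cball 0 1 \<inter> A)"
      by (auto simp: norm_reflection)
    also have "emeasure (lborel_on E) (reflection w -` (cball 0 1 \<inter> A)) = emeasure (distr (lborel_on E) borel (reflection w)) (cball 0 1 \<inter> A)"
      by (subst emeasure_distr) auto
    also have "\<dots> = emeasure (lborel_on E) (cball 0 1 \<inter> A)" by (simp only: R)
    also have "\<dots> / emeasure (lborel_on E) (cball 0 1) = emeasure ?U A"
      by (intro emeasure_uniform_measure[symmetric]) auto
    finally show "emeasure (distr ?U borel (reflection w)) A = emeasure ?U A" .
  qed simp
  have "distr unit_sphere borel (reflection w) = distr ?U borel (reflection w \<circ> sgn)"
    unfolding sphere_measure_def by (subst distr_distr) auto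
  also have "reflection w \<circ> sgn = sgn \<circ> reflection w"
    by (auto simp: sgn_div_norm norm_reflection linear_scale[OF linear_reflection])
  also have "distr ?U borel (sgn \<circ> reflection w) = distr (distr ?U borel (reflection w)) borel sgn"
    by (subst distr_distr) auto
  finally show ?thesis by (simp add: U sphere_measure_def)
qed

text \<open>The reflection in the hyperplane orthogonal to u - v exchanges u and v; reflections
  already act transitively on unit vectors.\<close>

lemma sphere_rotation:
  fixes g :: "real \<Rightarrow> ennreal"
  assumes uv: "u \<in> E" "norm u = 1" "v \<in> E" "norm v = 1" and g[measurable]: "g \<in> borel_measurable borel"
  shows "(\<integral>\<^sup>+\<xi>. g (inner \<xi> u) \<partial>unit_sphere) = (\<integral>\<^sup>+\<xi>. g (inner \<xi> v) \<partial>unit_sphere)"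
proof -
  have "(\<integral>\<^sup>+\<xi>. g (inner \<xi> v) \<partial>unit_sphere) = (\<integral>\<^sup>+\<xi>. g (inner \<xi> v) \<partial>distr unit_sphere borel (reflection (u - v)))"
    using uv by (subst sphere_reflection) (auto intro!: subspace_diff subspace)
  also have "\<dots> = (\<integral>\<^sup>+\<xi>. g (inner (reflection (u - v) \<xi>) v) \<partial>unit_sphere)"
    by (subst nn_integral_distr) auto
  also have "\<dots> = (\<integral>\<^sup>+\<xi>. g (inner \<xi> u) \<partial>unit_sphere)"
  proof (intro nn_integral_cong arg_cong[where f = g])
    fix \<xi>
    have "inner (reflection (u - v) \<xi>) (reflection (u - v) u) = inner \<xi> u" by (rule inner_reflection)
    then show "inner (reflection (u - v) \<xi>) v = inner \<xi> u" using uv by (simp add: reflection_swap)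
  qed
  finally show ?thesis by simp
qed

text \<open>The mean of the support function of the segment from 0 to a unit vector, that is, half
  its mean width. For n >= 1 it is the constant omega_(n-1) / (n omega_n) of Cauchy's formula,
  omega_k being the volume of the unit ball in dimension k.\<close>

definition half_width :: real
  where "half_width = (LINT \<xi>|unit_sphere. max 0 (inner \<xi> (onb E 0)))"

context
  assumes n: "dim E \<ge> 1"
begin

lemma e0: "onb E 0 \<in> E" "norm (onb E 0) = 1"
  using n onb_mem[OF is_onb_E, of 0] onb_norm[OF is_onb_E, of 0] by auto

lemma half_width_integrable: "integrable unit_sphere (\<lambda>\<xi>. max 0 (inner \<xi> (onb E 0)))"
proof -
  interpret prob_space unit_sphere by (rule prob_space_sphere)
  show ?thesis
  proof (rule integrable_const_bound[where B = 1])
    show "AE \<xi> in unit_sphere. norm (max 0 (inner \<xi> (onb E 0))) \<le> 1"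
      using AE_sphere[OF n]
    proof eventually_elim
      case (elim \<xi>)
      then show ?case using Cauchy_Schwarz_ineq2[of \<xi> "onb E 0"] e0 by simp
    qed
  qed measurable
qed

lemma half_width_nonneg: "half_width \<ge> 0"
  unfolding half_width_def by (intro Bochner_Integration.integral_nonneg) simp

text \<open>All coordinates have the same second moment and their squares sum to 1, so it is 1 / n.
  Then |t| <= (1 + n t^2) / (2 sqrt n) is integrated; its coefficients are chosen to give equality
  at t = 1 / sqrt n.\<close>

lemma half_width_le: "half_width \<le> 1 / sqrt (dim E)"
proof -
  interpret prob_space unit_sphere by (rule prob_space_sphere)
  let ?n = "real (dim E)" and ?e = "onb E"
  note e = is_onb_E
  have split_ennreal: "ennreal (a + a * (b * c)) = ennreal a + ennreal a * (ennreal b * ennreal c)"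
    if "a \<ge> 0" "b \<ge> 0" "c \<ge> 0" for a b c
    using that by (simp add: ennreal_mult)
  have np: "?n > 0" using n by simp
  have "(\<Sum>i<dim E. (\<integral>\<^sup>+\<xi>. ennreal ((inner \<xi> (?e i))\<^sup>2) \<partial>unit_sphere)) = (\<integral>\<^sup>+\<xi>. (\<Sum>i<dim E. ennreal ((inner \<xi> (?e i))\<^sup>2)) \<partial>unit_sphere)"
    by (rule nn_integral_sum[symmetric]) measurable
  also have "\<dots> = (\<integral>\<^sup>+\<xi>. 1 \<partial>unit_sphere)"
  proof (rule nn_integral_cong_AE)
    show "AE \<xi> in unit_sphere. (\<Sum>i<dim E. ennreal ((inner \<xi> (?e i))\<^sup>2)) = 1"
      using AE_sphere[OF n] by eventually_elim (simp add: sum_ennreal flip: onb_norm_expand[OF e])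
  qed
  also have "\<dots> = 1" by (simp add: emeasure_space_1[simplified])
  also have "(\<Sum>i<dim E. (\<integral>\<^sup>+\<xi>. ennreal ((inner \<xi> (?e i))\<^sup>2) \<partial>unit_sphere)) = (\<Sum>i<dim E. (\<integral>\<^sup>+\<xi>. ennreal ((inner \<xi> (?e 0))\<^sup>2) \<partial>unit_sphere))"
    using e0 by (intro sum.cong refl sphere_rotation onb_mem[OF e] onb_norm[OF e]) auto
  finally have sum1: "ennreal ?n * (\<integral>\<^sup>+\<xi>. ennreal ((inner \<xi> (?e 0))\<^sup>2) \<partial>unit_sphere) = 1"
    by (simp add: ennreal_of_nat_eq_real_of_nat)
  have "ennreal half_width = (\<integral>\<^sup>+\<xi>. ennreal (max 0 (inner \<xi> (?e 0))) \<partial>unit_sphere)"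
    unfolding half_width_def by (rule nn_integral_eq_integral[symmetric, OF half_width_integrable]) simp
  also have "\<dots> \<le> (\<integral>\<^sup>+\<xi>. ennreal (1 / (2 * sqrt ?n)) + ennreal (1 / (2 * sqrt ?n)) * (ennreal ?n * ennreal ((inner \<xi> (?e 0))\<^sup>2)) \<partial>unit_sphere)"
  proof (rule nn_integral_mono)
    fix \<xi>
    let ?t = "inner \<xi> (?e 0)"
    have "0 \<le> (sqrt ?n * \<bar>?t\<bar> - 1)\<^sup>2" by simp
    also have "(sqrt ?n * \<bar>?t\<bar> - 1)\<^sup>2 = ?n * ?t\<^sup>2 - 2 * (sqrt ?n * \<bar>?t\<bar>) + 1"
      by (simp add: power2_diff power_mult_distrib)
    finally have "2 * (sqrt ?n * \<bar>?t\<bar>) \<le> 1 + ?n * ?t\<^sup>2" by simp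
    then have "\<bar>?t\<bar> \<le> 1 / (2 * sqrt ?n) + 1 / (2 * sqrt ?n) * (?n * ?t\<^sup>2)"
      using np by (simp add: field_simps)
    then have "ennreal (max 0 ?t) \<le> ennreal (1 / (2 * sqrt ?n) + 1 / (2 * sqrt ?n) * (?n * ?t\<^sup>2))"
      by (intro ennreal_leI) linarith
    then show "ennreal (max 0 ?t) \<le> ennreal (1 / (2 * sqrt ?n)) + ennreal (1 / (2 * sqrt ?n)) * (ennreal ?n * ennreal (?t\<^sup>2))"
      by (subst (asm) split_ennreal) auto
  qed
  also have "\<dots> = ennreal (1 / (2 * sqrt ?n)) + ennreal (1 / (2 * sqrt ?n)) * (ennreal ?n * (\<integral>\<^sup>+\<xi>. ennreal ((inner \<xi> (?e 0))\<^sup>2) \<partial>unit_sphere))"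
    by (subst nn_integral_add) (auto simp: nn_integral_cmult emeasure_space_1[simplified])
  also have "\<dots> = ennreal (1 / (2 * sqrt ?n)) + ennreal (1 / (2 * sqrt ?n))"
    unfolding sum1 by simp
  also have "\<dots> = ennreal (1 / sqrt ?n)"
    using np by (simp flip: ennreal_plus)
  finally show ?thesis using np by simp
qed

end

end

section \<open>Cauchy's surface area formula for parallel bodies\<close>

lemma mem_segment_sum: "x \<in> segment_sum K s \<xi> \<longleftrightarrow> (\<exists>a\<in>{0..s}. x - a *\<^sub>R \<xi> \<in> K)"
  unfolding segment_sum_def
proof safe
  fix a assume a: "a \<in> {0..s}" "x - a *\<^sub>R \<xi> \<in> K"
  then show "\<exists>y b. x = y + b *\<^sub>R \<xi> \<and> y \<in> K \<and> 0 \<le> b \<and> b \<le> s"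
    by (intro exI[of _ "x - a *\<^sub>R \<xi>"] exI[of _ a]) auto
qed (auto intro!: bexI)

text \<open>A limit of pairs (x, xi) with x - a xi in K again admits such an a because [0, s] is
  compact. Closedness gives the joint measurability in (x, xi) that Fubini demands.\<close>

lemma closed_segment_graph:
  fixes K :: "'a::real_inner set"
  assumes K: "closed K"
  shows "closed {z. fst z \<in> segment_sum K s (snd z)}"
  unfolding closed_sequential_limits
proof (intro allI impI, elim conjE)
  fix z :: "nat \<Rightarrow> 'a \<times> 'a" and l
  assume z: "\<forall>n. z n \<in> {z. fst z \<in> segment_sum K s (snd z)}" and lim: "z \<longlonglongrightarrow> l"
  then obtain a where a: "\<And>n. a n \<in> {0..s}" "\<And>n. fst (z n) - a n *\<^sub>R snd (z n) \<in> K"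
    unfolding mem_Collect_eq mem_segment_sum by metis
  obtain b r where b: "b \<in> {0..s}" "strict_mono r" "(a \<circ> r) \<longlonglongrightarrow> b"
    using compact_Icc[of 0 s] a(1) unfolding compact_def by metis
  have zr: "(\<lambda>n. z (r n)) \<longlonglongrightarrow> l"
    using LIMSEQ_subseq_LIMSEQ[OF lim b(2)] by (simp add: o_def)
  have "(\<lambda>n. fst (z (r n)) - (a \<circ> r) n *\<^sub>R snd (z (r n))) \<longlonglongrightarrow> fst l - b *\<^sub>R snd l"
    by (intro tendsto_intros zr b)
  moreover have "fst (z (r n)) - (a \<circ> r) n *\<^sub>R snd (z (r n)) \<in> K" for n using a(2) by simp
  from closed_sequentially[OF K this calculation] have "fst l - b *\<^sub>R snd l \<in> K" .
  then show "l \<in> {z. fst z \<in> segment_sum K s (snd z)}"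
    using b(1) by (auto simp: mem_segment_sum)
qed

lemma borel_measurable_infdist [measurable]: "(\<lambda>x. infdist x K) \<in> borel_measurable borel"
  by (intro borel_measurable_continuous_onI continuous_intros)

context fd_subspace
begin

lemma segment_graph_measurable:
  fixes K :: "'a set"
  assumes K: "closed K"
  shows "Measurable.pred (borel \<Otimes>\<^sub>M borel) (\<lambda>z. fst z \<in> segment_sum K s (snd z))"
proof -
  have "{z :: 'a \<times> 'a. fst z \<in> segment_sum K s (snd z)} \<in> sets (borel \<Otimes>\<^sub>M borel)"
    unfolding borel_prod by (rule borel_closed[OF closed_segment_graph[OF K]])
  then show ?thesis by (simp add: pred_def space_pair_measure)
qed

lemma emeasure_segment_layer:
  assumes K: "body K"
  shows "emeasure (lborel_on E) (segment_sum K s \<xi> - K) =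
      (\<integral>\<^sup>+x. (if x \<in> segment_sum K s \<xi> \<and> x \<notin> K then 1 else 0) \<partial>lborel_on E)"
    and "(\<lambda>\<xi>. emeasure (lborel_on E) (segment_sum K s \<xi> - K)) \<in> borel_measurable borel"
proof -
  interpret M: sigma_finite_measure "lborel_on E" by (rule sigma_finite_E)
  note [measurable] = bodyD(4)[OF K]
  have eq: "emeasure (lborel_on E) (segment_sum K s \<xi> - K) =
      (\<integral>\<^sup>+x. (if x \<in> segment_sum K s \<xi> \<and> x \<notin> K then 1 else 0) \<partial>lborel_on E)" for \<xi>
  proof -
    have "emeasure (lborel_on E) (segment_sum K s \<xi> - K) = (\<integral>\<^sup>+x. indicator (segment_sum K s \<xi> - K) x \<partial>lborel_on E)"
      using compact_segment_sum[OF K] by (intro nn_integral_indicator[symmetric]) (auto simp: compact_imp_closed)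
    then show ?thesis by (simp add: indicator_def of_bool_def)
  qed
  then show "emeasure (lborel_on E) (segment_sum K s \<xi> - K) =
      (\<integral>\<^sup>+x. (if x \<in> segment_sum K s \<xi> \<and> x \<notin> K then 1 else 0) \<partial>lborel_on E)" .
  have [measurable]: "Measurable.pred (borel \<Otimes>\<^sub>M borel) (\<lambda>z. snd z \<in> segment_sum K s (fst z))"
    using measurable_compose[OF measurable_pair_swap' segment_graph_measurable[OF bodyD(6)[OF K], of s]]
    by (simp add: case_prod_beta')
  show "(\<lambda>\<xi>. emeasure (lborel_on E) (segment_sum K s \<xi> - K)) \<in> borel_measurable borel"
    unfolding eq
    by (rule M.borel_measurable_nn_integral) (simp add: case_prod_beta')
qed

text \<open>The shell is phrased through the distance with an offset a and a width h of either sign,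
  the shape in which layers arise both for a = 0 and for a > 0. For negative h it is a null set,
  whence \<open>max 0 h\<close>.\<close>

lemma emeasure_shell:
  assumes K: "body K" and a: "a \<ge> 0"
  shows "emeasure (lborel_on E) {x. x \<notin> parallel_body E K a \<and> infdist x K - a \<le> h}
    = ennreal (vol E (parallel_body E K (a + max 0 h)) - vol E (parallel_body E K a))"
proof -
  let ?m = "a + max 0 h"
  have m: "?m \<ge> 0" using a by simp
  note A = bodyD[OF body_parallel_body[OF K a]] and M = bodyD[OF body_parallel_body[OF K m]]
  note [measurable] = A(4) M(4)
  have sub: "parallel_body E K a \<subseteq> parallel_body E K ?m" using a by (intro parallel_body_mono) auto
  have "emeasure (lborel_on E) {x. x \<notin> parallel_body E K a \<and> infdist x K - a \<le> h}
    = emeasure (lborel_on E) (parallel_body E K ?m - parallel_body E K a)"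
  proof (rule emeasure_E_cong)
    have "x \<notin> parallel_body E K a \<and> infdist x K - a \<le> h \<longleftrightarrow> x \<in> parallel_body E K ?m - parallel_body E K a" if "x \<in> E" for x
      using that a m by (auto simp: mem_parallel_body_iff[OF K])
    then show "{x. x \<notin> parallel_body E K a \<and> infdist x K - a \<le> h} \<inter> E = (parallel_body E K ?m - parallel_body E K a) \<inter> E"
      by blast
  qed measurable
  also have "\<dots> = emeasure (lborel_on E) (parallel_body E K ?m) - emeasure (lborel_on E) (parallel_body E K a)"
    using emeasure_bounded[OF A(5)] sub by (intro emeasure_Diff) auto
  finally show ?thesis using A M by (simp add: emeasure_eq_vol ennreal_minus)
qed

text \<open>p x is the nearest point of K and u x the outer normal there that points to x. Both are
  chosen pointwise, and nothing is claimed about measurability.\<close>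

lemma outer_normal:
  assumes K: "body K"
  obtains p u where "\<And>x. p x \<in> K" "\<And>x. x = p x + infdist x K *\<^sub>R u x"
    "\<And>x. x \<in> E \<Longrightarrow> x \<notin> K \<Longrightarrow> u x \<in> E \<and> norm (u x) = 1"
    "\<And>x z. z \<in> K \<Longrightarrow> inner (u x) (z - p x) \<le> 0"
proof -
  have "\<forall>x. \<exists>p. p \<in> K \<and> norm (x - p) = infdist x K \<and> (\<forall>z\<in>K. inner (x - p) (z - p) \<le> 0)"
    using nearest_point[OF K] by metis
  then obtain p where p: "\<And>x. p x \<in> K" "\<And>x. norm (x - p x) = infdist x K"
    "\<And>x z. z \<in> K \<Longrightarrow> inner (x - p x) (z - p x) \<le> 0" by metis
  define u where "u x = (1 / infdist x K) *\<^sub>R (x - p x)" for x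
  show thesis
  proof (rule that[of p u])
    show "p x \<in> K" for x by (rule p)
    show "x = p x + infdist x K *\<^sub>R u x" for x
      using p(2)[of x] by (cases "infdist x K = 0") (auto simp: u_def)
    show "u x \<in> E \<and> norm (u x) = 1" if x: "x \<in> E" "x \<notin> K" for x
    proof
      have "p x \<in> E" using p(1) bodyD(1)[OF K] by blast
      then show "u x \<in> E" unfolding u_def using x by (intro subspace_scale subspace_diff subspace)
      have "x \<noteq> p x" using x p(1)[of x] by metis
      then have "norm (x - p x) \<noteq> 0" by simp
      then show "norm (u x) = 1" using p(2)[of x] infdist_nonneg[of x K] by (simp add: u_def)
    qed
    show "inner (u x) (z - p x) \<le> 0" if "z \<in> K" for x z
      using p(3)[OF that, of x] infdist_nonneg[of x K] by (auto simp: u_def divide_nonpos_nonneg)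
  qed
qed

text \<open>For fixed x the inner integral depends only on the length of u x, so rotation invariance
  replaces u x by the fixed vector e. This has to precede the exchange of integrals, since u may
  fail to be measurable.\<close>

lemma layer_fubini:
  assumes u: "\<And>x. x \<in> E \<Longrightarrow> x \<notin> B \<Longrightarrow> u x \<in> E \<and> norm (u x) = 1" and e: "e \<in> E" "norm e = 1"
    and [measurable]: "B \<in> sets borel" "h \<in> borel_measurable borel" "\<phi> \<in> borel_measurable borel"
  shows "(\<integral>\<^sup>+x. (\<integral>\<^sup>+\<xi>. (if x \<notin> B \<and> h x \<le> \<phi> (inner \<xi> (u x)) then 1 else 0) \<partial>unit_sphere) \<partial>lborel_on E)
    = (\<integral>\<^sup>+\<xi>. emeasure (lborel_on E) {x. x \<notin> B \<and> h x \<le> (\<phi> (inner \<xi> e) :: real)} \<partial>unit_sphere)"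
proof -
  interpret M: sigma_finite_measure "lborel_on E" by (rule sigma_finite_E)
  interpret S: prob_space unit_sphere by (rule prob_space_sphere)
  interpret pair_sigma_finite "lborel_on E" unit_sphere ..
  have "(\<integral>\<^sup>+x. (\<integral>\<^sup>+\<xi>. (if x \<notin> B \<and> h x \<le> \<phi> (inner \<xi> (u x)) then 1 else 0) \<partial>unit_sphere) \<partial>lborel_on E)
    = (\<integral>\<^sup>+x. (\<integral>\<^sup>+\<xi>. (if x \<notin> B \<and> h x \<le> \<phi> (inner \<xi> e) then 1 else 0) \<partial>unit_sphere) \<partial>lborel_on E)"
  proof (rule nn_integral_cong_AE)
    show "AE x in lborel_on E. (\<integral>\<^sup>+\<xi>. (if x \<notin> B \<and> h x \<le> \<phi> (inner \<xi> (u x)) then 1 else 0) \<partial>unit_sphere)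
      = (\<integral>\<^sup>+\<xi>. (if x \<notin> B \<and> h x \<le> \<phi> (inner \<xi> e) then 1 else 0) \<partial>unit_sphere)"
      using AE_E
    proof eventually_elim
      case (elim x)
      show ?case
      proof (cases "x \<in> B")
        case False
        show ?thesis
          using sphere_rotation[of "u x" e "\<lambda>t. if x \<notin> B \<and> h x \<le> \<phi> t then 1 else 0"] u[OF elim False] e by simp
      qed simp
    qed
  qed
  also have "\<dots> = (\<integral>\<^sup>+\<xi>. (\<integral>\<^sup>+x. (if x \<notin> B \<and> h x \<le> \<phi> (inner \<xi> e) then 1 else 0) \<partial>lborel_on E) \<partial>unit_sphere)"
    by (rule Fubini'[symmetric]) measurable
  also have "\<dots> = (\<integral>\<^sup>+\<xi>. emeasure (lborel_on E) {x. x \<notin> B \<and> h x \<le> \<phi> (inner \<xi> e)} \<partial>unit_sphere)"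
  proof (intro nn_integral_cong)
    fix \<xi>
    have "emeasure (lborel_on E) {x. x \<notin> B \<and> h x \<le> \<phi> (inner \<xi> e)}
      = (\<integral>\<^sup>+x. indicator {x. x \<notin> B \<and> h x \<le> \<phi> (inner \<xi> e)} x \<partial>lborel_on E)"
      by (rule nn_integral_indicator[symmetric]) measurable
    then show "(\<integral>\<^sup>+x. (if x \<notin> B \<and> h x \<le> \<phi> (inner \<xi> e) then 1 else 0) \<partial>lborel_on E)
      = emeasure (lborel_on E) {x. x \<notin> B \<and> h x \<le> \<phi> (inner \<xi> e)}"
      by (simp add: indicator_def of_bool_def)
  qed
  finally show ?thesis .
qed

lemma segment_fubini:
  assumes K: "body K"
  shows "(\<integral>\<^sup>+\<xi>. emeasure (lborel_on E) (segment_sum K s \<xi> - K) \<partial>unit_sphere)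
    = (\<integral>\<^sup>+x. (\<integral>\<^sup>+\<xi>. (if x \<in> segment_sum K s \<xi> \<and> x \<notin> K then 1 else 0) \<partial>unit_sphere) \<partial>lborel_on E)"
proof -
  interpret M: sigma_finite_measure "lborel_on E" by (rule sigma_finite_E)
  interpret S: prob_space unit_sphere by (rule prob_space_sphere)
  interpret pair_sigma_finite "lborel_on E" unit_sphere ..
  note [measurable] = bodyD(4)[OF K] segment_graph_measurable[OF bodyD(6)[OF K], of s]
  show ?thesis
    unfolding emeasure_segment_layer(1)[OF K]
    by (rule Fubini') (simp add: case_prod_beta')
qed

text \<open>By \<open>emeasure_segment_sum\<close> the integrand is the volume of the projection for
  every unit vector xi of \<open>E\<close>. The layer form is taken because its measurability in xi
  follows from the closed graph.\<close>

definition projection_average :: "'a set \<Rightarrow> ennreal"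
  where "projection_average K = (\<integral>\<^sup>+\<xi>. emeasure (lborel_on E) (segment_sum K 1 \<xi> - K) \<partial>unit_sphere)"

section \<open>The two halves of Cauchy's formula\<close>

context
  assumes n: "dim E \<ge> 1"
begin

lemma half_width_le_1: "half_width \<le> 1"
proof -
  have "1 / sqrt (real (dim E)) \<le> 1" using n by simp
  then show ?thesis using half_width_le[OF n] by linarith
qed

text \<open>For unit xi the layer has volume s times that of the projection, so its average is
  exactly linear in s and can be computed from arbitrarily thin layers.\<close>

lemma projection_average_scale:
  assumes K: "body K" and s: "s \<ge> 0"
  shows "(\<integral>\<^sup>+\<xi>. emeasure (lborel_on E) (segment_sum K s \<xi> - K) \<partial>unit_sphere) = ennreal s * projection_average K"
proof -
  note [measurable] = emeasure_segment_layer(2)[OF K]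
  have "(\<integral>\<^sup>+\<xi>. emeasure (lborel_on E) (segment_sum K s \<xi> - K) \<partial>unit_sphere)
    = (\<integral>\<^sup>+\<xi>. ennreal s * emeasure (lborel_on E) (segment_sum K 1 \<xi> - K) \<partial>unit_sphere)"
  proof (rule nn_integral_cong_AE)
    show "AE \<xi> in unit_sphere. emeasure (lborel_on E) (segment_sum K s \<xi> - K) = ennreal s * emeasure (lborel_on E) (segment_sum K 1 \<xi> - K)"
      using AE_sphere[OF n]
      by eventually_elim (use s in \<open>simp add: emeasure_segment_sum[OF _ _ K] fd_subspace.vol_nonneg[OF fd_perp] ennreal_mult\<close>)
  qed
  then show ?thesis unfolding projection_average_def by (simp add: nn_integral_cmult)
qed

text \<open>A point x outside K in K + s[0,xi] satisfies dist(x, K) <= s max(0, <xi, u x>) without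
  error term, so this half holds for every body. After rotation the layers are shells, whose volume
  is S(K) times their width to first order.\<close>

lemma projection_average_le:
  assumes K: "body K"
  shows "projection_average K \<le> ennreal (half_width * surface_area E K)"
proof -
  let ?e = "onb E 0" and ?f = "\<lambda>t. vol E (parallel_body E K t)" and ?c = "surface_area E K"
  note [measurable] = bodyD(4)[OF K]
  obtain x0 r where xr: "r > 0" "x0 \<in> K" "\<And>u. u \<in> E \<Longrightarrow> norm u \<le> r \<Longrightarrow> x0 + u \<in> K"
    using K by (elim body_ballE) blast
  note S = surface_area_body[OF K xr]
  obtain p u where pu: "\<And>x. p x \<in> K" "\<And>x. x = p x + infdist x K *\<^sub>R u x"
    "\<And>x. x \<in> E \<Longrightarrow> x \<notin> K \<Longrightarrow> u x \<in> E \<and> norm (u x) = 1"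
    "\<And>x z. z \<in> K \<Longrightarrow> inner (u x) (z - p x) \<le> 0"
    using outer_normal[OF K] by blast
  have le: "ennreal s * projection_average K \<le> (\<integral>\<^sup>+\<xi>. ennreal (?f (s * max 0 (inner \<xi> ?e)) - vol E K) \<partial>unit_sphere)"
    if s: "s > 0" for s
  proof -
    have touch: "infdist x K - 0 \<le> s * max 0 (inner \<xi> (u x))" if x: "x \<in> E" "x \<notin> K" "x \<in> segment_sum K s \<xi>" for x \<xi>
    proof -
      obtain k a where ka: "x = k + a *\<^sub>R \<xi>" "k \<in> K" "0 \<le> a" "a \<le> s" using x(3) unfolding segment_sum_def by blast
      have uu: "inner (u x) (u x) = 1" using pu(3)[OF x(1,2)] by (simp add: norm_eq_sqrt_inner)
      have "infdist x K = inner (u x) (infdist x K *\<^sub>R u x)" by (simp add: uu)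
      also have "infdist x K *\<^sub>R u x = (k - p x) + a *\<^sub>R \<xi>" using pu(2)[of x] ka(1) by (simp add: algebra_simps)
      also have "inner (u x) \<dots> \<le> a * inner \<xi> (u x)"
        using pu(4)[OF ka(2), of x] by (simp add: inner_add_right inner_commute)
      also have "\<dots> \<le> a * max 0 (inner \<xi> (u x))" using ka by (intro mult_left_mono) auto
      also have "\<dots> \<le> s * max 0 (inner \<xi> (u x))" using ka by (intro mult_right_mono) auto
      finally show ?thesis by simp
    qed
    have "ennreal s * projection_average K =
      (\<integral>\<^sup>+x. (\<integral>\<^sup>+\<xi>. (if x \<in> segment_sum K s \<xi> \<and> x \<notin> K then 1 else 0) \<partial>unit_sphere) \<partial>lborel_on E)"
      using projection_average_scale[OF K, of s] segment_fubini[OF K, of s] s by simp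
    also have "\<dots> \<le> (\<integral>\<^sup>+x. (\<integral>\<^sup>+\<xi>. (if x \<notin> K \<and> infdist x K - 0 \<le> s * max 0 (inner \<xi> (u x)) then 1 else 0) \<partial>unit_sphere) \<partial>lborel_on E)"
    proof (rule nn_integral_mono_AE)
      show "AE x in lborel_on E. (\<integral>\<^sup>+\<xi>. (if x \<in> segment_sum K s \<xi> \<and> x \<notin> K then 1 else 0) \<partial>unit_sphere)
        \<le> (\<integral>\<^sup>+\<xi>. (if x \<notin> K \<and> infdist x K - 0 \<le> s * max 0 (inner \<xi> (u x)) then 1 else 0) \<partial>unit_sphere)"
        using AE_E
      proof eventually_elim
        case (elim x)
        show ?case by (rule nn_integral_mono) (use touch[OF elim] in auto)
      qed
    qed
    also have "\<dots> = (\<integral>\<^sup>+\<xi>. emeasure (lborel_on E) {x. x \<notin> K \<and> infdist x K - 0 \<le> s * max 0 (inner \<xi> ?e)} \<partial>unit_sphere)"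
      by (rule layer_fubini) (use pu(3) e0[OF n] in auto)
    also have "\<dots> = (\<integral>\<^sup>+\<xi>. ennreal (?f (s * max 0 (inner \<xi> ?e)) - vol E K) \<partial>unit_sphere)"
      using emeasure_shell[OF K order_refl] s by (intro nn_integral_cong) (simp add: max_def)
    finally show ?thesis .
  qed
  have "projection_average K \<le> ennreal (half_width * ?c) + ennreal \<epsilon>" if \<epsilon>: "\<epsilon> > 0" for \<epsilon>
  proof -
    have "\<forall>\<^sub>F h in at_right 0. (?f h - vol E K) / h < ?c + \<epsilon>"
      using S(1) \<epsilon> by (intro order_tendstoD(2)) auto
    then obtain \<delta> where \<delta>: "\<delta> > 0" "\<And>h. 0 < h \<Longrightarrow> h < \<delta> \<Longrightarrow> (?f h - vol E K) / h < ?c + \<epsilon>"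
      by (auto simp: eventually_at_right_field)
    \<comment> \<open>Any s below \<open>\<delta>\<close> works: since <xi, e> <= 1, every shell has
      width less than \<open>\<delta>\<close>.\<close>
    define s where "s = \<delta> / 2"
    have s: "s > 0" "s < \<delta>" using \<delta> by (auto simp: s_def)
    have c: "?c + \<epsilon> \<ge> 0" using S(2) \<epsilon> by simp
    have "ennreal s * projection_average K \<le> (\<integral>\<^sup>+\<xi>. ennreal ((?c + \<epsilon>) * s * max 0 (inner \<xi> ?e)) \<partial>unit_sphere)"
    proof (rule order_trans[OF le[OF s(1)]], rule nn_integral_mono_AE)
      show "AE \<xi> in unit_sphere. ennreal (?f (s * max 0 (inner \<xi> ?e)) - vol E K) \<le> ennreal ((?c + \<epsilon>) * s * max 0 (inner \<xi> ?e))"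
        using AE_sphere[OF n]
      proof eventually_elim
        case (elim \<xi>)
        let ?m = "max 0 (inner \<xi> ?e)"
        have m: "?m \<le> 1" using elim Cauchy_Schwarz_ineq2[of \<xi> ?e] e0[OF n] by simp
        show ?case
        proof (cases "?m = 0")
          case False
          then have m0: "?m > 0" by linarith
          have h: "0 < s * ?m" using m0 s by simp
          have "s * ?m \<le> s * 1" using m s by (intro mult_left_mono) auto
          then have h': "s * ?m < \<delta>" using s(2) by linarith
          show ?thesis using \<delta>(2)[OF h h'] h by (intro ennreal_leI) (simp add: field_simps)
        qed simp
      qed
    qed
    also have "\<dots> = ennreal ((?c + \<epsilon>) * s * half_width)"
      unfolding half_width_def using c s half_width_integrable[OF n]
      by (subst nn_integral_eq_integral) auto
    finally have *: "ennreal s * projection_average K \<le> ennreal s * ennreal ((?c + \<epsilon>) * half_width)"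
      using s c half_width_nonneg[OF n] by (simp add: mult_ac flip: ennreal_mult)
    have "projection_average K \<le> ennreal ((?c + \<epsilon>) * half_width)"
      using * s by (subst (asm) ennreal_mult_le_mult_iff) auto
    also have "\<dots> \<le> ennreal (half_width * ?c + \<epsilon>)"
    proof (rule ennreal_leI)
      have "half_width \<le> 1"
        by (rule half_width_le_1)
      then have "\<epsilon> * half_width \<le> \<epsilon> * 1" using \<epsilon> by (intro mult_left_mono) auto
      then show "(?c + \<epsilon>) * half_width \<le> half_width * ?c + \<epsilon>" by (simp add: algebra_simps)
    qed
    finally show ?thesis using \<epsilon> S(2) half_width_nonneg[OF n] by simp
  qed
  then show ?thesis by (rule ennreal_le_epsilon)
qed

text \<open>The parallel body is a union of balls of radius \<open>\<tau>\<close> centred in K.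
  Moving back from x by s xi lands in the ball around p x once the distance of x to the parallel
  body is at most s <xi, u x> - s^2 / (2 \<open>\<tau>\<close>); the quadratic term disappears after
  division by s.\<close>

lemma projection_average_ge:
  assumes K: "body K" and \<tau>: "\<tau> > 0"
  shows "ennreal (half_width * surface_area E (parallel_body E K \<tau>)) \<le> projection_average (parallel_body E K \<tau>)"
proof -
  define L where "L = parallel_body E K \<tau>"
  let ?e = "onb E 0" and ?f = "\<lambda>t. vol E (parallel_body E K t)" and ?c = "surface_area E L"
  have L: "body L" unfolding L_def by (intro body_parallel_body K less_imp_le \<tau>)
  note [measurable] = bodyD(4)[OF L]
  obtain x0 r where xr: "r > 0" "x0 \<in> L" "\<And>u. u \<in> E \<Longrightarrow> norm u \<le> r \<Longrightarrow> x0 + u \<in> L"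
    using L by (elim body_ballE) blast
  note S = surface_area_body[OF L xr]
  have KL: "K \<subseteq> L" unfolding L_def by (rule subset_parallel_body)
  obtain p u where pu: "\<And>x. p x \<in> K" "\<And>x. x = p x + infdist x K *\<^sub>R u x"
    "\<And>x. x \<in> E \<Longrightarrow> x \<notin> K \<Longrightarrow> u x \<in> E \<and> norm (u x) = 1"
    "\<And>x z. z \<in> K \<Longrightarrow> inner (u x) (z - p x) \<le> 0"
    using outer_normal[OF K] by blast
  have le: "(\<integral>\<^sup>+\<xi>. ennreal (?f (\<tau> + max 0 (s * inner \<xi> ?e - s\<^sup>2 / (2 * \<tau>))) - vol E L) \<partial>unit_sphere) \<le> ennreal s * projection_average L"
    if s: "s > 0" for s
  proof -
    have touch: "x \<in> segment_sum L s \<xi>"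
      if x: "x \<in> E" "x \<notin> L" "infdist x K - \<tau> \<le> s * inner \<xi> (u x) - s\<^sup>2 / (2 * \<tau>)" and \<xi>: "\<xi> \<in> E" "norm \<xi> = 1" for x \<xi>
    proof -
      have xK: "x \<notin> K" using x KL by blast
      let ?d = "infdist x K"
      have uu: "inner (u x) (u x) = 1" "inner \<xi> \<xi> = 1" using pu(3)[OF x(1) xK] \<xi> by (simp_all add: norm_eq_sqrt_inner)
      have d: "?d > \<tau>" using x \<tau> unfolding L_def by (simp add: mem_parallel_body_iff[OF K])
      let ?w = "?d *\<^sub>R u x - s *\<^sub>R \<xi>"
      have xw: "x - s *\<^sub>R \<xi> = p x + ?w"
        by (subst (1) pu(2)[of x]) simp
      have "inner ?w ?w = ?d\<^sup>2 - 2 * s * ?d * inner \<xi> (u x) + s\<^sup>2"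
        by (simp add: inner_diff_left inner_diff_right uu inner_commute[of "u x" \<xi>] power2_eq_square algebra_simps)
      \<comment> \<open>With d > \<open>\<tau>\<close> the term d s^2 / \<open>\<tau>\<close> coming
        from the hypothesis absorbs s^2, and d^2 - 2 d (d - \<open>\<tau>\<close>) =
        \<open>\<tau>\<close>^2 - (d - \<open>\<tau>\<close>)^2.\<close>
      also have "\<dots> \<le> \<tau>\<^sup>2"
      proof -
        have "2 * ?d * (?d - \<tau> + s\<^sup>2 / (2 * \<tau>)) \<le> 2 * ?d * (s * inner \<xi> (u x))"
          using x(3) d \<tau> by (intro mult_left_mono) auto
        moreover have "s\<^sup>2 \<le> ?d * (s\<^sup>2 / \<tau>)"
          using mult_right_mono[of \<tau> ?d "s\<^sup>2 / \<tau>"] d \<tau> by simp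
        moreover have "2 * ?d * (?d - \<tau> + s\<^sup>2 / (2 * \<tau>)) = 2 * ?d * (?d - \<tau>) + ?d * (s\<^sup>2 / \<tau>)"
          using \<tau> by (simp add: field_simps)
        ultimately have "?d\<^sup>2 - 2 * s * ?d * inner \<xi> (u x) + s\<^sup>2 \<le> ?d\<^sup>2 - 2 * ?d * (?d - \<tau>)"
          by (simp add: mult_ac)
        also have "\<dots> = \<tau>\<^sup>2 - (?d - \<tau>)\<^sup>2" by (simp add: power2_eq_square algebra_simps)
        finally show ?thesis by (smt (verit) zero_le_power2)
      qed
      finally have "(norm ?w)\<^sup>2 \<le> \<tau>\<^sup>2" unfolding power2_norm_eq_inner .
      then have "norm ?w \<le> \<tau>" by (rule power2_le_imp_le[OF _ less_imp_le[OF \<tau>]])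
      moreover have "?w \<in> E" using pu(3)[OF x(1) xK] \<xi> by (intro subspace_diff subspace_scale subspace) auto
      moreover have "p x + ?w = p x + \<tau> *\<^sub>R ((1 / \<tau>) *\<^sub>R ?w)" using \<tau> by simp
      moreover have "norm ((1 / \<tau>) *\<^sub>R ?w) \<le> 1" using \<tau> calculation(1) by simp
      moreover have "(1 / \<tau>) *\<^sub>R ?w \<in> E" using calculation(2) by (intro subspace_scale subspace)
      ultimately have "x - s *\<^sub>R \<xi> \<in> L" unfolding L_def parallel_body_def xw using pu(1) by blast
      then show ?thesis using s by (auto simp: mem_segment_sum)
    qed
    have "(\<integral>\<^sup>+\<xi>. ennreal (?f (\<tau> + max 0 (s * inner \<xi> ?e - s\<^sup>2 / (2 * \<tau>))) - vol E L) \<partial>unit_sphere)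
      = (\<integral>\<^sup>+\<xi>. emeasure (lborel_on E) {x. x \<notin> L \<and> infdist x K - \<tau> \<le> s * inner \<xi> ?e - s\<^sup>2 / (2 * \<tau>)} \<partial>unit_sphere)"
      unfolding L_def using emeasure_shell[OF K less_imp_le[OF \<tau>]] by (intro nn_integral_cong) simp
    also have "\<dots> = (\<integral>\<^sup>+x. (\<integral>\<^sup>+\<xi>. (if x \<notin> L \<and> infdist x K - \<tau> \<le> s * inner \<xi> (u x) - s\<^sup>2 / (2 * \<tau>) then 1 else 0) \<partial>unit_sphere) \<partial>lborel_on E)"
      by (rule layer_fubini[symmetric]) (use pu(3) e0[OF n] KL in auto)
    also have "\<dots> \<le> (\<integral>\<^sup>+x. (\<integral>\<^sup>+\<xi>. (if x \<in> segment_sum L s \<xi> \<and> x \<notin> L then 1 else 0) \<partial>unit_sphere) \<partial>lborel_on E)"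
    proof (rule nn_integral_mono_AE)
      show "AE x in lborel_on E. (\<integral>\<^sup>+\<xi>. (if x \<notin> L \<and> infdist x K - \<tau> \<le> s * inner \<xi> (u x) - s\<^sup>2 / (2 * \<tau>) then 1 else 0) \<partial>unit_sphere)
        \<le> (\<integral>\<^sup>+\<xi>. (if x \<in> segment_sum L s \<xi> \<and> x \<notin> L then 1 else 0) \<partial>unit_sphere)"
        using AE_E
      proof eventually_elim
        case (elim x)
        show ?case
        proof (rule nn_integral_mono_AE)
          show "AE \<xi> in unit_sphere. (if x \<notin> L \<and> infdist x K - \<tau> \<le> s * inner \<xi> (u x) - s\<^sup>2 / (2 * \<tau>) then 1 else 0)
            \<le> (if x \<in> segment_sum L s \<xi> \<and> x \<notin> L then 1 else (0::ennreal))"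
            using AE_sphere[OF n] by eventually_elim (use touch[OF elim] in auto)
        qed
      qed
    qed
    also have "\<dots> = ennreal s * projection_average L"
      using projection_average_scale[OF L, of s] segment_fubini[OF L, of s] s by simp
    finally show ?thesis .
  qed
  \<comment> \<open>The upper half makes the average finite, so that it can be handled as a real
    number.\<close>
  obtain P where P: "P \<ge> 0" "projection_average L = ennreal P"
    using projection_average_le[OF L] by (cases "projection_average L") (auto simp: top_unique)
  have hw: "0 \<le> half_width" "half_width \<le> 1"
    using half_width_nonneg[OF n] half_width_le_1 by auto
  have "half_width * ?c \<le> P + \<epsilon>" if \<epsilon>: "\<epsilon> > 0" for \<epsilon>
  proof -
    \<comment> \<open>A lower bound for the difference quotients near 0. If it is not positive, S(L)
      is at most \<open>\<epsilon>\<close> / 2 and the claim is immediate; otherwise it can serve as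
      a divisor.\<close>
    define c' where "c' = ?c - \<epsilon> / 2"
    show ?thesis
    proof (cases "c' > 0")
      case False
      then have "half_width * ?c \<le> 1 * (\<epsilon> / 2)" using hw S(2) by (intro mult_mono) (auto simp: c'_def)
      then show ?thesis using P \<epsilon> by simp
    next
      case c': True
      have "\<forall>\<^sub>F h in at_right 0. c' < (vol E (parallel_body E L h) - vol E L) / h"
        using S(1) \<epsilon> by (intro order_tendstoD(1)) (auto simp: c'_def)
      then obtain \<delta> where \<delta>: "\<delta> > 0" "\<And>h. 0 < h \<Longrightarrow> h < \<delta> \<Longrightarrow> c' < (vol E (parallel_body E L h) - vol E L) / h"
        by (auto simp: eventually_at_right_field)
      \<comment> \<open>The second entry keeps the curvature error c' s / (2 \<open>\<tau>\<close>)
        at most \<open>\<epsilon>\<close> / 2.\<close>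
      define s where "s = min (\<delta> / 2) (\<tau> * \<epsilon> / c')"
      have s: "s > 0" "s < \<delta>" "c' * s / (2 * \<tau>) \<le> \<epsilon> / 2"
      proof -
        show "s > 0" "s < \<delta>" using \<delta>(1) \<tau> \<epsilon> c' by (auto simp: s_def)
        have "s \<le> \<tau> * \<epsilon> / c'" by (simp add: s_def)
        then show "c' * s / (2 * \<tau>) \<le> \<epsilon> / 2" using c' \<tau> by (simp add: field_simps)
      qed
      have "ennreal (c' * s * half_width) = (\<integral>\<^sup>+\<xi>. ennreal (c' * s * max 0 (inner \<xi> ?e)) \<partial>unit_sphere)"
        unfolding half_width_def using c' s half_width_integrable[OF n]
        by (subst nn_integral_eq_integral) auto
      also have "\<dots> \<le> (\<integral>\<^sup>+\<xi>. ennreal (?f (\<tau> + max 0 (s * inner \<xi> ?e - s\<^sup>2 / (2 * \<tau>))) - vol E L) + ennreal (c' * (s\<^sup>2 / (2 * \<tau>))) \<partial>unit_sphere)"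
      proof (rule nn_integral_mono_AE)
        show "AE \<xi> in unit_sphere. ennreal (c' * s * max 0 (inner \<xi> ?e))
          \<le> ennreal (?f (\<tau> + max 0 (s * inner \<xi> ?e - s\<^sup>2 / (2 * \<tau>))) - vol E L) + ennreal (c' * (s\<^sup>2 / (2 * \<tau>)))"
          using AE_sphere[OF n]
        proof eventually_elim
          case (elim \<xi>)
          let ?t = "inner \<xi> ?e"
          define h where "h = max 0 (s * ?t - s\<^sup>2 / (2 * \<tau>))"
          have "?t \<le> 1" using elim Cauchy_Schwarz_ineq2[of \<xi> ?e] e0[OF n] by simp
          then have "s * ?t \<le> s * 1" using s by (intro mult_left_mono) auto
          moreover have "s\<^sup>2 / (2 * \<tau>) \<ge> 0" using \<tau> by simp
          ultimately have "s * ?t - s\<^sup>2 / (2 * \<tau>) < \<delta>" using s(2) by linarith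
          then have h: "0 \<le> h" "h < \<delta>" using \<delta>(1) by (auto simp: h_def)
          have fh: "c' * h \<le> ?f (\<tau> + h) - vol E L"
          proof (cases "h = 0")
            case False
            then show ?thesis using \<delta>(2)[of h] h \<tau> by (simp add: L_def parallel_body_add field_simps)
          qed (simp add: L_def)
          have "s * max 0 ?t \<le> h + s\<^sup>2 / (2 * \<tau>)"
            using s(1) \<tau> unfolding h_def by (cases "?t \<ge> 0") (auto simp: max_def mult_nonneg_nonpos)
          then have "c' * (s * max 0 ?t) \<le> c' * (h + s\<^sup>2 / (2 * \<tau>))" using c' by (intro mult_left_mono) auto
          then have "c' * s * max 0 ?t \<le> (?f (\<tau> + h) - vol E L) + c' * (s\<^sup>2 / (2 * \<tau>))"
            using fh by (simp add: algebra_simps)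
          then have "ennreal (c' * s * max 0 ?t) \<le> ennreal ((?f (\<tau> + h) - vol E L) + c' * (s\<^sup>2 / (2 * \<tau>)))"
            by (rule ennreal_leI)
          also have "\<dots> = ennreal (?f (\<tau> + h) - vol E L) + ennreal (c' * (s\<^sup>2 / (2 * \<tau>)))"
          proof (rule ennreal_plus)
            show "0 \<le> ?f (\<tau> + h) - vol E L" using fh c' h mult_nonneg_nonneg[of c' h] by linarith
          qed (use c' \<tau> in simp)
          finally show ?case by (simp add: h_def)
        qed
      qed
      also have "\<dots> = (\<integral>\<^sup>+\<xi>. ennreal (?f (\<tau> + max 0 (s * inner \<xi> ?e - s\<^sup>2 / (2 * \<tau>))) - vol E L) \<partial>unit_sphere) + ennreal (c' * (s\<^sup>2 / (2 * \<tau>)))"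
      proof -
        interpret S: prob_space unit_sphere by (rule prob_space_sphere)
        have "mono (\<lambda>h. ?f (\<tau> + max 0 h))"
          using \<tau> by (intro monoI vol_mono parallel_body_mono bodyD body_parallel_body K) auto
        then have [measurable]: "(\<lambda>h. ?f (\<tau> + max 0 h)) \<in> borel_measurable borel" by (rule borel_measurable_mono)
        have [measurable]: "(\<lambda>\<xi>. ?f (\<tau> + max 0 (s * inner \<xi> ?e - s\<^sup>2 / (2 * \<tau>)))) \<in> borel_measurable borel"
          by (rule measurable_compose[of "\<lambda>\<xi>. s * inner \<xi> ?e - s\<^sup>2 / (2 * \<tau>)" _ borel]) measurable
        show ?thesis by (subst nn_integral_add) (auto simp: S.emeasure_space_1[simplified])
      qed
      also have "\<dots> \<le> ennreal s * projection_average L + ennreal (c' * (s\<^sup>2 / (2 * \<tau>)))"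
        by (intro add_right_mono le s)
      also have "\<dots> = ennreal (s * P + c' * (s\<^sup>2 / (2 * \<tau>)))"
        using s P c' \<tau> by (simp add: ennreal_mult ennreal_plus)
      finally have fin: "ennreal (c' * s * half_width) \<le> ennreal (s * P + c' * (s\<^sup>2 / (2 * \<tau>)))" .
      have "0 \<le> s * P + c' * (s\<^sup>2 / (2 * \<tau>))" using s P c' \<tau> by simp
      from fin[unfolded ennreal_le_iff[OF this]]
      have "c' * s * half_width \<le> s * P + c' * (s\<^sup>2 / (2 * \<tau>))" .
      then have "s * (c' * half_width) \<le> s * (P + c' * s / (2 * \<tau>))"
        by (simp add: algebra_simps power2_eq_square)
      then have "c' * half_width \<le> P + c' * s / (2 * \<tau>)" using s by simp
      moreover have "half_width * ?c \<le> c' * half_width + \<epsilon> / 2"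
        using mult_right_mono[of half_width 1 "\<epsilon> / 2"] hw \<epsilon> by (simp add: c'_def algebra_simps)
      ultimately show ?thesis using s(3) by linarith
    qed
  qed
  then have "half_width * ?c \<le> P" by (rule field_le_epsilon)
  then show ?thesis using P unfolding L_def by (simp add: ennreal_leI)
qed

end

text \<open>Subtracting A(0) >= kappa S(K) from A(h) <= kappa f(h) S(K) / f(0) leaves kappa S(K) /
  |K| times f(h) - f(0); the second factor S(K) thus enters as the derivative of f at 0.\<close>

theorem average_surface_area_projections:
  assumes n: "dim E \<ge> 1" and K: "body K"
  shows "(LINT \<xi>|unit_sphere. surface_area (perp E \<xi>) (perp_proj \<xi> ` K))
    \<le> half_width * (surface_area E K)\<^sup>2 / vol E K"
proof -
  let ?f = "\<lambda>t. vol E (parallel_body E K t)" and ?c = "surface_area E K" and ?\<kappa> = half_width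
  obtain x0 r where xr: "r > 0" "x0 \<in> K" "\<And>u. u \<in> E \<Longrightarrow> norm u \<le> r \<Longrightarrow> x0 + u \<in> K"
    using K by (elim body_ballE) blast
  note S = surface_area_body[OF K xr]
  have f0: "vol E K > 0" by (rule vol_body_pos[OF K])
  have \<kappa>: "?\<kappa> \<ge> 0" by (rule half_width_nonneg[OF n])
  have pb: "body (parallel_body E K t)" if "t \<ge> 0" for t by (rule body_parallel_body[OF K that])
  \<comment> \<open>The volume of a layer rather than of a projection: it is measurable in xi on the
    whole space and equals the projected volume for almost all xi.\<close>
  define G where "G h \<xi> = measure (lborel_on E) (segment_sum (parallel_body E K h) 1 \<xi> - parallel_body E K h)" for h \<xi>
  have G_emeasure: "emeasure (lborel_on E) (segment_sum (parallel_body E K h) 1 \<xi> - parallel_body E K h) = ennreal (G h \<xi>)"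
    if "h \<ge> 0" for h \<xi>
    using emeasure_eq_vol[of "segment_sum (parallel_body E K h) 1 \<xi> - parallel_body E K h"]
      compact_segment_sum[OF pb[OF that]] by (simp add: G_def vol_def compact_imp_bounded bounded_diff)
  have G_nonneg: "G h \<xi> \<ge> 0" for h \<xi> by (simp add: G_def)
  have Gm: "G h \<in> borel_measurable borel" if "h \<ge> 0" for h
  proof -
    have "(\<lambda>\<xi>. enn2real (emeasure (lborel_on E) (segment_sum (parallel_body E K h) 1 \<xi> - parallel_body E K h))) \<in> borel_measurable borel"
      using emeasure_segment_layer(2)[OF pb[OF that]] by measurable
    then show ?thesis by (simp add: G_emeasure[OF that] G_nonneg)
  qed
  have avg: "(\<integral>\<^sup>+\<xi>. ennreal (G h \<xi>) \<partial>unit_sphere) = projection_average (parallel_body E K h)" if "h \<ge> 0" for h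
    unfolding projection_average_def G_emeasure[OF that] ..
  have Gint: "integrable unit_sphere (G h)" if h: "h \<ge> 0" for h
  proof (rule integrableI_nonneg)
    show "G h \<in> borel_measurable unit_sphere" using Gm[OF h] by simp
    show "(\<integral>\<^sup>+\<xi>. ennreal (G h \<xi>) \<partial>unit_sphere) < \<infinity>"
      unfolding avg[OF h] using projection_average_le[OF n pb[OF h]] by (rule le_less_trans) simp
  qed (simp add: G_nonneg)
  define A where "A h = (LINT \<xi>|unit_sphere. G h \<xi>)" for h
  have A_avg: "projection_average (parallel_body E K h) = ennreal (A h)" if "h \<ge> 0" for h
    unfolding A_def avg[OF that, symmetric]
    by (rule nn_integral_eq_integral[OF Gint[OF that]]) (simp add: G_nonneg)
  have A_nonneg: "A h \<ge> 0" for h unfolding A_def by (intro Bochner_Integration.integral_nonneg G_nonneg)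
  have S_nonneg: "surface_area E (parallel_body E K h) \<ge> 0" if h: "h \<ge> 0" for h
    using pb[OF h] surface_area_nonneg[OF pb[OF h]] by (auto elim!: body_ballE)
  have A_le: "A h \<le> ?\<kappa> * surface_area E (parallel_body E K h)" if h: "h \<ge> 0" for h
    using projection_average_le[OF n pb[OF h]] S_nonneg[OF h] \<kappa> by (simp add: A_avg[OF h])
  have A_ge: "?\<kappa> * surface_area E (parallel_body E K h) \<le> A h" if h: "h > 0" for h
    using projection_average_ge[OF n K h] A_nonneg[of h] h by (simp add: A_avg)
  have G_eq: "G h \<xi> = vol (perp E \<xi>) (parallel_body (perp E \<xi>) (perp_proj \<xi> ` K) h)"
    if h: "h \<ge> 0" and \<xi>: "\<xi> \<in> E" "norm \<xi> = 1" for h \<xi>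
  proof -
    interpret P: fd_subspace "perp E \<xi>" by (rule fd_perp[OF \<xi>])
    have "ennreal (G h \<xi>) = ennreal (vol (perp E \<xi>) (parallel_body (perp E \<xi>) (perp_proj \<xi> ` K) h))"
      using emeasure_segment_sum[OF \<xi> pb[OF h], of 1] G_emeasure[OF h, of \<xi>]
      by (simp add: perp_proj_parallel_body[OF \<xi>])
    then show ?thesis by (simp add: G_nonneg)
  qed
  \<comment> \<open>Every projection of K contains a ball of the same radius r, so the growth factor
    is uniform in xi and survives averaging.\<close>
  have A_growth: "A h \<le> (1 + h / r) ^ (dim E - 1) * A 0" if h: "h \<ge> 0" for h
  proof -
    have "A h \<le> (LINT \<xi>|unit_sphere. (1 + h / r) ^ (dim E - 1) * G 0 \<xi>)"
      unfolding A_def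
    proof (rule integral_mono_AE[OF Gint[OF h]])
      show "integrable unit_sphere (\<lambda>\<xi>. (1 + h / r) ^ (dim E - 1) * G 0 \<xi>)"
        by (intro integrable_mult_right Gint) simp
      show "AE \<xi> in unit_sphere. G h \<xi> \<le> (1 + h / r) ^ (dim E - 1) * G 0 \<xi>"
        using AE_sphere[OF n]
      proof eventually_elim
        case (elim \<xi>)
        then have \<xi>: "\<xi> \<in> E" "norm \<xi> = 1" by auto
        interpret P: fd_subspace "perp E \<xi>" by (rule fd_perp[OF \<xi>])
        have "vol (perp E \<xi>) (parallel_body (perp E \<xi>) (perp_proj \<xi> ` K) h)
          \<le> (1 + h / r) ^ dim (perp E \<xi>) * vol (perp E \<xi>) (perp_proj \<xi> ` K)"
        proof (rule P.vol_parallel_body_bound[OF body_perp_proj(1)[OF \<xi> K] xr(1) _ _ h])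
          show "perp_proj \<xi> x0 \<in> perp_proj \<xi> ` K" using xr(2) by blast
          show "perp_proj \<xi> x0 + u \<in> perp_proj \<xi> ` K" if "u \<in> perp E \<xi>" "norm u \<le> r" for u
            by (rule body_perp_proj(2)[OF \<xi> K xr(2,3) that])
        qed
        then show ?case by (simp add: G_eq[OF h \<xi>] G_eq[OF order_refl \<xi>] dim_perp[OF \<xi>])
      qed
    qed
    then show ?thesis by (simp add: A_def)
  qed
  have f_pos: "?f h > 0" if "h \<ge> 0" for h by (rule vol_body_pos[OF pb[OF that]])
  \<comment> \<open>The lower half of Cauchy's formula is at hand for h > 0 only. S(K_h) is at least
    f(h) times the slope of ln f from h to 2 h, which tends to S(K), while A(h) is at most A(0)
    times a factor tending to 1.\<close>
  have A0: "?\<kappa> * ?c \<le> A 0"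
  proof (rule tendsto_le)
    show "((\<lambda>h. (1 + h / r) ^ (dim E - 1) * A 0) \<longlongrightarrow> A 0) (at_right 0)"
    proof -
      have "((\<lambda>h. (1 + h / r) ^ (dim E - 1) * A 0) \<longlongrightarrow> (1 + 0 / r) ^ (dim E - 1) * A 0) (at_right 0)"
        by (intro tendsto_intros) (use xr in auto)
      then show ?thesis by simp
    qed
    have "(?f has_real_derivative ?c) (at 0 within {0<..})"
      using S(1) by (simp add: has_field_derivative_iff)
    then have "((\<lambda>t. ln (?f t)) has_real_derivative (1 / ?f 0 * ?c)) (at 0 within {0<..})"
      using f0 by (intro DERIV_chain2[of ln] DERIV_ln_divide) auto
    then have ln1: "((\<lambda>h. (ln (?f h) - ln (vol E K)) / h) \<longlongrightarrow> ?c / vol E K) (at_right 0)"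
      by (simp add: has_field_derivative_iff)
    \<comment> \<open>The slope of ln f from h to 2 h is twice the slope from 0 to 2 h minus the
      slope from 0 to h, so two instances of one limit suffice.\<close>
    have ln2: "((\<lambda>h. (ln (?f (2 * h)) - ln (vol E K)) / (2 * h)) \<longlongrightarrow> ?c / vol E K) (at_right 0)"
    proof (rule filterlim_compose[OF ln1])
      show "filterlim (\<lambda>h::real. 2 * h) (at_right 0) (at_right 0)"
        by (intro filterlim_at_withinI) (auto intro!: tendsto_eq_intros simp: eventually_at_right_field intro: exI[of _ 1])
    qed
    have fl: "(?f \<longlongrightarrow> vol E K) (at_right 0)"
    proof -
      have "((\<lambda>h. (?f h - vol E K) / h * h + vol E K) \<longlongrightarrow> ?c * 0 + vol E K) (at_right 0)"
        by (intro tendsto_intros S(1))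
      then have "((\<lambda>h. (?f h - vol E K) / h * h + vol E K) \<longlongrightarrow> vol E K) (at_right 0)" by simp
      then show ?thesis
        by (rule Lim_transform_eventually) (auto simp: eventually_at_right_field intro!: exI[of _ 1])
    qed
    have "((\<lambda>h. ?\<kappa> * (?f h * (2 * ((ln (?f (2 * h)) - ln (vol E K)) / (2 * h)) - (ln (?f h) - ln (vol E K)) / h)))
      \<longlongrightarrow> ?\<kappa> * (vol E K * (2 * (?c / vol E K) - ?c / vol E K))) (at_right 0)"
      by (intro tendsto_intros fl ln1 ln2)
    then show "((\<lambda>h. ?\<kappa> * (?f h * (2 * ((ln (?f (2 * h)) - ln (vol E K)) / (2 * h)) - (ln (?f h) - ln (vol E K)) / h)))
      \<longlongrightarrow> ?\<kappa> * ?c) (at_right 0)"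
      using f0 by simp
    have "?\<kappa> * (?f h * (2 * ((ln (?f (2 * h)) - ln (vol E K)) / (2 * h)) - (ln (?f h) - ln (vol E K)) / h))
      \<le> (1 + h / r) ^ (dim E - 1) * A 0" if h: "h > 0" for h
    proof -
      let ?L = "parallel_body E K h"
      have xL: "x0 \<in> ?L" "\<And>u. u \<in> E \<Longrightarrow> norm u \<le> r \<Longrightarrow> x0 + u \<in> ?L"
        using xr subset_parallel_body by blast+
      have "2 * ((ln (?f (2 * h)) - ln (vol E K)) / (2 * h)) - (ln (?f h) - ln (vol E K)) / h
        = (ln (?f (h + h)) - ln (?f h)) / h"
      proof -
        have "2 * ((a - c) / (2 * h)) - (b - c) / h = (a - b) / h" for a b c :: real
          using h by (simp add: field_simps)
        then show ?thesis unfolding mult_2[symmetric] .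
      qed
      also have "?f h * \<dots> \<le> surface_area E ?L"
        using surface_area_ge[OF pb xr(1) xL h] h by (simp add: parallel_body_add)
      finally have "?\<kappa> * (?f h * (2 * ((ln (?f (2 * h)) - ln (vol E K)) / (2 * h)) - (ln (?f h) - ln (vol E K)) / h))
        \<le> ?\<kappa> * surface_area E ?L" using \<kappa> by (rule mult_left_mono)
      also have "\<dots> \<le> A h" by (rule A_ge[OF h])
      also have "\<dots> \<le> (1 + h / r) ^ (dim E - 1) * A 0" by (intro A_growth less_imp_le h)
      finally show ?thesis .
    qed
    then show "\<forall>\<^sub>F h in at_right 0. ?\<kappa> * (?f h * (2 * ((ln (?f (2 * h)) - ln (vol E K)) / (2 * h)) - (ln (?f h) - ln (vol E K)) / h))
      \<le> (1 + h / r) ^ (dim E - 1) * A 0"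
      by (auto simp: eventually_at_right_field intro!: exI[of _ 1])
  qed simp
  \<comment> \<open>Fatou's lemma is about sequences, so the one-sided limit is taken along 1 / (k +
    1).\<close>
  define h where "h k = 1 / real (Suc k)" for k
  have h_pos: "h k > 0" for k by (simp add: h_def)
  have h_lim: "filterlim h (at_right 0) sequentially"
    unfolding h_def by (intro filterlim_at_withinI LIMSEQ_Suc[OF lim_1_over_n]) auto
  let ?X = "\<lambda>k \<xi>. ennreal ((G (h k) \<xi> - G 0 \<xi>) / h k)"
  let ?S = "\<lambda>\<xi>. surface_area (perp E \<xi>) (perp_proj \<xi> ` K)"
  have perp_S: "?S \<xi> \<ge> 0" "(\<lambda>k. (G (h k) \<xi> - G 0 \<xi>) / h k) \<longlonglongrightarrow> ?S \<xi>" "\<And>k. G 0 \<xi> \<le> G (h k) \<xi>"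
    if \<xi>: "\<xi> \<in> E" "norm \<xi> = 1" for \<xi>
  proof -
    interpret P: fd_subspace "perp E \<xi>" by (rule fd_perp[OF \<xi>])
    note PK = body_perp_proj(1)[OF \<xi> K]
    obtain y s where ys: "s > 0" "y \<in> perp_proj \<xi> ` K" "\<And>u. u \<in> perp E \<xi> \<Longrightarrow> norm u \<le> s \<Longrightarrow> y + u \<in> perp_proj \<xi> ` K"
      using PK by (elim P.body_ballE) blast
    note PS = P.surface_area_body[OF PK ys]
    show "?S \<xi> \<ge> 0" by (rule PS(2))
    show "(\<lambda>k. (G (h k) \<xi> - G 0 \<xi>) / h k) \<longlonglongrightarrow> ?S \<xi>"
      using filterlim_compose[OF PS(1) h_lim] h_pos
      by (simp add: G_eq[OF less_imp_le[OF h_pos] \<xi>] G_eq[OF order_refl \<xi>])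
    show "G 0 \<xi> \<le> G (h k) \<xi>" for k
      using P.bodyD[OF P.body_parallel_body[OF PK less_imp_le[OF h_pos]]] h_pos[of k]
      by (simp only: G_eq[OF less_imp_le[OF h_pos] \<xi>] G_eq[OF order_refl \<xi>])
        (intro P.vol_mono P.parallel_body_mono, auto)
  qed
  have X_int: "(\<integral>\<^sup>+\<xi>. ?X k \<xi> \<partial>unit_sphere) \<le> ennreal (?\<kappa> * ?c / vol E K * ((?f (h k) - vol E K) / h k))" for k
  proof -
    have hk: "h k > 0" "h k \<ge> 0" using h_pos[of k] by auto
    have "(\<integral>\<^sup>+\<xi>. ?X k \<xi> \<partial>unit_sphere) = ennreal (LINT \<xi>|unit_sphere. (G (h k) \<xi> - G 0 \<xi>) / h k)"
    proof (rule nn_integral_eq_integral)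
      show "integrable unit_sphere (\<lambda>\<xi>. (G (h k) \<xi> - G 0 \<xi>) / h k)"
        by (intro integrable_divide_zero Bochner_Integration.integrable_diff Gint hk order_refl)
      show "AE \<xi> in unit_sphere. 0 \<le> (G (h k) \<xi> - G 0 \<xi>) / h k"
        using AE_sphere[OF n] by eventually_elim (use perp_S(3) hk in simp)
    qed
    also have "(LINT \<xi>|unit_sphere. (G (h k) \<xi> - G 0 \<xi>) / h k) = (A (h k) - A 0) / h k"
      unfolding A_def using hk by (simp add: Bochner_Integration.integral_diff Gint)
    also have "\<dots> \<le> ?\<kappa> * ?c / vol E K * ((?f (h k) - vol E K) / h k)"
    proof -
      have "A (h k) \<le> ?\<kappa> * (?f (h k) / vol E K * ?c)"
        using A_le[OF hk(2)] mult_left_mono[OF surface_area_parallel_body_le[OF K hk(2)] \<kappa>] by linarith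
      then have "A (h k) - A 0 \<le> ?\<kappa> * (?f (h k) / vol E K * ?c) - ?\<kappa> * ?c" using A0 by simp
      also have "\<dots> = ?\<kappa> * ?c / vol E K * (?f (h k) - vol E K)" using f0 by (simp add: field_simps)
      finally have "(A (h k) - A 0) / h k \<le> ?\<kappa> * ?c / vol E K * (?f (h k) - vol E K) / h k"
        using hk by (intro divide_right_mono) auto
      then show ?thesis by simp
    qed
    finally show ?thesis by (simp add: ennreal_leI)
  qed
  have "(\<integral>\<^sup>+\<xi>. ennreal (?S \<xi>) \<partial>unit_sphere) = (\<integral>\<^sup>+\<xi>. liminf (\<lambda>k. ?X k \<xi>) \<partial>unit_sphere)"
  proof (rule nn_integral_cong_AE)
    show "AE \<xi> in unit_sphere. ennreal (?S \<xi>) = liminf (\<lambda>k. ?X k \<xi>)"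
      using AE_sphere[OF n]
    proof eventually_elim
      case (elim \<xi>)
      then have "(\<lambda>k. ?X k \<xi>) \<longlonglongrightarrow> ennreal (?S \<xi>)" by (intro tendsto_ennrealI perp_S) auto
      then show ?case by (intro lim_imp_Liminf[symmetric]) auto
    qed
  qed
  also have "\<dots> \<le> liminf (\<lambda>k. \<integral>\<^sup>+\<xi>. ?X k \<xi> \<partial>unit_sphere)"
  proof (rule nn_integral_liminf)
    fix k
    have [measurable]: "G (h k) \<in> borel_measurable borel" "G 0 \<in> borel_measurable borel"
      by (intro Gm less_imp_le h_pos, intro Gm order_refl)
    show "?X k \<in> borel_measurable unit_sphere" by measurable
  qed
  also have "\<dots> \<le> liminf (\<lambda>k. ennreal (?\<kappa> * ?c / vol E K * ((?f (h k) - vol E K) / h k)))"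
    by (intro Liminf_mono always_eventually allI X_int)
  also have "\<dots> = ennreal (?\<kappa> * ?c / vol E K * ?c)"
    using filterlim_compose[OF S(1) h_lim]
    by (intro lim_imp_Liminf tendsto_ennrealI tendsto_mult_left) auto
  finally have fin: "(\<integral>\<^sup>+\<xi>. ennreal (?S \<xi>) \<partial>unit_sphere) \<le> ennreal (?\<kappa> * ?c\<^sup>2 / vol E K)"
    by (simp add: power2_eq_square mult.assoc)
  show ?thesis
  proof (cases "integrable unit_sphere ?S")
    case True
    have "ennreal (LINT \<xi>|unit_sphere. ?S \<xi>) = (\<integral>\<^sup>+\<xi>. ennreal (?S \<xi>) \<partial>unit_sphere)"
    proof (rule nn_integral_eq_integral[symmetric, OF True])
      show "AE \<xi> in unit_sphere. 0 \<le> ?S \<xi>"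
        using AE_sphere[OF n] by eventually_elim (rule perp_S(1), auto)
    qed
    also note fin
    finally have "ennreal (LINT \<xi>|unit_sphere. ?S \<xi>) \<le> ennreal (?\<kappa> * ?c\<^sup>2 / vol E K)" .
    moreover have "0 \<le> ?\<kappa> * ?c\<^sup>2 / vol E K" using \<kappa> f0 by simp
    ultimately show ?thesis by (simp only: ennreal_le_iff)
  next
    \<comment> \<open>A function that is not integrable has Bochner integral 0, which is below the
      nonnegative right side.\<close>
    case False
    then show ?thesis using \<kappa> f0 by (simp add: not_integrable_integral_eq)
  qed
qed

end

section \<open>Bodies in isotropic position contain a large ball\<close>

text \<open>The odd numbers 1, 3, ..., 2 m + 1 sum to (m + 1)^2, which exceeds y^2 for m the integer
  part of y: a discrete layer cake formula for the square.\<close>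

lemma square_le_sum_odd:
  fixes y :: real
  assumes "0 \<le> y" "y < real N"
  shows "y\<^sup>2 \<le> (\<Sum>k<N. (2 * real k + 1) * (if real k \<le> y then 1 else 0))"
proof -
  define m where "m = nat \<lfloor>y\<rfloor>"
  have m: "real m \<le> y" "y < real m + 1" using assms by (auto simp: m_def)
  have "m < N" using m assms by linarith
  have "y\<^sup>2 \<le> (real m + 1)\<^sup>2" using m assms by (intro power_mono) auto
  also have "\<dots> = (\<Sum>k<Suc m. 2 * real k + 1)"
    by (induction m) (simp_all add: power2_eq_square algebra_simps)
  also have "\<dots> = (\<Sum>k<Suc m. (2 * real k + 1) * (if real k \<le> y then 1 else 0))"
    using m by (intro sum.cong) auto
  also have "\<dots> \<le> (\<Sum>k<N. (2 * real k + 1) * (if real k \<le> y then 1 else 0))"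
    using \<open>m < N\<close> by (intro sum_mono2) auto
  finally show ?thesis .
qed

text \<open>Since 2 k + 1 is at most twice 2^k, the sum is dominated by a geometric series of ratio
  2 / 5.\<close>

lemma sum_odd_geometric_le: "(\<Sum>k<N. (2 * real k + 1) / 5 ^ k) \<le> 10 / 3"
proof -
  have "2 * real k + 1 \<le> 2 * 2 ^ k" for k
  proof -
    have "real (Suc k) \<le> real (2 ^ k)"
      using less_exp[of k] by (simp only: of_nat_le_iff Suc_le_eq)
    then show ?thesis by simp
  qed
  then have "(\<Sum>k<N. (2 * real k + 1) / 5 ^ k) \<le> (\<Sum>k<N. 2 * (2 / 5) ^ k)"
    by (intro sum_mono) (auto simp: power_divide intro: divide_right_mono)
  also have "\<dots> = 2 * (\<Sum>k<N. (2 / 5 :: real) ^ k)" by (simp add: sum_distrib_left)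
  also have "(\<Sum>k<N. (2 / 5 :: real) ^ k) \<le> suminf ((^) (2 / 5 :: real))"
    by (intro sum_le_suminf summable_geometric) auto
  also have "suminf ((^) (2 / 5 :: real)) = 5 / 3" by (subst suminf_geometric) auto
  finally show ?thesis by simp
qed

context fd_subspace
begin

lemma set_integrable_body:
  fixes g :: "'a \<Rightarrow> real"
  assumes K: "body K" and g: "continuous_on UNIV g"
  shows "set_integrable (lborel_on E) K g"
proof -
  note k = bodyD[OF K]
  have [measurable]: "g \<in> borel_measurable borel" using g by (rule borel_measurable_continuous_onI)
  note [measurable] = k(4)
  have "compact (g ` K)" using g k(2) by (intro compact_continuous_image) (auto intro: continuous_on_subset)
  then obtain B where B: "\<And>x. x \<in> K \<Longrightarrow> \<bar>g x\<bar> \<le> B" using compact_imp_bounded by (fastforce simp: bounded_iff)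
  have "integrable (lborel_on E) (\<lambda>x. indicator K x *\<^sub>R g x)"
  proof (rule Bochner_Integration.integrable_bound)
    show "integrable (lborel_on E) (\<lambda>x. B * indicator K x :: real)"
      using emeasure_bounded[OF k(5)] by (intro integrable_mult_right integrable_real_indicator) auto
    show "AE x in lborel_on E. norm (indicator K x *\<^sub>R g x) \<le> norm (B * indicator K x :: real)"
      using B by (intro AE_I2) (auto simp: indicator_def intro: order_trans[OF _ abs_ge_self])
  qed measurable
  then show ?thesis by (simp add: set_integrable_def)
qed

lemma set_integral_const_body: "body K \<Longrightarrow> (LINT x:K|lborel_on E. c) = c * vol E K" for c :: real
  unfolding set_lebesgue_integral_def vol_def using bodyD(4) emeasure_bounded[OF bodyD(5)] by simp

text \<open>The function b - <x, xi> is nonnegative on K with mean b, so Markov's inequality leaves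
  at most a fifth of K beyond 5 b. The Brunn-Minkowski inequality between K and the part beyond 5 b
  k, with weight 1 / k on the latter, lands beyond 5 b and turns the fifth into 5^(-k), in the
  manner of Borell's lemma.\<close>

lemma vol_tail:
  assumes K: "body K" and b: "b > 0" and le: "\<And>x. x \<in> K \<Longrightarrow> inner x \<xi> \<le> b"
    and cent: "(LINT x:K|lborel_on E. inner x \<xi>) = 0"
  shows "vol E {x\<in>K. 5 * b * real k \<le> b - inner x \<xi>} \<le> vol E K / 5 ^ k"
proof -
  let ?A = "\<lambda>t. {x\<in>K. t \<le> b - inner x \<xi>}" and ?V = "vol E K"
  note k = bodyD[OF K]
  note [measurable] = k(4)
  have A: "?A t \<in> sets borel" "bounded (?A t)" for t
    using k(5) by (measurable, auto intro: bounded_subset)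
  have V: "?V > 0" by (rule vol_body_pos[OF K])
  have int: "set_integrable (lborel_on E) K (\<lambda>x. b - inner x \<xi>)"
    by (intro set_integrable_body K continuous_intros)
  have one: "vol E (?A (5 * b)) \<le> ?V / 5"
  proof -
    have "5 * b * vol E (?A (5 * b)) = (LINT x|lborel_on E. 5 * b * indicator (?A (5 * b)) x)"
      using A by (simp add: vol_def)
    also have "\<dots> \<le> (LINT x|lborel_on E. indicator K x *\<^sub>R (b - inner x \<xi>))"
    proof (rule integral_mono)
      show "integrable (lborel_on E) (\<lambda>x. 5 * b * indicator (?A (5 * b)) x :: real)"
        using A emeasure_bounded[OF A(2)] unfolding sets_lborel_on[symmetric]
        by (intro integrable_mult_right integrable_real_indicator)
      show "integrable (lborel_on E) (\<lambda>x. indicator K x *\<^sub>R (b - inner x \<xi>))"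
        using int by (simp add: set_integrable_def)
      show "5 * b * indicator (?A (5 * b)) x \<le> indicator K x *\<^sub>R (b - inner x \<xi>)" for x
        using le[of x] by (cases "x \<in> K") (auto simp: indicator_def)
    qed
    also have "\<dots> = (LINT x:K|lborel_on E. b - inner x \<xi>)" by (simp add: set_lebesgue_integral_def)
    also have "\<dots> = (LINT x:K|lborel_on E. b) - (LINT x:K|lborel_on E. inner x \<xi>)"
      by (intro set_integral_diff set_integrable_body K continuous_intros)
    also have "\<dots> = b * ?V" by (simp add: cent set_integral_const_body[OF K])
    finally show ?thesis using b by simp
  qed
  consider "k = 0" | "k = 1" | "k \<ge> 2" by linarith
  then show ?thesis
  proof cases
    case 1
    then show ?thesis using A(1)[of 0] k by (auto intro: vol_mono)
  next
    case 2
    then show ?thesis using one by simp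
  next
    case 3
    define l where "l = 1 / real k"
    have l: "0 < l" "l < 1" using 3 by (auto simp: l_def)
    let ?W = "vol E (?A (5 * b * real k))"
    have "?V powr (1 - l) * ?W powr l \<le> vol E (?A (5 * b))"
    proof (rule brunn_minkowski[OF l k(4,5) A A])
      fix x y assume x: "x \<in> K" and y: "y \<in> ?A (5 * b * real k)"
      have "(1 - l) *\<^sub>R x + l *\<^sub>R y \<in> K" using k(3) x y l by (intro convexD) auto
      moreover have "5 * b \<le> b - inner ((1 - l) *\<^sub>R x + l *\<^sub>R y) \<xi>"
      proof -
        have "5 * b = l * (5 * b * real k)" using 3 by (simp add: l_def)
        also have "\<dots> \<le> l * (b - inner y \<xi>)" using l y by (intro mult_left_mono) auto
        also have "\<dots> \<le> (1 - l) * (b - inner x \<xi>) + l * (b - inner y \<xi>)" using l le[OF x] by simp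
        also have "\<dots> = b - inner ((1 - l) *\<^sub>R x + l *\<^sub>R y) \<xi>" by (simp add: inner_add_left algebra_simps)
        finally show ?thesis .
      qed
      ultimately show "(1 - l) *\<^sub>R x + l *\<^sub>R y \<in> ?A (5 * b)" by simp
    qed
    with one have "?V powr (1 - l) * ?W powr l \<le> ?V / 5" by simp
    \<comment> \<open>Multiplication by |K|^l completes the power of |K|; after cancelling |K|, the
      k-th power gives the claim because l k = 1.\<close>
    then have "?V powr l * (?V powr (1 - l) * ?W powr l) \<le> ?V powr l * (?V / 5)" by (intro mult_left_mono) auto
    moreover have "?V powr l * (?V powr (1 - l) * ?W powr l) = ?V * ?W powr l"
      using V by (simp add: mult.assoc[symmetric] flip: powr_add)
    moreover have "?V powr l * (?V / 5) = ?V * (?V powr l / 5)" by simp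
    ultimately have "?V * ?W powr l \<le> ?V * (?V powr l / 5)" by (simp only:)
    then have W: "?W powr l \<le> ?V powr l / 5" by (rule mult_left_le_imp_le[OF _ V])
    have "(?W powr l) ^ k \<le> (?V powr l / 5) ^ k" using W by (intro power_mono) auto
    moreover have "(v powr l) ^ k = v" if "v \<ge> 0" for v :: real
      using that 3 by (cases "v = 0") (auto simp: l_def powr_powr simp flip: powr_realpow)
    ultimately show ?thesis using V by (simp add: power_divide)
  qed
qed

text \<open>The square of b - <x, xi> is summed over the tails: 25 b^2 times the bound 10 / 3 gives
  250 / 3 <= 84. Passing to the moment about 0 only subtracts b^2 |K|, since b - <x, xi> has mean
  b.\<close>

lemma second_moment_le:
  assumes K: "body K" and b: "b > 0" and le: "\<And>x. x \<in> K \<Longrightarrow> inner x \<xi> \<le> b"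
    and cent: "(LINT x:K|lborel_on E. inner x \<xi>) = 0"
  shows "(LINT x:K|lborel_on E. (inner x \<xi>)\<^sup>2) \<le> 84 * b\<^sup>2 * vol E K"
proof -
  let ?V = "vol E K" and ?Y = "\<lambda>x. b - inner x \<xi>"
  let ?A = "\<lambda>k::nat. {x\<in>K. 5 * b * real k \<le> ?Y x}"
  note k = bodyD[OF K]
  note [measurable] = k(4)
  have A: "?A k \<in> sets borel" "bounded (?A k)" for k
    using k(5) by (measurable, auto intro: bounded_subset)
  have int: "set_integrable (lborel_on E) K g" if "continuous_on UNIV g" for g :: "'a \<Rightarrow> real"
    using K that by (rule set_integrable_body)
  have "compact (?Y ` K)" using k(2) by (intro compact_continuous_image continuous_intros)
  then obtain B where B: "\<And>x. x \<in> K \<Longrightarrow> \<bar>?Y x\<bar> \<le> B" using compact_imp_bounded by (fastforce simp: bounded_iff)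
  \<comment> \<open>Only finitely many tails are nonempty because K is bounded, so finite sums
    suffice.\<close>
  obtain N where N: "B / (5 * b) < real N" using reals_Archimedean2 by blast
  have "(LINT x:K|lborel_on E. (?Y x)\<^sup>2) = (LINT x|lborel_on E. indicator K x *\<^sub>R (?Y x)\<^sup>2)"
    by (simp add: set_lebesgue_integral_def)
  also have "\<dots> \<le> (LINT x|lborel_on E. (\<Sum>k<N. 25 * b\<^sup>2 * (2 * real k + 1) * indicator (?A k) x))"
  proof (rule integral_mono)
    show "integrable (lborel_on E) (\<lambda>x. indicator K x *\<^sub>R (?Y x)\<^sup>2)"
      by (rule int[of "\<lambda>x. (?Y x)\<^sup>2", unfolded set_integrable_def]) (intro continuous_intros)
    show "integrable (lborel_on E) (\<lambda>x. (\<Sum>k<N. 25 * b\<^sup>2 * (2 * real k + 1) * indicator (?A k) x) :: real)"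
      using A emeasure_bounded[OF A(2)]
      by (intro Bochner_Integration.integrable_sum integrable_mult_right integrable_real_indicator) auto
    show "indicator K x *\<^sub>R (?Y x)\<^sup>2 \<le> (\<Sum>k<N. 25 * b\<^sup>2 * (2 * real k + 1) * indicator (?A k) x)" for x
    proof (cases "x \<in> K")
      case True
      have y: "0 \<le> ?Y x / (5 * b)" "?Y x / (5 * b) < real N"
        using le[OF True] b N B[OF True] by (auto intro: le_less_trans[OF divide_right_mono])
      have "(?Y x)\<^sup>2 = 25 * b\<^sup>2 * (?Y x / (5 * b))\<^sup>2" using b by (simp add: power_divide power_mult_distrib)
      also have "\<dots> \<le> 25 * b\<^sup>2 * (\<Sum>k<N. (2 * real k + 1) * (if real k \<le> ?Y x / (5 * b) then 1 else 0))"
        by (intro mult_left_mono square_le_sum_odd y) simp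
      also have "\<dots> = (\<Sum>k<N. 25 * b\<^sup>2 * (2 * real k + 1) * indicator (?A k) x)"
        unfolding sum_distrib_left using True b
        by (intro sum.cong) (auto simp: indicator_def field_simps)
      finally show ?thesis using True by simp
    next
      case False
      then show ?thesis by (simp add: sum_nonneg)
    qed
  qed
  also have "\<dots> = (\<Sum>k<N. 25 * b\<^sup>2 * (2 * real k + 1) * vol E (?A k))"
    using A emeasure_bounded[OF A(2)]
    by (subst Bochner_Integration.integral_sum) (auto simp: vol_def intro!: integrable_mult_right integrable_real_indicator)
  also have "\<dots> \<le> (\<Sum>k<N. 25 * b\<^sup>2 * (2 * real k + 1) * (?V / 5 ^ k))"
    by (intro sum_mono mult_left_mono vol_tail[OF K b le cent]) auto
  also have "\<dots> = 25 * b\<^sup>2 * ?V * (\<Sum>k<N. (2 * real k + 1) / 5 ^ k)"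
    by (simp add: sum_distrib_left mult_ac)
  also have "\<dots> \<le> 25 * b\<^sup>2 * ?V * (10 / 3)"
    by (intro mult_left_mono sum_odd_geometric_le) simp
  also have "\<dots> \<le> 84 * b\<^sup>2 * ?V" by simp
  finally have Y: "(LINT x:K|lborel_on E. (?Y x)\<^sup>2) \<le> 84 * b\<^sup>2 * ?V" .
  have "(LINT x:K|lborel_on E. (inner x \<xi>)\<^sup>2) = (LINT x:K|lborel_on E. (?Y x)\<^sup>2 - b\<^sup>2 + 2 * b * inner x \<xi>)"
    by (simp add: power2_diff)
  also have "\<dots> = (LINT x:K|lborel_on E. (?Y x)\<^sup>2) - b\<^sup>2 * ?V + 2 * b * (LINT x:K|lborel_on E. inner x \<xi>)"
    using int[of "\<lambda>x. (?Y x)\<^sup>2"] int[of "\<lambda>_. b\<^sup>2"] int[of "\<lambda>x. 2 * b * inner x \<xi>"] int[of "\<lambda>x. (?Y x)\<^sup>2 - b\<^sup>2"]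
    by (simp add: set_integral_add set_integral_diff set_integral_const_body[OF K] continuous_intros)
  also have "\<dots> \<le> 84 * b\<^sup>2 * ?V"
  proof -
    have "0 \<le> b\<^sup>2 * ?V" "2 * b * (LINT x:K|lborel_on E. inner x \<xi>) = 0" using cent by simp_all
    with Y show ?thesis by linarith
  qed
  finally show ?thesis .
qed

text \<open>Summing the moments over an orthonormal basis gives the integral of |x|^2, and at least
  half of K lies outside a centred ball of at most half its volume.\<close>

lemma second_moment_ge:
  assumes K: "body K" and n: "dim E \<ge> 1"
    and iso: "\<And>\<xi>. \<xi> \<in> E \<Longrightarrow> norm \<xi> = 1 \<Longrightarrow> (LINT x:K|lborel_on E. (inner x \<xi>)\<^sup>2) = Q"
  shows "vol E K * (vol E K powr (1 / dim E))\<^sup>2 / 288 \<le> Q"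
proof -
  let ?n = "dim E" and ?V = "vol E K"
  let ?v = "?V powr (1 / ?n)"
  \<comment> \<open>As |B| <= (2 e / sqrt n)^n, a ball of this radius has volume at most (e / 6)^n
    |K| <= |K| / 2. The constant 288 is twice the square of 12.\<close>
  define \<rho> where "\<rho> = ?v * sqrt ?n / 12"
  note k = bodyD[OF K]
  note [measurable] = k(4)
  have V: "?V > 0" by (rule vol_body_pos[OF K])
  have v: "?v > 0" "?v ^ ?n = ?V" using V n by (auto simp: powr_powr simp flip: powr_realpow)
  have np: "real ?n > 0" using n by simp
  have \<rho>: "\<rho> > 0" using v np by (simp add: \<rho>_def)
  have "vol E (cball 0 \<rho>) \<le> \<rho> ^ ?n * (2 * exp 1 / sqrt ?n) ^ ?n"
    unfolding vol_cball[OF \<rho>] using \<rho> by (intro mult_left_mono vol_unit_ball n) auto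
  also have "\<dots> = (?v * (exp 1 / 6)) ^ ?n"
    unfolding power_mult_distrib[symmetric] using np by (simp add: \<rho>_def mult.commute)
  also have "\<dots> = ?V * (exp 1 / 6) ^ ?n" by (simp only: power_mult_distrib v)
  also have "\<dots> \<le> ?V * (1 / 2) ^ 1"
  proof (intro mult_left_mono)
    have "(exp 1 / 6 :: real) ^ ?n \<le> (1 / 2) ^ ?n" using exp_le by (intro power_mono) auto
    also have "\<dots> \<le> (1 / 2) ^ 1" using n by (intro power_decreasing) auto
    finally show "(exp 1 / 6 :: real) ^ ?n \<le> (1 / 2) ^ 1" .
  qed (use V in simp)
  finally have ball: "vol E (cball 0 \<rho>) \<le> ?V / 2" by simp
  have int: "set_integrable (lborel_on E) K g" if "continuous_on UNIV g" for g :: "'a \<Rightarrow> real"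
    using K that by (rule set_integrable_body)
  have "\<rho>\<^sup>2 * (?V / 2) \<le> \<rho>\<^sup>2 * (?V - vol E (cball 0 \<rho>))"
    using ball by (intro mult_left_mono) auto
  also have "\<dots> = (LINT x|lborel_on E. \<rho>\<^sup>2 * (indicator K x - indicator (cball 0 \<rho>) x))"
    using emeasure_bounded[OF k(5)] emeasure_cball_finite[of \<rho>] k(4)
    by (simp add: vol_def Bochner_Integration.integral_diff)
  also have "\<dots> \<le> (LINT x|lborel_on E. indicator K x *\<^sub>R (norm x)\<^sup>2)"
  proof (rule integral_mono)
    show "integrable (lborel_on E) (\<lambda>x. \<rho>\<^sup>2 * (indicator K x - indicator (cball 0 \<rho>) x) :: real)"
      using emeasure_bounded[OF k(5)] emeasure_cball_finite[of \<rho>] k(4)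
      by (intro integrable_mult_right Bochner_Integration.integrable_diff integrable_real_indicator) auto
    show "integrable (lborel_on E) (\<lambda>x. indicator K x *\<^sub>R (norm x)\<^sup>2)"
      by (rule int[of "\<lambda>x. (norm x)\<^sup>2", unfolded set_integrable_def]) (intro continuous_intros)
    show "\<rho>\<^sup>2 * (indicator K x - indicator (cball 0 \<rho>) x) \<le> indicator K x *\<^sub>R (norm x)\<^sup>2" for x
    proof (cases "norm x \<le> \<rho>")
      case False
      then have "\<rho>\<^sup>2 \<le> (norm x)\<^sup>2" using \<rho> by (intro power_mono) auto
      then show ?thesis using False by (cases "x \<in> K") auto
    qed (cases "x \<in> K", auto)
  qed
  also have "\<dots> = (LINT x|lborel_on E. (\<Sum>i<?n. indicator K x *\<^sub>R (inner x (onb E i))\<^sup>2))"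
  proof (rule integral_cong_AE)
    show "AE x in lborel_on E. indicator K x *\<^sub>R (norm x)\<^sup>2 = (\<Sum>i<?n. indicator K x *\<^sub>R (inner x (onb E i))\<^sup>2)"
      using AE_E by eventually_elim (simp add: onb_norm_expand[OF is_onb_E] flip: sum_distrib_left)
  qed measurable
  also have "\<dots> = (\<Sum>i<?n. (LINT x:K|lborel_on E. (inner x (onb E i))\<^sup>2))"
    unfolding set_lebesgue_integral_def
    by (intro Bochner_Integration.integral_sum int[unfolded set_integrable_def] continuous_intros)
  also have "\<dots> = (\<Sum>i<?n. Q)"
    by (intro sum.cong refl iso onb_mem[OF is_onb_E] onb_norm[OF is_onb_E]) auto
  also have "\<dots> = ?n * Q" by simp
  also have "\<rho>\<^sup>2 * (?V / 2) = ?n * (?V * ?v\<^sup>2 / 288)"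
    using np by (simp add: \<rho>_def power_divide power_mult_distrib)
  finally show ?thesis by (rule mult_left_le_imp_le[OF _ np])
qed

text \<open>A point u outside K gives a unit normal xi with <x, xi> <= |u| on K. With v = |K|^(1/n),
  the second moment along xi would be at most 84 |K| v^2 / 160^2 and at least |K| v^2 / 288, which
  is impossible as 84 * 288 < 160^2.\<close>

theorem isotropic_contains_ball:
  assumes K: "body K" and n: "dim E \<ge> 1"
    and cent: "\<And>\<xi>. \<xi> \<in> E \<Longrightarrow> (LINT x:K|lborel_on E. inner x \<xi>) = 0"
    and iso: "\<And>\<xi>. \<xi> \<in> E \<Longrightarrow> norm \<xi> = 1 \<Longrightarrow> (LINT x:K|lborel_on E. (inner x \<xi>)\<^sup>2) = Q"
    and u: "u \<in> E" "norm u \<le> vol E K powr (1 / dim E) / 160"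
  shows "u \<in> K"
proof (rule ccontr)
  assume "u \<notin> K"
  let ?V = "vol E K" and ?v = "vol E K powr (1 / dim E)"
  have V: "?V > 0" by (rule vol_body_pos[OF K])
  have v: "?v > 0" using V by simp
  obtain p w where pw: "\<And>x. p x \<in> K" "\<And>x. x = p x + infdist x K *\<^sub>R w x"
    "\<And>x. x \<in> E \<Longrightarrow> x \<notin> K \<Longrightarrow> w x \<in> E \<and> norm (w x) = 1"
    "\<And>x z. z \<in> K \<Longrightarrow> inner (w x) (z - p x) \<le> 0"
    using outer_normal[OF K] by blast
  let ?\<xi> = "w u"
  have \<xi>: "?\<xi> \<in> E" "norm ?\<xi> = 1" using pw(3)[OF u(1) \<open>u \<notin> K\<close>] by auto
  have le: "inner x ?\<xi> \<le> ?v / 160" if "x \<in> K" for x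
  proof -
    have "inner x ?\<xi> \<le> inner (p u) ?\<xi>"
      using pw(4)[OF that, of u] by (simp add: inner_diff_right inner_commute)
    also have "\<dots> \<le> inner (p u + infdist u K *\<^sub>R ?\<xi>) ?\<xi>"
      by (simp add: inner_add_left infdist_nonneg)
    also have "\<dots> = inner u ?\<xi>" by (simp flip: pw(2))
    also have "\<dots> \<le> norm u" using norm_cauchy_schwarz[of u ?\<xi>] \<xi> by simp
    finally show ?thesis using u by simp
  qed
  have "?V * ?v\<^sup>2 / 288 \<le> Q" by (rule second_moment_ge[OF K n iso])
  also have "Q = (LINT x:K|lborel_on E. (inner x ?\<xi>)\<^sup>2)" by (rule iso[OF \<xi>, symmetric])
  also have "\<dots> \<le> 84 * (?v / 160)\<^sup>2 * ?V"
    using v le by (intro second_moment_le K cent \<xi>) auto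
  finally have "?V * ?v\<^sup>2 * (1 / 288) \<le> ?V * ?v\<^sup>2 * (84 / 25600)" by (simp add: power_divide)
  moreover have "?V * ?v\<^sup>2 > 0" using V v by simp
  ultimately show False by simp
qed

lemma projection_bound:
  assumes K: "body K" and n: "dim E \<ge> 1" and C: "C > 0"
    and S: "surface_area E K \<le> C * dim E * vol E K / vol E K powr (1 / dim E)"
  shows "vol E K powr (1 / dim E) * (LINT \<xi>|unit_sphere. surface_area (perp E \<xi>) (perp_proj \<xi> ` K))
    \<le> C * sqrt (dim E) * surface_area E K"
proof -
  let ?n = "real (dim E)" and ?V = "vol E K" and ?v = "vol E K powr (1 / dim E)" and ?S = "surface_area E K"
  have V: "?V > 0" by (rule vol_body_pos[OF K])
  have v: "?v > 0" using V by simp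
  have np: "?n > 0" using n by simp
  have S0: "?S \<ge> 0" using K surface_area_nonneg[OF K] by (auto elim!: body_ballE)
  have "(LINT \<xi>|unit_sphere. surface_area (perp E \<xi>) (perp_proj \<xi> ` K)) \<le> half_width * ?S\<^sup>2 / ?V"
    by (rule average_surface_area_projections[OF n K])
  also have "\<dots> \<le> 1 / sqrt ?n * ?S\<^sup>2 / ?V"
    using V by (intro divide_right_mono mult_right_mono half_width_le n) auto
  finally have "?v * (LINT \<xi>|unit_sphere. surface_area (perp E \<xi>) (perp_proj \<xi> ` K)) \<le> ?v * (1 / sqrt ?n * ?S\<^sup>2 / ?V)"
    using v by (intro mult_left_mono) auto
  also have "\<dots> = ?v / (sqrt ?n * ?V) * ?S * ?S" by (simp add: power2_eq_square)
  also have "\<dots> \<le> ?v / (sqrt ?n * ?V) * ?S * (C * ?n * ?V / ?v)"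
    using S v V np S0 by (intro mult_left_mono) auto
  also have "\<dots> = C * (?n / sqrt ?n) * ?S" using v V np by simp
  also have "?n / sqrt ?n = sqrt ?n" using np by (simp add: real_div_sqrt)
  finally show ?thesis .
qed

lemma surface_area_ball_bound:
  assumes K: "body K" and c: "c > 0" and x: "x \<in> K"
    and ball: "\<And>u. u \<in> E \<Longrightarrow> norm u \<le> vol E K powr (1 / dim E) / c \<Longrightarrow> x + u \<in> K"
  shows "surface_area E K \<le> c * dim E * vol E K / vol E K powr (1 / dim E)"
proof -
  have "vol E K powr (1 / dim E) / c > 0" using vol_body_pos[OF K] c by simp
  from surface_area_le_inball[OF K this x ball] show ?thesis by (simp add: mult_ac)
qed

end

section \<open>Isotropic images and the four positions\<close>

context fd_subspace
begin

text \<open>Gram-Schmidt for the form q started from the basis e: w k differs from e k by a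
  combination of the earlier w i, so the family stays triangular with respect to e while it becomes
  orthogonal for q.\<close>

lemma gram_schmidt_triangular:
  fixes q :: "'a \<Rightarrow> 'a \<Rightarrow> real"
  assumes e: "is_onb E e"
    and lin: "\<And>y. linear (\<lambda>x. q x y)" and sym: "\<And>x y. q x y = q y x"
    and pos: "\<And>x. x \<in> E \<Longrightarrow> x \<noteq> 0 \<Longrightarrow> q x x > 0"
  obtains w where "\<And>i. i < dim E \<Longrightarrow> w i \<in> E" "\<And>i. i < dim E \<Longrightarrow> inner (w i) (e i) = 1"
    "\<And>i j. i < j \<Longrightarrow> j < dim E \<Longrightarrow> inner (w i) (e j) = 0"
    "\<And>i j. i < dim E \<Longrightarrow> j < dim E \<Longrightarrow> i \<noteq> j \<Longrightarrow> q (w i) (w j) = 0"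
proof -
  have "\<exists>w. (\<forall>i<k. w i \<in> E \<and> inner (w i) (e i) = 1 \<and> (\<forall>j<dim E. i < j \<longrightarrow> inner (w i) (e j) = 0)) \<and>
    (\<forall>i<k. \<forall>j<i. q (w i) (w j) = 0)" if "k \<le> dim E" for k
    using that
  proof (induction k)
    case (Suc k)
    then obtain w where
      "\<forall>i<k. w i \<in> E \<and> inner (w i) (e i) = 1 \<and> (\<forall>j<dim E. i < j \<longrightarrow> inner (w i) (e j) = 0)"
      "\<forall>i<k. \<forall>j<i. q (w i) (w j) = 0" by auto
    then have w: "\<And>i. i < k \<Longrightarrow> w i \<in> E" "\<And>i. i < k \<Longrightarrow> inner (w i) (e i) = 1"
      "\<And>i j. i < k \<Longrightarrow> j < dim E \<Longrightarrow> i < j \<Longrightarrow> inner (w i) (e j) = 0"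
      "\<And>i j. i < k \<Longrightarrow> j < i \<Longrightarrow> q (w i) (w j) = 0"
      by blast+
    have k: "k < dim E" using Suc.prems by simp
    define v where "v = e k - (\<Sum>i<k. (q (e k) (w i) / q (w i) (w i)) *\<^sub>R w i)"
    have wq: "q (w i) (w j) = 0" if "i < k" "j < k" "i \<noteq> j" for i j
      using w(4)[of i j] w(4)[of j i] that sym[of "w i" "w j"] by (cases "i < j") auto
    have "v \<in> E"
      unfolding v_def using w(1) onb_mem[OF e k] by (intro subspace_diff subspace subspace_sum subspace_scale) auto
    moreover have "inner v (e j) = (if j = k then 1 else 0)" if "k \<le> j" "j < dim E" for j
    proof -
      have "inner (\<Sum>i<k. (q (e k) (w i) / q (w i) (w i)) *\<^sub>R w i) (e j) = 0"
        unfolding inner_sum_left using w(3) that by (intro sum.neutral) auto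
      then show ?thesis using that k by (simp add: v_def inner_diff_left onb_inner[OF e])
    qed
    moreover have "q v (w j) = 0" if j: "j < k" for j
    proof -
      have "w j \<noteq> 0" using w(2)[OF j] by auto
      then have "q (w j) (w j) > 0" using pos w(1)[OF j] by blast
      have "q v (w j) = q (e k) (w j) - (\<Sum>i<k. q (e k) (w i) / q (w i) (w i) * q (w i) (w j))"
        unfolding v_def by (simp add: linear_diff[OF lin] linear_sum[OF lin] linear_scale[OF lin])
      also have "(\<Sum>i<k. q (e k) (w i) / q (w i) (w i) * q (w i) (w j)) = (\<Sum>i<k. if i = j then q (e k) (w j) else 0)"
        using wq j \<open>q (w j) (w j) > 0\<close> by (intro sum.cong) auto
      also have "\<dots> = q (e k) (w j)" using j by simp
      finally show ?thesis by simp
    qed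
    ultimately show ?case
      using w k by (intro exI[of _ "w(k := v)"]) (auto simp: less_Suc_eq)
  qed auto
  then obtain w where w: "\<forall>i<dim E. w i \<in> E \<and> inner (w i) (e i) = 1 \<and> (\<forall>j<dim E. i < j \<longrightarrow> inner (w i) (e j) = 0)"
    "\<forall>i<dim E. \<forall>j<i. q (w i) (w j) = 0" by blast
  show thesis
  proof (rule that[of w])
    show "q (w i) (w j) = 0" if "i < dim E" "j < dim E" "i \<noteq> j" for i j
      using w(2) that sym[of "w i" "w j"] by (cases "i < j") auto
  qed (use w in auto)
qed

text \<open>Change of variables for a volume preserving map. T is injective on E only, so the
  indicators of the image at T x and of A at x agree for x in E, that is, almost everywhere.\<close>

lemma
  fixes T :: "'a \<Rightarrow> 'a"
  assumes T: "T \<in> borel_measurable borel" "distr (lborel_on E) borel T = lborel_on E" "inj_on T E"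
    and A: "A \<subseteq> E" "compact A" "compact (T ` A)"
  shows set_integral_image: "g \<in> borel_measurable borel \<Longrightarrow> (LINT x:T ` A|lborel_on E. g x) = (LINT x:A|lborel_on E. g (T x) :: real)"
    and vol_image: "vol E (T ` A) = vol E A"
proof -
  note [measurable] = T(1)
  have [measurable]: "A \<in> sets borel" "T ` A \<in> sets borel" using A by (auto simp: compact_imp_closed)
  have int: "(LINT x:T ` A|lborel_on E. g x) = (LINT x:A|lborel_on E. g (T x))"
    if [measurable]: "g \<in> borel_measurable borel" for g :: "'a \<Rightarrow> real"
  proof -
    have "(LINT x:T ` A|lborel_on E. g x) = (LINT x|distr (lborel_on E) borel T. indicator (T ` A) x *\<^sub>R g x)"
      by (simp add: T(2) set_lebesgue_integral_def)
    also have "\<dots> = (LINT x|lborel_on E. indicator (T ` A) (T x) *\<^sub>R g (T x))"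
      by (rule integral_distr) measurable
    also have "\<dots> = (LINT x|lborel_on E. indicator A x *\<^sub>R g (T x))"
    proof (rule integral_cong_AE)
      show "AE x in lborel_on E. indicator (T ` A) (T x) *\<^sub>R g (T x) = indicator A x *\<^sub>R g (T x)"
        using AE_E
      proof eventually_elim
        case (elim x)
        have "T x \<in> T ` A \<longleftrightarrow> x \<in> A" using T(3) elim A(1) by (rule inj_on_image_mem_iff)
        then show ?case by (simp add: indicator_def)
      qed
    qed measurable
    finally show ?thesis by (simp add: set_lebesgue_integral_def)
  qed
  then show "g \<in> borel_measurable borel \<Longrightarrow> (LINT x:T ` A|lborel_on E. g x) = (LINT x:A|lborel_on E. g (T x))" .
  show "vol E (T ` A) = vol E A"
    using int[of "\<lambda>_. 1"] by (simp add: set_lebesgue_integral_def vol_def)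
qed

lemma body_image:
  assumes K: "body K" and T: "continuous_on UNIV T" "T ` K \<subseteq> E" "convex (T ` K)"
    and r: "r > 0" and x: "x \<in> T ` K" "\<And>u. u \<in> E \<Longrightarrow> norm u \<le> r \<Longrightarrow> x + u \<in> T ` K"
  shows "body (T ` K)"
  unfolding body_def
proof (intro conjI T)
  show "compact (T ` K)"
    using T(1) by (intro compact_continuous_image bodyD[OF K]) (auto intro: continuous_on_subset)
  show "\<exists>x\<in>T ` K. \<exists>r>0. \<forall>u\<in>E. norm u \<le> r \<longrightarrow> x + u \<in> T ` K"
    using r x by blast
qed

lemma body_translate:
  assumes K: "body K" and a: "a \<in> E"
  shows "body ((+) a ` K)"
proof -
  obtain x r where xr: "x \<in> K" "r > 0" "\<And>u. u \<in> E \<Longrightarrow> norm u \<le> r \<Longrightarrow> x + u \<in> K"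
    using K by (elim body_ballE) blast
  have "(+) a ` K \<subseteq> E" using bodyD(1)[OF K] a by (auto intro!: subspace_add subspace)
  then show ?thesis
    using xr bodyD(3)[OF K]
    by (intro body_image[OF K, of _ r "a + x"]) (auto intro!: continuous_intros convex_translation simp: add.assoc)
qed

text \<open>The barycenter is assembled from the scalar integrals of the coordinates, and centering
  is verified by expanding xi in the same basis.\<close>

lemma barycenter_exists:
  assumes K: "body K"
  obtains a where "a \<in> E" "\<And>\<xi>. \<xi> \<in> E \<Longrightarrow> (LINT x:(+) (- a) ` K|lborel_on E. inner x \<xi>) = 0"
proof -
  let ?e = "onb E" and ?V = "vol E K"
  note e = is_onb_E
  have V: "?V > 0" by (rule vol_body_pos[OF K])
  define a where "a = (\<Sum>i<dim E. ((LINT x:K|lborel_on E. inner x (?e i)) / ?V) *\<^sub>R ?e i)"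
  have a: "a \<in> E" unfolding a_def by (rule onb_comb_mem[OF e])
  have na: "- a \<in> E" using a subspace_neg[OF subspace] by blast
  have int: "set_integrable (lborel_on E) K g" if "continuous_on UNIV g" for g :: "'a \<Rightarrow> real"
    using K that by (rule set_integrable_body)
  have "(LINT x:(+) (- a) ` K|lborel_on E. inner x \<xi>) = 0" if \<xi>: "\<xi> \<in> E" for \<xi>
  proof -
    have "(LINT x:(+) (- a) ` K|lborel_on E. inner x \<xi>) = (LINT x:K|lborel_on E. inner (- a + x) \<xi>)"
      using bodyD[OF K] by (intro set_integral_image lborel_on_translate na compact_translation) auto
    also have "\<dots> = (LINT x:K|lborel_on E. inner x \<xi> - inner a \<xi>)" by (simp add: inner_diff_left)
    also have "\<dots> = (LINT x:K|lborel_on E. inner x \<xi>) - (LINT x:K|lborel_on E. inner a \<xi>)"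
      by (intro set_integral_diff int continuous_intros)
    also have "(LINT x:K|lborel_on E. inner a \<xi>) = inner a \<xi> * ?V" by (rule set_integral_const_body[OF K])
    also have "inner a \<xi> * ?V = (\<Sum>i<dim E. (LINT x:K|lborel_on E. inner x (?e i)) * inner \<xi> (?e i))"
      using V unfolding onb_inner_expand[OF e a, of \<xi>]
      unfolding sum_distrib_right by (intro sum.cong refl) (simp add: a_def onb_comb_inner[OF e])
    also have "(LINT x:K|lborel_on E. inner x \<xi>) = (LINT x|lborel_on E. (\<Sum>i<dim E. indicator K x *\<^sub>R (inner x (?e i) * inner \<xi> (?e i))))"
      unfolding set_lebesgue_integral_def
    proof (rule integral_cong_AE)
      show "AE x in lborel_on E. indicator K x *\<^sub>R inner x \<xi> = (\<Sum>i<dim E. indicator K x *\<^sub>R (inner x (?e i) * inner \<xi> (?e i)))"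
        using AE_E
      proof eventually_elim
        case (elim x)
        show ?case using onb_inner_expand[OF e elim, of \<xi>] by (simp add: sum_distrib_left)
      qed
    qed (use bodyD(4)[OF K] in measurable)
    also have "\<dots> = (\<Sum>i<dim E. (LINT x:K|lborel_on E. inner x (?e i) * inner \<xi> (?e i)))"
      unfolding set_lebesgue_integral_def
      by (intro Bochner_Integration.integral_sum int[unfolded set_integrable_def] continuous_intros)
    also have "\<dots> = (\<Sum>i<dim E. (LINT x:K|lborel_on E. inner x (?e i)) * inner \<xi> (?e i))" by simp
    finally show ?thesis by simp
  qed
  with a show thesis by (rule that)
qed

text \<open>A small ball inside L stays away from the hyperplane orthogonal to x, so <y, x>^2 is
  bounded below on a set of positive volume.\<close>

lemma second_moment_pos:
  assumes L: "body L" and x: "x \<in> E" "x \<noteq> 0"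
  shows "(LINT y:L|lborel_on E. inner y x * inner y x) > 0"
proof -
  obtain z \<rho> where z: "z \<in> L" "\<rho> > 0" "\<And>u. u \<in> E \<Longrightarrow> norm u \<le> \<rho> \<Longrightarrow> z + u \<in> L"
    using L by (elim body_ballE) blast
  \<comment> \<open>The sign makes the shift by \<open>\<rho>\<close> / 2 along x lead away from the
    hyperplane, so |<c, x>| >= \<open>\<rho>\<close> |x| / 2. A ball of radius \<open>\<rho>\<close>
    / 4 around c then loses at most half of this and stays within 3 \<open>\<rho>\<close> / 4 of
    z.\<close>
  define \<sigma> :: real where "\<sigma> = (if inner z x \<ge> 0 then 1 else - 1)"
  define c where "c = z + (\<sigma> * \<rho> / (2 * norm x)) *\<^sub>R x"
  have nx: "norm x > 0" using x by simp
  have cE: "c \<in> E" unfolding c_def using bodyD(1)[OF L] z(1) x by (intro subspace_add subspace_scale subspace) auto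
  let ?B = "(+) c ` (E \<inter> cball 0 (\<rho> / 4))"
  have B: "compact ?B" by (intro compact_translation compact_E_cball)
  have "vol E ?B = vol E (cball 0 (\<rho> / 4))"
    using compact_E_cball[of "\<rho> / 4"] by (subst vol_translate[OF cE]) (auto simp: vol_E_Int compact_imp_closed compact_imp_bounded)
  also have "\<dots> > 0" using emeasure_cball_pos[of "\<rho> / 4"] z(2) by (simp add: emeasure_eq_vol)
  finally have volB: "vol E ?B > 0" .
  have BL: "y \<in> L \<and> (\<rho> * norm x / 4)\<^sup>2 \<le> inner y x * inner y x" if "y \<in> ?B" for y
  proof -
    from that obtain v where "y = c + v" "v \<in> E \<inter> cball 0 (\<rho> / 4)" by blast
    then have v: "y = c + v" "v \<in> E" "norm v \<le> \<rho> / 4" by auto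
    let ?u = "(\<sigma> * \<rho> / (2 * norm x)) *\<^sub>R x + v"
    have "\<bar>\<sigma>\<bar> = 1" by (simp add: \<sigma>_def)
    then have "norm ((\<sigma> * \<rho> / (2 * norm x)) *\<^sub>R x) = \<rho> / 2" using nx z(2) by (simp add: abs_mult)
    then have "norm ?u \<le> \<rho> / 2 + \<rho> / 4"
      using norm_triangle_ineq[of "(\<sigma> * \<rho> / (2 * norm x)) *\<^sub>R x" v] v by linarith
    then have "z + ?u \<in> L" using z v x by (intro z(3) subspace_add subspace_scale subspace) auto
    then have yL: "y \<in> L" by (simp add: v c_def add.assoc)
    have "inner c x = inner z x + \<sigma> * (\<rho> * norm x / 2)"
      using nx by (simp add: c_def inner_add_left power2_norm_eq_inner[symmetric] power2_eq_square)
    then have "\<bar>inner c x\<bar> \<ge> \<rho> * norm x / 2"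
    proof (cases "inner z x \<ge> 0")
      case True
      then have "\<sigma> = 1" by (simp add: \<sigma>_def)
      with \<open>inner c x = _\<close> have "inner c x = inner z x + \<rho> * norm x / 2" by simp
      then show ?thesis using True mult_pos_pos[OF z(2) nx] by linarith
    next
      case False
      then have "\<sigma> = - 1" by (simp add: \<sigma>_def)
      with \<open>inner c x = _\<close> have "inner c x = inner z x - \<rho> * norm x / 2" by simp
      then show ?thesis using False mult_pos_pos[OF z(2) nx] by linarith
    qed
    moreover have "\<bar>inner v x\<bar> \<le> \<rho> / 4 * norm x"
      using Cauchy_Schwarz_ineq2[of v x] v(3) nx mult_right_mono[of "norm v" "\<rho> / 4" "norm x"] by linarith
    ultimately have "\<bar>\<rho> * norm x / 4\<bar> \<le> \<bar>inner y x\<bar>"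
      using nx z(2) unfolding v inner_add_left by (simp add: abs_if split: if_splits)
    then have "(\<rho> * norm x / 4)\<^sup>2 \<le> (inner y x)\<^sup>2" by (simp only: abs_le_square_iff)
    then show ?thesis using yL by (simp add: power2_eq_square)
  qed
  have "0 < (\<rho> * norm x / 4)\<^sup>2 * vol E ?B" using z(2) nx volB by simp
  also have "\<dots> = (LINT y|lborel_on E. (\<rho> * norm x / 4)\<^sup>2 * indicator ?B y)"
    using B by (simp add: vol_def compact_imp_closed)
  also have "\<dots> \<le> (LINT y|lborel_on E. indicator L y *\<^sub>R (inner y x * inner y x))"
  proof (rule integral_mono)
    show "integrable (lborel_on E) (\<lambda>y. (\<rho> * norm x / 4)\<^sup>2 * indicator ?B y :: real)"
      using B emeasure_bounded[of ?B]
      by (intro integrable_mult_right integrable_real_indicator) (auto simp: compact_imp_closed compact_imp_bounded)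
    show "integrable (lborel_on E) (\<lambda>y. indicator L y *\<^sub>R (inner y x * inner y x))"
      by (rule set_integrable_body[OF L, unfolded set_integrable_def]) (intro continuous_intros)
    show "(\<rho> * norm x / 4)\<^sup>2 * indicator ?B y \<le> indicator L y *\<^sub>R (inner y x * inner y x)" for y
      using BL[of y] by (cases "y \<in> ?B"; cases "y \<in> L") (auto simp del: mem_cball)
  qed
  finally show ?thesis by (simp add: set_lebesgue_integral_def)
qed

text \<open>Up to scale T is a triangular factor of the inverse of the moment form q, obtained by
  Gram-Schmidt; for a triangular map both the determinant and the change of volume are products of
  diagonal entries. The point a is the barycenter of K. The inverse S is returned because a ball has
  to be pulled back to an ellipsoid in K.\<close>

theorem isotropic_image:
  assumes K: "body K" and n: "dim E \<ge> 1"
  obtains T S a where "linear T" "continuous_on UNIV T" "inj_on T E" "\<And>x. T x \<in> E" "det_on E T = 1"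
    "distr (lborel_on E) borel T = lborel_on E" "linear S" "S ` E = E" "\<And>x. x \<in> E \<Longrightarrow> S (T x) = x" "\<And>x. x \<in> E \<Longrightarrow> T (S x) = x" "a \<in> E"
    "\<And>u. u \<in> E \<Longrightarrow> norm u \<le> vol E K powr (1 / dim E) / 160 \<Longrightarrow> \<exists>x\<in>K. u = T (- a + x)"
proof -
  let ?e = "onb E" and ?n = "dim E"
  note e = is_onb_E
  obtain a where a: "a \<in> E" "\<And>\<xi>. \<xi> \<in> E \<Longrightarrow> (LINT x:(+) (- a) ` K|lborel_on E. inner x \<xi>) = 0"
    using barycenter_exists[OF K] by blast
  have na: "- a \<in> E" using a subspace_neg[OF subspace] by blast
  define L where "L = (+) (- a) ` K"
  have L: "body L" unfolding L_def by (rule body_translate[OF K na])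
  have volL: "vol E L = vol E K" unfolding L_def by (intro vol_translate na bodyD[OF K])
  have intL: "set_integrable (lborel_on E) L g" if "continuous_on UNIV g" for g :: "'a \<Rightarrow> real"
    using L that by (rule set_integrable_body)
  define q where "q x y = (LINT z:L|lborel_on E. inner z x * inner z y)" for x y
  have q_lin: "linear (\<lambda>x. q x y)" for y
  proof (rule linearI)
    show "q (x + x') y = q x y + q x' y" for x x'
    proof -
      have "q (x + x') y = (LINT z:L|lborel_on E. inner z x * inner z y + inner z x' * inner z y)"
        by (simp add: q_def inner_add_right distrib_right)
      also have "\<dots> = q x y + q x' y" unfolding q_def
        by (intro set_integral_add intL continuous_intros)
      finally show ?thesis .
    qed
    show "q (r *\<^sub>R x) y = r *\<^sub>R q x y" for r x
      by (simp add: q_def mult.assoc)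
  qed
  have q_sym: "q x y = q y x" for x y by (simp add: q_def mult.commute)
  have q_pos: "q x x > 0" if "x \<in> E" "x \<noteq> 0" for x
    unfolding q_def by (rule second_moment_pos[OF L that])
  obtain v where v: "\<And>i. i < ?n \<Longrightarrow> v i \<in> E" "\<And>i. i < ?n \<Longrightarrow> inner (v i) (?e i) = 1"
    "\<And>i j. i < j \<Longrightarrow> j < ?n \<Longrightarrow> inner (v i) (?e j) = 0"
    "\<And>i j. i < ?n \<Longrightarrow> j < ?n \<Longrightarrow> i \<noteq> j \<Longrightarrow> q (v i) (v j) = 0"
    using gram_schmidt_triangular[OF e q_lin q_sym q_pos] by metis
  have qv: "q (v i) (v i) > 0" if "i < ?n" for i
  proof -
    have "v i \<noteq> 0" using v(2)[OF that] by auto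
    then show ?thesis using q_pos v(1)[OF that] by blast
  qed
  define p where "p = (\<Prod>i<?n. sqrt (q (v i) (v i)))"
  \<comment> \<open>Dividing each v i by its q-length equalises the moments; the factor s, the
    geometric mean of these lengths, restores determinant 1. The common moment is s^2.\<close>
  define s where "s = p powr (1 / ?n)"
  have p: "p > 0" unfolding p_def using qv by (intro prod_pos) auto
  have s: "s > 0" "s ^ ?n = p" using p n by (auto simp: s_def powr_powr simp flip: powr_realpow)
  define w where "w i = (s / sqrt (q (v i) (v i))) *\<^sub>R v i" for i
  have wE: "w i \<in> E" if "i < ?n" for i unfolding w_def using v(1)[OF that] by (intro subspace_scale subspace)
  have w_diag: "inner (w i) (?e i) = s / sqrt (q (v i) (v i))" if "i < ?n" for i using v(2)[OF that] by (simp add: w_def)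
  have w_pos: "inner (w i) (?e i) > 0" if "i < ?n" for i using w_diag[OF that] s(1) qv[OF that] by simp
  have w_upper: "inner (w i) (?e j) = 0" if "i < j" "j < ?n" for i j using v(3)[OF that] by (simp add: w_def)
  have w_prod: "(\<Prod>i<?n. inner (w i) (?e i)) = 1"
  proof -
    have "(\<Prod>i<?n. inner (w i) (?e i)) = (\<Prod>i<?n. s / sqrt (q (v i) (v i)))"
      by (intro prod.cong refl w_diag) simp
    also have "\<dots> = s ^ ?n / p" by (simp add: prod_dividef p_def)
    finally show ?thesis using s p by simp
  qed
  have qw: "q (w i) (w j) = (if i = j then s\<^sup>2 else 0)" if "i < ?n" "j < ?n" for i j
  proof -
    have "q (w i) (w j) = s / sqrt (q (v i) (v i)) * (s / sqrt (q (v j) (v j))) * q (v i) (v j)"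
      proof -
      have "q (w i) (w j) = s / sqrt (q (v i) (v i)) * q (v i) (w j)"
        unfolding w_def by (simp only: linear_scale[OF q_lin] real_scaleR_def)
      also have "q (v i) (w j) = q (w j) (v i)" by (rule q_sym)
      also have "q (w j) (v i) = s / sqrt (q (v j) (v j)) * q (v j) (v i)"
        unfolding w_def by (simp only: linear_scale[OF q_lin] real_scaleR_def)
      also have "q (v j) (v i) = q (v i) (v j)" by (rule q_sym)
      finally show ?thesis by (simp only: mult.assoc)
    qed
    then show ?thesis
      using v(4)[OF that] qv[OF that(1)] by (auto simp: power2_eq_square field_simps)
  qed
  define T where "T x = (\<Sum>i<?n. inner x (w i) *\<^sub>R ?e i)" for x
  have T_lin: "linear T"
    unfolding T_def by (rule linearI) (simp_all add: inner_add_left scaleR_add_left sum.distrib scaleR_sum_right)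
  have T_cont: "continuous_on UNIV T" unfolding T_def by (intro continuous_intros)
  have T_meas[measurable]: "T \<in> borel_measurable borel" using T_cont by (rule borel_measurable_continuous_onI)
  have TE: "T x \<in> E" for x unfolding T_def by (rule onb_comb_mem[OF e])
  have T_inner: "inner (T x) (?e i) = inner x (w i)" if "i < ?n" for x i
    unfolding T_def by (rule onb_comb_inner[OF e that])
  \<comment> \<open>Forward substitution: the i-th equation involves only coordinates of index at
    most i.\<close>
  have T_inj0: "x = 0" if x: "x \<in> E" "T x = 0" for x
  proof -
    have xe: "inner x (?e i) = 0" if "i < ?n" for i
      using that
    proof (induction i rule: less_induct)
      case (less i)
      have "0 = inner (w i) x" using T_inner[OF less.prems, of x] x by (simp add: inner_commute)
      also have "\<dots> = (\<Sum>j<?n. inner (w i) (?e j) * inner x (?e j))" by (rule onb_inner_expand[OF e wE[OF less.prems]])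
      also have "\<dots> = (\<Sum>j<?n. if j = i then inner (w i) (?e i) * inner x (?e i) else 0)"
      proof (intro sum.cong refl)
        fix j assume "j \<in> {..<?n}"
        then show "inner (w i) (?e j) * inner x (?e j) = (if j = i then inner (w i) (?e i) * inner x (?e i) else 0)"
          using less.IH[of j] w_upper[of i j] by (cases "j < i"; cases "j = i") auto
      qed
      also have "\<dots> = inner (w i) (?e i) * inner x (?e i)" using less.prems by simp
      finally show ?case using w_pos[OF less.prems] by simp
    qed
    have "x = (\<Sum>i<?n. inner x (?e i) *\<^sub>R ?e i)" by (rule onb_expand[OF e x(1), symmetric])
    also have "\<dots> = 0" using xe by (intro sum.neutral) auto
    finally show ?thesis .
  qed
  have T_inj: "inj_on T E"
  proof (rule inj_onI)
    fix x y assume xy: "x \<in> E" "y \<in> E" "T x = T y"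
    then have "T (x - y) = 0" by (simp add: linear_diff[OF T_lin])
    then have "x - y = 0" by (rule T_inj0[OF subspace_diff[OF subspace xy(1,2)]])
    then show "x = y" by simp
  qed
  have T_distr: "distr (lborel_on E) borel T = lborel_on E"
  proof (rule measure_eqI)
    fix A assume "A \<in> sets (distr (lborel_on E) borel T)"
    then have A[measurable]: "A \<in> sets borel" by simp
    have "emeasure (distr (lborel_on E) borel T) A = emeasure (lborel_on E) {x. T x \<in> A}"
      by (subst emeasure_distr) (auto simp: vimage_def)
    also have "\<dots> = emeasure (lborel_on E) A"
      using emeasure_triangular[OF e wE w_upper w_pos A] by (simp add: w_prod T_def)
    finally show "emeasure (distr (lborel_on E) borel T) A = emeasure (lborel_on E) A" .
  qed simp
  have T_det: "det_on E T = 1"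
  proof -
    let ?M = "Matrix.mat ?n ?n (\<lambda>(i, j). inner (?e i) (T (?e j)))"
    have M: "?M $$ (i, j) = inner (w i) (?e j)" if "i < ?n" "j < ?n" for i j
      using that T_inner[of i "?e j"] by (simp add: inner_commute)
    have "Determinant.det ?M = prod_list (diag_mat ?M)"
    proof (rule det_lower_triangular[of ?n])
      show "?M $$ (i, j) = 0" if "i < j" "j < ?n" for i j
        using M[of i j] w_upper[OF that] that by (simp only: less_trans[OF that])
    qed simp
    also have "\<dots> = (\<Prod>i<?n. ?M $$ (i, i))" by (simp add: prod_list_diag_prod atLeast0LessThan)
    also have "\<dots> = (\<Prod>i<?n. inner (w i) (?e i))" by (intro prod.cong refl M) auto
    also note w_prod
    finally show ?thesis by (simp add: det_on_def)
  qed
  have TL: "compact (T ` L)" using T_cont bodyD[OF L] by (intro compact_continuous_image) (auto intro: continuous_on_subset)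
  note image = set_integral_image[OF T_meas T_distr T_inj bodyD(1,2)[OF L] TL]
  have volTL: "vol E (T ` L) = vol E K"
    using vol_image[OF T_meas T_distr T_inj bodyD(1,2)[OF L] TL] volL by simp
  \<comment> \<open>W is the adjoint of T on \<open>E\<close>: the moment of the image along xi is
    that of L along W xi, and W sends the basis to the vectors w i, which are q-orthogonal of equal
    q-length s.\<close>
  define W where "W \<xi> = (\<Sum>i<?n. inner \<xi> (?e i) *\<^sub>R w i)" for \<xi>
  have WE: "W \<xi> \<in> E" for \<xi> unfolding W_def using wE by (intro subspace_sum subspace_scale subspace) auto
  have TW: "inner (T x) \<xi> = inner x (W \<xi>)" for x \<xi>
    by (simp add: T_def W_def inner_sum_left inner_sum_right inner_commute mult.commute)
  have qW: "q (W \<xi>) (W \<xi>) = s\<^sup>2" if "\<xi> \<in> E" "norm \<xi> = 1" for \<xi>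
  proof -
    have "q (W \<xi>) (W \<xi>) = (\<Sum>i<?n. inner \<xi> (?e i) * q (w i) (W \<xi>))"
      by (subst (1) W_def) (simp add: linear_sum[OF q_lin] linear_scale[OF q_lin])
    also have "\<dots> = (\<Sum>i<?n. inner \<xi> (?e i) * (\<Sum>j<?n. inner \<xi> (?e j) * q (w j) (w i)))"
      by (subst q_sym, subst W_def) (simp add: linear_sum[OF q_lin] linear_scale[OF q_lin])
    also have "\<dots> = (\<Sum>i<?n. inner \<xi> (?e i) * (\<Sum>j<?n. if j = i then inner \<xi> (?e j) * s\<^sup>2 else 0))"
      by (intro sum.cong refl arg_cong2[where f = "(*)"]) (auto simp: qw)
    also have "\<dots> = s\<^sup>2 * (\<Sum>i<?n. (inner \<xi> (?e i))\<^sup>2)"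
      by (simp add: sum_distrib_left power2_eq_square mult_ac)
    also have "(\<Sum>i<?n. (inner \<xi> (?e i))\<^sup>2) = 1" using onb_norm_expand[OF e that(1)] that(2) by simp
    finally show ?thesis by simp
  qed
  obtain z \<rho> where z: "z \<in> L" "\<rho> > 0" "\<And>u. u \<in> E \<Longrightarrow> norm u \<le> \<rho> \<Longrightarrow> z + u \<in> L"
    using L by (elim body_ballE) blast
  \<comment> \<open>Surjectivity by back substitution: T maps the j-th basis vector to a combination
    of those of index at least j, hence the induction on n - j.\<close>
  have T_e: "?e j \<in> T ` E" if "j < ?n" for j
    using that
  proof (induction "?n - j" arbitrary: j rule: less_induct)
    case less
    have sub: "subspace (T ` E)" by (rule linear_subspace_image[OF T_lin subspace])
    let ?R = "\<Sum>i\<in>{Suc j..<?n}. inner (?e j) (w i) *\<^sub>R ?e i"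
    have "T (?e j) = (\<Sum>i\<in>{..<j}. inner (?e j) (w i) *\<^sub>R ?e i) + (inner (?e j) (w j) *\<^sub>R ?e j + ?R)"
    proof -
      have "{..<?n} = {..<j} \<union> insert j {Suc j..<?n}" using less.prems by auto
      then show ?thesis unfolding T_def by (simp add: sum.union_disjoint disjoint_iff)
    qed
    also have "(\<Sum>i\<in>{..<j}. inner (?e j) (w i) *\<^sub>R ?e i) = 0"
      using w_upper less.prems by (intro sum.neutral) (auto simp: inner_commute[of "?e j"])
    finally have eq: "inner (?e j) (w j) *\<^sub>R ?e j = T (?e j) - ?R" by simp
    have "?R \<in> T ` E" using less by (intro subspace_sum sub subspace_scale) auto
    then have "inner (?e j) (w j) *\<^sub>R ?e j \<in> T ` E"
      unfolding eq using onb_mem[OF e less.prems] by (intro subspace_diff sub) auto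
    then have "(1 / inner (?e j) (w j)) *\<^sub>R (inner (?e j) (w j) *\<^sub>R ?e j) \<in> T ` E" by (rule subspace_scale[OF sub])
    then show ?case using w_pos[OF less.prems] by (simp add: inner_commute)
  qed
  then have "\<forall>i<?n. \<exists>y\<in>E. T y = ?e i" by (metis imageE)
  then obtain y where y: "\<And>i. i < ?n \<Longrightarrow> y i \<in> E" "\<And>i. i < ?n \<Longrightarrow> T (y i) = ?e i" by metis
  define S where "S x = (\<Sum>i<?n. inner x (?e i) *\<^sub>R y i)" for x
  have S_lin: "linear S"
    unfolding S_def by (rule linearI) (simp_all add: inner_add_left scaleR_add_left sum.distrib scaleR_sum_right)
  have SE: "S x \<in> E" for x unfolding S_def using y(1) by (intro subspace_sum subspace_scale subspace) auto
  have TS: "T (S x) = x" if "x \<in> E" for x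
  proof -
    have "T (S x) = (\<Sum>i<?n. inner x (?e i) *\<^sub>R ?e i)"
      unfolding S_def by (simp add: linear_sum[OF T_lin] linear_scale[OF T_lin] y(2))
    then show ?thesis by (simp only: onb_expand[OF e that])
  qed
  have ST: "S (T x) = x" if "x \<in> E" for x
    using T_inj TS[OF TE, of x] SE that by (auto dest: inj_onD)
  have S_img: "S ` E = E" using SE ST TE by (metis image_eqI image_subsetI subsetI subset_antisym)
  have TL_body: "body (T ` L)"
  proof (rule body_image[OF L T_cont])
    show "T ` L \<subseteq> E" using TE by blast
    show "convex (T ` L)" by (intro convex_linear_image T_lin bodyD[OF L])
    \<comment> \<open>B bounds the norm of S on \<open>E\<close>, so S maps the ball of radius
      \<open>\<rho>\<close> / B into the one of radius \<open>\<rho>\<close>; the summand 1 keeps B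
      positive.\<close>
    define B where "B = 1 + (\<Sum>i<?n. norm (y i))"
    have B: "B > 0" unfolding B_def by (intro add_pos_nonneg sum_nonneg) auto
    show "\<rho> / B > 0" using z(2) B by simp
    show "T z \<in> T ` L" using z(1) by blast
    fix u assume u: "u \<in> E" "norm u \<le> \<rho> / B"
    have "norm (S u) \<le> (\<Sum>i<?n. norm u * norm (y i))"
      unfolding S_def
    proof (rule sum_norm_le)
      fix i assume "i \<in> {..<?n}"
      then have "\<bar>inner u (?e i)\<bar> \<le> norm u"
        using Cauchy_Schwarz_ineq2[of u "?e i"] onb_norm[OF e, of i] by simp
      then show "norm (inner u (?e i) *\<^sub>R y i) \<le> norm u * norm (y i)" by (simp add: mult_right_mono)
    qed
    also have "\<dots> \<le> norm u * B" by (simp add: B_def sum_distrib_left distrib_left)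
    also have "\<dots> \<le> \<rho>" using u(2) B by (simp add: field_simps)
    finally have "z + S u \<in> L" by (intro z(3) SE)
    then have "T (z + S u) \<in> T ` L" by blast
    then show "T z + u \<in> T ` L" by (simp add: linear_add[OF T_lin] TS[OF u(1)])
  qed
  have ball: "\<exists>x\<in>K. u = T (- a + x)" if u: "u \<in> E" "norm u \<le> vol E K powr (1 / ?n) / 160" for u
  proof -
    have "u \<in> T ` L"
    proof (rule isotropic_contains_ball[OF TL_body n _ _ u(1)])
      show "(LINT x:T ` L|lborel_on E. inner x \<xi>) = 0" if "\<xi> \<in> E" for \<xi>
      proof -
        have "(LINT x:T ` L|lborel_on E. inner x \<xi>) = (LINT x:L|lborel_on E. inner (T x) \<xi>)" by (rule image) simp
        also have "\<dots> = 0" unfolding TW L_def by (rule a(2)[OF WE])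
        finally show ?thesis .
      qed
      show "(LINT x:T ` L|lborel_on E. (inner x \<xi>)\<^sup>2) = s\<^sup>2" if "\<xi> \<in> E" "norm \<xi> = 1" for \<xi>
      proof -
        have "(LINT x:T ` L|lborel_on E. (inner x \<xi>)\<^sup>2) = (LINT x:L|lborel_on E. (inner (T x) \<xi>)\<^sup>2)" by (rule image) simp
        also have "\<dots> = q (W \<xi>) (W \<xi>)" by (simp add: TW q_def power2_eq_square)
        also have "\<dots> = s\<^sup>2" by (rule qW[OF that])
        finally show ?thesis .
      qed
      show "norm u \<le> vol E (T ` L) powr (1 / ?n) / 160" using u(2) by (simp add: volTL)
    qed
    then show ?thesis unfolding L_def by auto
  qed
  show thesis
    by (rule that[OF T_lin T_cont T_inj TE T_det T_distr S_lin S_img ST TS a(1) ball])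
qed

section \<open>Inner balls and surface area in the four positions\<close>

lemma surface_area_ball_0_bound:
  assumes K: "body K" and c: "c > 0"
    and ball: "\<And>u. u \<in> E \<Longrightarrow> norm u \<le> vol E K powr (1 / dim E) / c \<Longrightarrow> u \<in> K"
  shows "surface_area E K \<le> c * dim E * vol E K / vol E K powr (1 / dim E)"
proof (rule surface_area_ball_bound[OF K c, of 0])
  show "0 \<in> K" using c by (intro ball zero_E) simp
qed (use ball in simp)

text \<open>The competitor is the image of K under the volume preserving T. It is isotropic only
  after a translation, so its inner ball is centred at T a rather than at 0, which does not affect
  the surface area bound.\<close>

lemma minimal_surface_area_bound:
  assumes K: "body K" and n: "dim E \<ge> 1" and min: "minimal_surface_area_position E K"
  shows "surface_area E K \<le> 160 * dim E * vol E K / vol E K powr (1 / dim E)"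
proof -
  obtain T S a where T: "linear T" "continuous_on UNIV T" "inj_on T E" "\<And>x. T x \<in> E" "det_on E T = 1"
    "distr (lborel_on E) borel T = lborel_on E" and a: "a \<in> E"
    and ball: "\<And>u. u \<in> E \<Longrightarrow> norm u \<le> vol E K powr (1 / dim E) / 160 \<Longrightarrow> \<exists>x\<in>K. u = T (- a + x)"
    using isotropic_image[OF K n] by metis
  have "T \<in> SL_on E" using T by (auto simp: SL_on_def)
  then have le: "surface_area E K \<le> surface_area E (T ` K)"
    using min by (simp add: minimal_surface_area_position_def)
  have Tm: "T \<in> borel_measurable borel" using T(2) by (rule borel_measurable_continuous_onI)
  have cTK: "compact (T ` K)" using T(2) bodyD(2)[OF K]
    by (intro compact_continuous_image) (auto intro: continuous_on_subset)
  have vol: "vol E (T ` K) = vol E K" by (rule vol_image[OF Tm T(6,3) bodyD(1,2)[OF K] cTK])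
  have r: "vol E K powr (1 / dim E) / 160 > 0" using vol_body_pos[OF K] by simp
  have ball': "T a + u \<in> T ` K" if u: "u \<in> E" "norm u \<le> vol E K powr (1 / dim E) / 160" for u
  proof -
    obtain x where x: "x \<in> K" "u = T (- a + x)" using ball[OF u] by blast
    then have "T a + u = T (a + (- a + x))" by (simp only: linear_add[OF T(1)])
    then show ?thesis using x(1) by simp
  qed
  have Ta: "T a \<in> T ` K" using ball'[OF zero_E] r by simp
  have "body (T ` K)"
    using T(4) by (intro body_image[OF K T(2) _ _ r Ta ball'] convex_linear_image T(1) bodyD[OF K]) auto
  from surface_area_ball_bound[OF this _ Ta, of 160] ball' le show ?thesis by (simp add: vol)
qed

text \<open>The ball r B inside T (K - a) pulls back to the ellipsoid a + S (r B) in K, which has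
  the volume of r B. The maximal ellipsoid is a ball centred at 0, so its radius is at least
  r.\<close>

lemma john_contains_ball:
  assumes K: "body K" and n: "dim E \<ge> 1" and john: "john_position E K"
    and u: "u \<in> E" "norm u \<le> vol E K powr (1 / dim E) / 160"
  shows "u \<in> K"
proof -
  obtain T S a where T: "linear T" "continuous_on UNIV T" "inj_on T E" "\<And>x. T x \<in> E"
    "distr (lborel_on E) borel T = lborel_on E" and S: "linear S" "S ` E = E" "\<And>x. x \<in> E \<Longrightarrow> S (T x) = x" "\<And>x. x \<in> E \<Longrightarrow> T (S x) = x" and a: "a \<in> E"
    and ball: "\<And>u. u \<in> E \<Longrightarrow> norm u \<le> vol E K powr (1 / dim E) / 160 \<Longrightarrow> \<exists>x\<in>K. u = T (- a + x)"
    using isotropic_image[OF K n] by metis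
  define r where "r = vol E K powr (1 / dim E) / 160"
  have r: "r > 0" using vol_body_pos[OF K] by (simp add: r_def)
  obtain \<rho> where \<rho>: "\<rho> > 0" "is_arg_max (vol E) (\<lambda>D. D \<in> ellipsoids E \<and> D \<subseteq> K) (E \<inter> cball 0 \<rho>)"
    using john unfolding john_position_def by blast
  define D where "D = (\<lambda>x. a + r *\<^sub>R S x) ` (E \<inter> cball 0 1)"
  have lin: "linear (\<lambda>x. r *\<^sub>R S x)" using linear_compose_scale_right[OF S(1)] .
  have "(\<lambda>x. r *\<^sub>R S x) ` E = E"
  proof -
    have "(\<lambda>x. r *\<^sub>R S x) ` E = (*\<^sub>R) r ` E" using S(2) by (simp add: image_image[symmetric])
    also have "\<dots> = E"
    proof (intro equalityI subsetI)
      fix x assume "x \<in> E"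
      then have "(1 / r) *\<^sub>R x \<in> E" by (rule subspace_scale[OF subspace])
      then show "x \<in> (*\<^sub>R) r ` E" using r by (intro image_eqI[of _ _ "(1 / r) *\<^sub>R x"]) auto
    qed (auto intro: subspace_scale[OF subspace])
    finally show ?thesis .
  qed
  with lin a have "D \<in> ellipsoids E"
    unfolding D_def ellipsoids_def
    by (intro CollectI exI[of _ a] exI[of _ "\<lambda>x. r *\<^sub>R S x"] conjI refl)
  moreover have "D \<subseteq> K"
  proof
    fix y assume "y \<in> D"
    then obtain x where x: "x \<in> E" "norm x \<le> 1" "y = a + r *\<^sub>R S x" unfolding D_def by auto
    have "norm (r *\<^sub>R x) \<le> vol E K powr (1 / dim E) / 160" using x r by (simp add: mult_left_le flip: r_def)
    from ball[OF subspace_scale[OF subspace x(1)] this]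
    obtain k where k: "k \<in> K" "r *\<^sub>R x = T (- a + k)" by blast
    have "r *\<^sub>R S x = S (T (- a + k))" using k(2) by (simp flip: linear_scale[OF S(1)])
    also have "\<dots> = - a + k" using k(1) a bodyD(1)[OF K] by (intro S subspace_add subspace subspace_neg) auto
    finally show "y \<in> K" using x k by simp
  qed
  ultimately have not: "\<not> vol E D > vol E (E \<inter> cball 0 \<rho>)" and in_K: "E \<inter> cball 0 \<rho> \<subseteq> K"
    using \<rho>(2) unfolding is_arg_max_def by blast+
  have [measurable]: "T \<in> borel_measurable borel" using T(2) by (rule borel_measurable_continuous_onI)
  \<comment> \<open>Once D is a preimage under T, its volume follows from the invariance of the
    measure under T.\<close>
  have D_eq: "D = E \<inter> {y. T (- a + y) \<in> cball 0 r}"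
  proof (intro equalityI subsetI)
    fix y assume "y \<in> D"
    then obtain x where x: "x \<in> E" "norm x \<le> 1" "y = a + r *\<^sub>R S x" unfolding D_def by auto
    have SxE: "S x \<in> E" using S(2) x(1) by blast
    show "y \<in> E \<inter> {y. T (- a + y) \<in> cball 0 r}"
      using x r a SxE by (auto simp: linear_scale[OF T(1)] S(4) mult_left_le intro!: subspace_add subspace subspace_scale)
  next
    fix y assume y: "y \<in> E \<inter> {y. T (- a + y) \<in> cball 0 r}"
    let ?x = "(1 / r) *\<^sub>R T (- a + y)"
    have "- a + y \<in> E" using y a by (intro subspace_add subspace subspace_neg) auto
    then have "y = a + r *\<^sub>R S ?x" using r S(3) by (simp add: linear_scale[OF S(1)])
    moreover have "?x \<in> E \<inter> cball 0 1" using y r T(4) by (auto intro!: subspace_scale subspace)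
    ultimately show "y \<in> D" unfolding D_def by blast
  qed
  have em: "emeasure (lborel_on E) {y. T (- a + y) \<in> cball 0 r} = emeasure (lborel_on E) (cball 0 r)"
  proof -
    have "{y. T (- a + y) \<in> cball 0 r} = {y. - a + y \<in> T -` cball 0 r}" by auto
    also have "emeasure (lborel_on E) \<dots> = emeasure (lborel_on E) (T -` cball 0 r)"
      using a measurable_sets[of T borel borel "cball 0 r"] subspace_neg[OF subspace] by (intro emeasure_translate) auto
    also have "\<dots> = emeasure (distr (lborel_on E) borel T) (cball 0 r)" by (subst emeasure_distr) auto
    finally show ?thesis by (simp only: T(5))
  qed
  have "{y. T (- a + y) \<in> cball 0 r} \<in> sets borel"
    using measurable_sets[of "\<lambda>y. T (- a + y)" borel borel "cball 0 r"] by (simp add: vimage_def)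
  from vol_E_Int[OF this] have "vol E D = vol E {y. T (- a + y) \<in> cball 0 r}" unfolding D_eq .
  with em have "vol E D = vol E (cball 0 r)" by (simp only: vol_def measure_def)
  with not have "r ^ dim E * vol E (cball 0 1) \<le> \<rho> ^ dim E * vol E (cball 0 1)"
    by (simp add: vol_E_Int vol_cball[OF r] vol_cball[OF \<rho>(1)])
  moreover have "vol E (cball 0 1) > 0" using emeasure_cball_pos[of 1] by (simp add: emeasure_eq_vol)
  ultimately have "r ^ dim E \<le> \<rho> ^ dim E" by simp
  then have "r \<le> \<rho>" using \<rho>(1) r n power_strict_mono[of \<rho> r "dim E"] by linarith
  then show ?thesis using in_K u by (auto simp: r_def)
qed

text \<open>A point u outside K with |u| <= t, together with symmetry, confines K to the slab |<x,
  xi>| <= t. The ellipsoid b |x|^2 + 2 <x, xi>^2 <= R^2 then contains K and has smaller volume than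
  the ball of radius R: it is slightly longer across xi but much shorter along xi.\<close>

lemma symmetric_loewner_contains_ball:
  assumes K: "body K" and n: "dim E \<ge> 1" and sym: "symmetric K" and loew: "loewner_position E K"
    and u: "u \<in> E" "norm u \<le> vol E K powr (1 / dim E) / 160"
  shows "u \<in> K"
proof (rule ccontr)
  assume "u \<notin> K"
  let ?n = "dim E" and ?\<omega> = "vol E (cball 0 1)"
  obtain R where R: "R > 0" "is_arg_min (vol E) (\<lambda>D. D \<in> ellipsoids E \<and> K \<subseteq> D) (E \<inter> cball 0 R)"
    using loew unfolding loewner_position_def by blast
  then have KR: "K \<subseteq> E \<inter> cball 0 R" and min: "\<And>D. D \<in> ellipsoids E \<Longrightarrow> K \<subseteq> D \<Longrightarrow> \<not> vol E D < vol E (E \<inter> cball 0 R)"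
    unfolding is_arg_min_def by blast+
  have np: "real ?n > 0" using n by simp
  \<comment> \<open>The radius |K|^(1/n) / 160 is at most this t, since |K| <= |R B| <= (6 R / sqrt
    n)^n and 6 / 160 <= 1 / 2.\<close>
  define t where "t = R / (2 * sqrt ?n)"
  have t: "t > 0" "t\<^sup>2 * (4 * ?n) = R\<^sup>2" using R np by (simp_all add: t_def power_divide power_mult_distrib)
  have ut: "norm u \<le> t"
  proof -
    have "vol E K \<le> vol E (cball 0 R)" using KR by (intro vol_mono) auto
    also have "\<dots> \<le> R ^ ?n * (2 * exp 1 / sqrt ?n) ^ ?n"
      unfolding vol_cball[OF R(1)] using R by (intro mult_left_mono vol_unit_ball n) auto
    also have "\<dots> = (R * (2 * exp 1 / sqrt ?n)) ^ ?n" by (simp only: power_mult_distrib)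
    finally have "vol E K powr (1 / ?n) \<le> ((R * (2 * exp 1 / sqrt ?n)) ^ ?n) powr (1 / ?n)"
      by (intro powr_mono2) auto
    also have "\<dots> = R * (2 * exp 1 / sqrt ?n)"
      using R np by (simp add: powr_powr flip: powr_realpow)
    also have "\<dots> \<le> R * (6 / sqrt ?n)"
      using R np exp_le by (intro mult_left_mono divide_right_mono) auto
    finally have "vol E K powr (1 / ?n) / 160 \<le> R * (6 / sqrt ?n) / 160" by (rule divide_right_mono) simp
    also have "\<dots> \<le> t" using R np by (simp add: t_def field_simps)
    finally show ?thesis using u by simp
  qed
  obtain p w where pw: "\<And>x. p x \<in> K" "\<And>x. x = p x + infdist x K *\<^sub>R w x"
    "\<And>x. x \<in> E \<Longrightarrow> x \<notin> K \<Longrightarrow> w x \<in> E \<and> norm (w x) = 1"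
    "\<And>x z. z \<in> K \<Longrightarrow> inner (w x) (z - p x) \<le> 0"
    using outer_normal[OF K] by blast
  define \<xi> where "\<xi> = w u"
  have \<xi>: "\<xi> \<in> E" "norm \<xi> = 1" using pw(3)[OF u(1) \<open>u \<notin> K\<close>] by (auto simp: \<xi>_def)
  have le: "inner x \<xi> \<le> t" if "x \<in> K" for x
  proof -
    have "inner x \<xi> \<le> inner (p u) \<xi>"
      using pw(4)[OF that, of u] by (simp add: inner_diff_right inner_commute \<xi>_def)
    also have "\<dots> \<le> inner (p u + infdist u K *\<^sub>R \<xi>) \<xi>"
      by (simp add: inner_add_left infdist_nonneg)
    also have "\<dots> = inner u \<xi>" using pw(2)[of u] by (simp add: \<xi>_def)
    also have "\<dots> \<le> norm u" using norm_cauchy_schwarz[of u \<xi>] \<xi> by simp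
    finally show ?thesis using ut by simp
  qed
  have slab: "(inner x \<xi>)\<^sup>2 \<le> t\<^sup>2" if "x \<in> K" for x
  proof -
    have "- x \<in> K" using sym that unfolding symmetric_def by (metis image_eqI)
    then have "\<bar>inner x \<xi>\<bar> \<le> \<bar>t\<bar>" using le[OF that] le[of "- x"] by simp
    then show ?thesis by (simp only: abs_le_square_iff)
  qed
  \<comment> \<open>b is determined by b + 2 t^2 / R^2 = 1 with t^2 = R^2 / (4 n). The coefficient
    along xi is c = b + 2, so the semi-axes are R / sqrt b across xi and R / sqrt c along
    it.\<close>
  define b where "b = 1 - 1 / (2 * real ?n)"
  define c where "c = 3 - 1 / (2 * real ?n)"
  have bc: "b \<ge> 1 / 2" "c \<ge> 2" "c = b + 2" using n by (auto simp: b_def c_def field_simps)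
  define m where "m = dim (perp E \<xi>)"
  have nm: "?n = Suc m" unfolding m_def by (rule perp_frame_onb(1)[OF \<xi>])
  define e where "e = perp_frame \<xi>"
  have e: "is_onb E e" unfolding e_def by (rule perp_frame_onb(2)[OF \<xi>])
  have em: "e m = \<xi>" by (simp add: e_def perp_frame_def[OF \<xi>] m_def)
  \<comment> \<open>Reciprocals of the semi-axes: \<open>M\<close> maps the new ellipsoid to the
    unit ball of \<open>E\<close>, and \<open>T\<close> is its inverse on \<open>E\<close>.\<close>
  define \<mu> where "\<mu> i = sqrt (if i = m then c else b) / R" for i :: nat
  have \<mu>: "\<mu> i > 0" for i using bc R by (simp add: \<mu>_def)
  define M where "M x = (\<Sum>i<?n. inner x (\<mu> i *\<^sub>R e i) *\<^sub>R e i)" for x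
  define T where "T x = (\<Sum>i<?n. inner x ((1 / \<mu> i) *\<^sub>R e i) *\<^sub>R e i)" for x
  have T_lin: "linear T"
    unfolding T_def by (rule linearI) (simp_all add: inner_add_left scaleR_add_left sum.distrib scaleR_sum_right add_divide_distrib)
  have ME: "M x \<in> E" and TE: "T x \<in> E" for x unfolding M_def T_def by (rule onb_comb_mem[OF e])+
  have M_i: "inner (M x) (e i) = \<mu> i * inner x (e i)" and T_i: "inner (T x) (e i) = inner x (e i) / \<mu> i" if "i < ?n" for x i
    unfolding M_def T_def by (simp_all add: onb_comb_inner[OF e that])
  have eqI: "x = y" if "x \<in> E" "y \<in> E" "\<And>i. i < ?n \<Longrightarrow> inner x (e i) = inner y (e i)" for x y
    using onb_expand[OF e that(1)] onb_expand[OF e that(2)] that(3) by (metis (no_types, lifting) lessThan_iff sum.cong)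
  have TM: "T (M x) = x" and MT: "M (T x) = x" if "x \<in> E" for x
    using \<mu> that by (auto intro!: eqI TE ME simp: M_i T_i less_imp_neq[OF \<mu>, symmetric])
  have Mm[measurable]: "M \<in> borel_measurable borel" unfolding M_def by measurable
  define D where "D = (\<lambda>x. 0 + T x) ` (E \<inter> cball 0 1)"
  have "T ` E = E" using TM TE ME by (metis image_eqI image_subsetI subsetI subset_antisym)
  with T_lin zero_E have D_ell: "D \<in> ellipsoids E"
    unfolding D_def ellipsoids_def by (intro CollectI exI[of _ 0] exI[of _ T] conjI refl)
  have D_eq: "D = E \<inter> {x. M x \<in> cball 0 1}"
  proof (intro equalityI subsetI)
    fix x assume "x \<in> E \<inter> {x. M x \<in> cball 0 1}"
    then show "x \<in> D" unfolding D_def using TM[of x] ME[of x] by (intro image_eqI[of _ _ "M x"]) auto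
  qed (auto simp: D_def MT TE)
  have "K \<subseteq> D"
  proof
    fix x assume x: "x \<in> K"
    then have xE: "x \<in> E" and xR: "norm x \<le> R" using KR by auto
    have "(norm (M x))\<^sup>2 = (\<Sum>i<?n. (\<mu> i)\<^sup>2 * (inner x (e i))\<^sup>2)"
      unfolding onb_norm_expand[OF e ME] by (intro sum.cong refl) (simp add: M_i power_mult_distrib)
    also have "\<dots> = (\<Sum>i<?n. b / R\<^sup>2 * (inner x (e i))\<^sup>2 + (if i = m then 2 / R\<^sup>2 * (inner x (e i))\<^sup>2 else 0))"
      using bc by (intro sum.cong refl) (auto simp: \<mu>_def power_divide add_divide_distrib algebra_simps)
    also have "\<dots> = b / R\<^sup>2 * (norm x)\<^sup>2 + 2 / R\<^sup>2 * (inner x \<xi>)\<^sup>2"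
      using nm by (simp add: sum.distrib em onb_norm_expand[OF e xE] sum_distrib_left
          sum_divide_distrib distrib_left add_divide_distrib)
    also have "\<dots> \<le> b / R\<^sup>2 * R\<^sup>2 + 2 / R\<^sup>2 * t\<^sup>2"
      using bc xR by (intro add_mono mult_left_mono slab[OF x] power_mono) auto
    also have "\<dots> = b + 1 / (2 * ?n)"
      unfolding t(2)[symmetric] using t(1) np by (simp add: field_simps)
    also have "\<dots> = 1" by (simp add: b_def)
    finally have "(norm (M x))\<^sup>2 \<le> 1\<^sup>2" by simp
    then have "norm (M x) \<le> 1" by (rule power2_le_imp_le) simp
    then show "x \<in> D" unfolding D_eq using xE by simp
  qed
  then have not: "vol E (E \<inter> cball 0 R) \<le> vol E D" using min[OF D_ell] by simp
  have \<mu>_prod: "(\<Prod>i<?n. inner (\<mu> i *\<^sub>R e i) (e i)) = sqrt (b ^ m * c) / R ^ ?n"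
  proof -
    have "(\<Prod>i<?n. inner (\<mu> i *\<^sub>R e i) (e i)) = (\<Prod>i<?n. \<mu> i)"
      by (intro prod.cong refl) (simp add: onb_inner[OF e])
    also have "\<dots> = (\<Prod>i<m. sqrt b / R) * (sqrt c / R)" unfolding nm by (simp add: \<mu>_def)
    also have "\<dots> = sqrt (b ^ m * c) / R ^ ?n"
      by (simp add: nm power_divide real_sqrt_mult real_sqrt_power)
    finally show ?thesis .
  qed
  have "ennreal (\<Prod>i<?n. inner (\<mu> i *\<^sub>R e i) (e i)) * emeasure (lborel_on E) {x. M x \<in> cball 0 1}
    = emeasure (lborel_on E) (cball 0 1)"
    unfolding M_def using \<mu>
    by (intro emeasure_triangular e) (auto simp: onb_inner[OF e] intro!: subspace_scale subspace onb_mem[OF e])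
  moreover have "emeasure (lborel_on E) {x. M x \<in> cball 0 1} = emeasure (lborel_on E) D"
    unfolding D_eq by (rule emeasure_E_cong) (measurable, auto)
  moreover have "bounded D"
  proof -
    have "compact D" unfolding D_def by (intro compact_continuous_image compact_E_cball) (auto simp: T_def less_imp_neq[OF \<mu>, symmetric] intro!: continuous_intros)
    then show ?thesis by (rule compact_imp_bounded)
  qed
  ultimately have "ennreal (sqrt (b ^ m * c) / R ^ ?n) * ennreal (vol E D) = ennreal ?\<omega>"
    unfolding \<mu>_prod by (simp add: emeasure_eq_vol)
  then have volD: "sqrt (b ^ m * c) / R ^ ?n * vol E D = ?\<omega>"
    using bc R by (simp flip: ennreal_mult)
  \<comment> \<open>Bernoulli's inequality gives b^(n - 1) >= 1 - (n - 1) / (2 n) > 1 / 2, and c >=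
    2 outweighs this loss.\<close>
  have big: "sqrt (b ^ m * c) > 1"
  proof -
    have "1 / 2 < 1 + real m * (- 1 / (2 * real ?n))" unfolding nm by (simp add: field_simps)
    also have "\<dots> \<le> (1 + - 1 / (2 * real ?n)) ^ m"
      using np n by (intro Bernoulli_inequality) (simp add: field_simps)
    also have "\<dots> = b ^ m" by (simp add: b_def)
    finally have "1 / 2 * 2 < b ^ m * c" using bc by (intro mult_less_le_imp_less) auto
    then show ?thesis by simp
  qed
  have \<omega>: "?\<omega> > 0" using emeasure_cball_pos[of 1] by (simp add: emeasure_eq_vol)
  have "vol E (E \<inter> cball 0 R) = R ^ ?n * ?\<omega>" by (simp add: vol_E_Int vol_cball[OF R(1)])
  also have "\<dots> = sqrt (b ^ m * c) * vol E D" using volD R by (simp add: field_simps)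
  also have "\<dots> > 1 * vol E D"
  proof (rule mult_strict_right_mono[OF big])
    show "0 < vol E D"
    proof (rule order_le_neq_trans[OF vol_nonneg not_sym])
      show "vol E D \<noteq> 0" using volD \<omega> by auto
    qed
  qed
  finally show False using not by simp
qed

lemma isotropic_position_contains_ball:
  assumes K: "body K" and n: "dim E \<ge> 1" and iso: "isotropic_position E K"
    and u: "u \<in> E" "norm u \<le> vol E K powr (1 / dim E) / 160"
  shows "u \<in> K"
proof -
  obtain L where L: "\<And>\<xi>. \<xi> \<in> E \<Longrightarrow> norm \<xi> = 1 \<Longrightarrow> (LINT x:K|lborel_on E. (inner x \<xi>)\<^sup>2) = L\<^sup>2"
    using iso unfolding isotropic_position_def by blast
  show ?thesis
    by (rule isotropic_contains_ball[OF K n _ L u]) (use iso in \<open>auto simp: isotropic_position_def centered_def\<close>)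
qed

end

theorem theorem4p10:
  shows "\<exists>c2::real. c2 > 0 \<and>
    (\<forall>n\<ge>2. \<forall>K. convex_body (Rn n) K \<longrightarrow>
      minimal_surface_area_position (Rn n) K \<or> isotropic_position (Rn n) K \<or>
      john_position (Rn n) K \<or> (symmetric K \<and> loewner_position (Rn n) K) \<longrightarrow>
      vol (Rn n) K powr (1 / real n) *
        (LINT \<xi>|sphere_measure (Rn n). surface_area (perp (Rn n) \<xi>) (perp_proj \<xi> ` K))
      \<le> c2 * sqrt (real n) * surface_area (Rn n) K)"
proof (intro exI[of _ 160] conjI allI impI)
  fix n :: nat and K
  assume n: "2 \<le> n" and K: "convex_body (Rn n) K" and pos: "minimal_surface_area_position (Rn n) K \<or> isotropic_position (Rn n) K \<or>
      john_position (Rn n) K \<or> (symmetric K \<and> loewner_position (Rn n) K)"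
  interpret fd_subspace "Rn n"
    by standard (use subspace_Rn[of n] Rn_eq_span[of n] in auto)
  have body: "body K" by (rule convex_body_body[OF K])
  have dim: "dim (Rn n) \<ge> 1" using n by (simp add: dim_Rn)
  \<comment> \<open>The constant is that of the ball in an isotropic body, and it serves all four
    positions.\<close>
  have "surface_area (Rn n) K \<le> 160 * dim (Rn n) * vol (Rn n) K / vol (Rn n) K powr (1 / dim (Rn n))"
    using pos
  proof (elim disjE conjE)
    assume "minimal_surface_area_position (Rn n) K"
    then show ?thesis by (rule minimal_surface_area_bound[OF body dim])
  next
    assume "isotropic_position (Rn n) K"
    then show ?thesis by (intro surface_area_ball_0_bound body isotropic_position_contains_ball[OF body dim]) auto
  next
    assume "john_position (Rn n) K"
    then show ?thesis by (intro surface_area_ball_0_bound body john_contains_ball[OF body dim]) auto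
  next
    assume "symmetric K" "loewner_position (Rn n) K"
    then show ?thesis by (intro surface_area_ball_0_bound body symmetric_loewner_contains_ball[OF body dim]) auto
  qed
  from projection_bound[OF body dim _ this]
  show "vol (Rn n) K powr (1 / real n) * (LINT \<xi>|sphere_measure (Rn n). surface_area (perp (Rn n) \<xi>) (perp_proj \<xi> ` K))
    \<le> 160 * sqrt (real n) * surface_area (Rn n) K"
    by (simp add: dim_Rn)
qed simp

end
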